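(* Consider the Gaussian sequence model $Y_{lk}=\beta^0_{lk}+\varepsilon_{lk}/\sqrt n$, with $\varepsilon_{lk}$ i.i.d. $\mathcal N(0,1)$, where $\beta^0_{lk}=\int_0^1 f_0\psi_{lk}$ are the Haar coefficients of $f_0$, and put on $f=\sum_{l\le L_{max}}\sum_k\beta_{lk}\psi_{lk}$ the Bayesian CART prior $\Pi$ with split probabilities $p_l=\Gamma^{-l}$ (defined in the context). There exists $\Gamma_0>0$ such that for every fixed $\Gamma\ge\Gamma_0$ the following holds. Let $t,M,\eta:[0,1]\to(0,\infty)$ be functions such that $M(\cdot)$ and $\eta(\cdot)$ are bounded and uniformly bounded away from zero and $0<t_1\le\inf_{x\in[0,1]}t(x)$, $t(\cdot)\le 1$, for some constant $t_1$. Let $\zeta_n(x)=(n/\log n)^{t(x)/(2t(x)+1)}$. Then for every sequence $M_n\to\infty$ with $M_n/\sqrt{\log n}\to\infty$, $$\sup_{f_0\in\mathcal C(t,M,\eta)}E_{f_0}\,\Pi\Big[f:\ \sup_{x\in[0,1]}\zeta_n(x)|f(x)-f_0(x)|>M_n\,\Big|\,Y\Big]\longrightarrow 0\quad(n\to\infty).$$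
   Context: Haar system: $\psi_{-1,0}=\mathbb I_{[0,1]}$ and, for $l\ge0$, $0\le k<2^l$, $\psi_{lk}(x)=2^{l/2}\psi(2^lx-k)$ with $\psi=\mathbb I_{(0,1/2]}-\mathbb I_{(1/2,1]}$; $I_{lk}=(k2^{-l},(k+1)2^{-l}]$. Convention: the point $0$ is added to $I_{l0}$ and $\psi_{l0}(0)=2^{l/2}$. Indices $(l,k)$ range over $(-1,0)$ and $l\ge0$, $0\le k<2^l$. Local Hölder class: $\mathcal C(t,M,\eta)$ is the set of $f:[0,1]\to\mathbb R$ such that for every $x\in[0,1]$, $\max\big(\|f\|_\infty,\ \sup_{0<|m|\le\eta(x),\,x+m\in[0,1]}|f(x+m)-f(x)|/|m|^{t(x)}\big)\le M(x)$. Bayesian CART prior: let $L_{max}=\lfloor\log_2 n\rfloor$. A (full binary) tree $\mathcal T$ is a finite set of nodes $(l,k)$, $0\le l\le L_{max}$, $0\le k<2^l$, containing the root $(0,0)$, such that $(l,k)\in\mathcal T$ implies $(j,\lfloor k/2^{l-j}\rfloor)\in\mathcal T$ for $0\le j<l$, and such that each node has either both or none of its children $(l+1,2k),(l+1,2k+1)$ in $\mathcal T$. Internal nodes $\mathcal T_{int}$: the nodes having both children in $\mathcal T$, together with $(-1,0)$. External nodes: $\mathcal T_{ext}=\mathcal T\setminus\mathcal T_{int}$. The prior $\Pi_{\mathcal T}$ on trees is the Galton–Watson-type law: starting from the root, each node $(l,k)$ present in the tree with $l<L_{max}$ is split (becomes internal, i.e. both children are added) independently with probability $p_l=\Gamma^{-l}$;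 nodes of depth $L_{max}$ are not split. Given $\mathcal T$, the coefficients $\beta_{lk}$, $(l,k)\in\mathcal T_{int}$, are i.i.d. $\mathcal N(0,1)$ and $\beta_{lk}=0$ for $(l,k)\notin\mathcal T_{int}$. $\Pi[\cdot\mid Y]$ is the posterior in the sequence model, and $E_{f_0}$ is expectation when $Y$ is generated from $f_0$. *)

theory Defs
  imports "HOL-Probability.Probability" "HOL-Probability.Product_PMF"
begin

section \<open>Haar system on the unit interval\<close>

text \<open>
  A node is a pair \<open>(l, k)\<close> with level \<open>l :: int\<close> (the level \<open>-1\<close> is used only for the constant
  function) and position \<open>k :: nat\<close>.
\<close>

type_synonym node = "int \<times> nat"

definition haar_index :: "node set" where
  "haar_index = insert (-1, 0) {(l, k). 0 \<le> l \<and> k < 2 ^ nat l}"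

definition haar_mother :: "real \<Rightarrow> real" where
  "haar_mother x = indicator {0<..1/2} x - indicator {1/2<..1} x"

text \<open>
  The half-open dyadic intervals do not contain \<open>0\<close>; the middle case adds it to the leftmost
  interval of each level.
\<close>

definition haar :: "node \<Rightarrow> real \<Rightarrow> real" where
  "haar = (\<lambda>(l, k) x.
     if l = -1 then indicator {0..1} x
     else if k = 0 \<and> x = 0 then 2 powr (l / 2)
     else 2 powr (l / 2) * haar_mother (2 powr l * x - k))"

definition haar_coeff :: "(real \<Rightarrow> real) \<Rightarrow> node \<Rightarrow> real" where
  "haar_coeff f v = (LINT x:{0..1}|lborel. f x * haar v x)"

definition haar_sum :: "int \<Rightarrow> (node \<Rightarrow> real) \<Rightarrow> real \<Rightarrow> real" where
  "haar_sum L \<beta> x = (\<Sum>v\<in>{v \<in> haar_index. fst v \<le> L}. \<beta> v * haar v x)"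


section \<open>Local Hoelder classes\<close>

text \<open>
  Functions on the unit interval are represented by functions on the reals of which only the values
  on \<open>{0..1}\<close> matter. The suprema are taken in the extended reals, so that unbounded functions are
  excluded.
\<close>

definition local_Hoelder ::
    "(real \<Rightarrow> real) \<Rightarrow> (real \<Rightarrow> real) \<Rightarrow> (real \<Rightarrow> real) \<Rightarrow> (real \<Rightarrow> real) set" where
  "local_Hoelder t M \<eta> = {f. \<forall>x\<in>{0..1}.
     max (SUP y\<in>{0..1}. ereal \<bar>f y\<bar>)
         (SUP m\<in>{m. 0 < \<bar>m\<bar> \<and> \<bar>m\<bar> \<le> \<eta> x \<and> x + m \<in> {0..1}}.
            ereal (\<bar>f (x + m) - f x\<bar> / \<bar>m\<bar> powr t x))
     \<le> ereal (M x)}"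


section \<open>Bayesian CART prior\<close>

definition children :: "node \<Rightarrow> node set" where
  "children = (\<lambda>(l, k). {(l + 1, 2 * k), (l + 1, 2 * k + 1)})"

definition full_binary_tree :: "int \<Rightarrow> node set \<Rightarrow> bool" where
  "full_binary_tree L T \<longleftrightarrow>
     finite T \<and>
     (\<forall>(l, k)\<in>T. 0 \<le> l \<and> l \<le> L \<and> k < 2 ^ nat l) \<and>
     (0, 0) \<in> T \<and>
     (\<forall>(l, k)\<in>T. \<forall>j. 0 \<le> j \<and> j < l \<longrightarrow> (j, k div 2 ^ nat (l - j)) \<in> T) \<and>
     (\<forall>v\<in>T. children v \<subseteq> T \<or> children v \<inter> T = {})"

definition internal_nodes :: "node set \<Rightarrow> node set" where
  "internal_nodes T = insert (-1, 0) {v \<in> T. children v \<subseteq> T}"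

text \<open>
  The branching process, one generation at a time: in step \<open>l\<close> each node of level \<open>l\<close> present in the
  tree is split independently with probability \<open>\<Gamma> powi (- l)\<close>.
\<close>

primrec galton_watson :: "real \<Rightarrow> nat \<Rightarrow> node set pmf" where
  "galton_watson \<Gamma> 0 = return_pmf {(0, 0)}"
| "galton_watson \<Gamma> (Suc l) =
     bind_pmf (galton_watson \<Gamma> l) (\<lambda>T.
       map_pmf (\<lambda>split. T \<union> (\<Union>v\<in>{v \<in> T. fst v = int l \<and> split v}. children v))
         (Pi_pmf {v \<in> T. fst v = int l} False (\<lambda>_. bernoulli_pmf (\<Gamma> powi (- int l)))))"

definition L_max :: "nat \<Rightarrow> int" where
  "L_max n = \<lfloor>log 2 n\<rfloor>"

definition tree_prior :: "real \<Rightarrow> nat \<Rightarrow> node set pmf" where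
  "tree_prior \<Gamma> n = galton_watson \<Gamma> (nat (L_max n))"

abbreviation std_normal :: "real measure" where
  "std_normal \<equiv> density lborel std_normal_density"

definition coeff_prior :: "node set \<Rightarrow> (node \<Rightarrow> real) measure" where
  "coeff_prior T =
     PiM haar_index (\<lambda>v. if v \<in> internal_nodes T then std_normal else return borel 0)"

text \<open>The prior on the function \<open>haar_sum (L_max n) \<beta>\<close> is given through its coefficients \<open>\<beta>\<close>.\<close>

definition cart_prior :: "real \<Rightarrow> nat \<Rightarrow> (node \<Rightarrow> real) measure" where
  "cart_prior \<Gamma> n = measure_pmf (tree_prior \<Gamma> n) \<bind> coeff_prior"


section \<open>Gaussian sequence model and posterior\<close>

definition sequence_model :: "nat \<Rightarrow> (node \<Rightarrow> real) \<Rightarrow> (node \<Rightarrow> real) measure" where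
  "sequence_model n \<beta> =
     distr (PiM haar_index (\<lambda>_. std_normal)) (PiM haar_index (\<lambda>_. borel))
       (\<lambda>\<epsilon>. \<lambda>v\<in>haar_index. \<beta> v + \<epsilon> v / sqrt n)"

text \<open>
  Under the prior the coefficients above level \<open>L_max n\<close> vanish, so the law of the observations
  \<open>Y v\<close> above that level is free of the parameter. Their densities cancel in Bayes' formula and are
  left out.
\<close>

definition likelihood :: "nat \<Rightarrow> (node \<Rightarrow> real) \<Rightarrow> (node \<Rightarrow> real) \<Rightarrow> real" where
  "likelihood n Y \<beta> =
     (\<Prod>v\<in>{v \<in> haar_index. fst v \<le> L_max n}. normal_density (\<beta> v) (1 / sqrt n) (Y v))"

definition posterior :: "real \<Rightarrow> nat \<Rightarrow> (node \<Rightarrow> real) \<Rightarrow> (node \<Rightarrow> real) measure" where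
  "posterior \<Gamma> n Y =
     density (cart_prior \<Gamma> n)
       (\<lambda>\<beta>. ennreal (likelihood n Y \<beta>) / (\<integral>\<^sup>+ \<beta>'. ennreal (likelihood n Y \<beta>') \<partial>cart_prior \<Gamma> n))"

definition local_rate :: "(real \<Rightarrow> real) \<Rightarrow> nat \<Rightarrow> real \<Rightarrow> real" where
  "local_rate t n x = (n / ln n) powr (t x / (2 * t x + 1))"


section \<open>Well-definedness\<close>

lemma galton_watson_full_binary_tree:
  "T \<in> set_pmf (galton_watson \<Gamma> L) \<Longrightarrow> full_binary_tree (int L) T"
proof (induction L arbitrary: T)
  case 0
  then show ?case by (auto simp: full_binary_tree_def children_def)
next
  case (Suc l)
  from Suc.prems obtain T0 split where T0: "T0 \<in> set_pmf (galton_watson \<Gamma> l)"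
    and T: "T = T0 \<union> (\<Union>v\<in>{v \<in> T0. fst v = int l \<and> split v}. children v)"
    by auto
  have tr: "full_binary_tree (int l) T0" by (rule Suc.IH[OF T0])
  then have fin: "finite T0" and bnd: "\<And>i k. (i, k) \<in> T0 \<Longrightarrow> 0 \<le> i \<and> i \<le> int l \<and> k < 2 ^ nat i"
    and root: "(0, 0) \<in> T0"
    and anc: "\<And>i k j. (i, k) \<in> T0 \<Longrightarrow> 0 \<le> j \<Longrightarrow> j < i \<Longrightarrow> (j, k div 2 ^ nat (i - j)) \<in> T0"
    and bin: "\<And>v. v \<in> T0 \<Longrightarrow> children v \<subseteq> T0 \<or> children v \<inter> T0 = {}"
    unfolding full_binary_tree_def by blast+
  have new: "(\<exists>k'. (int l, k') \<in> T0 \<and> split (int l, k') \<and> i = int l + 1 \<and> k div 2 = k')"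
    if "(i, k) \<in> T" "(i, k) \<notin> T0" for i k
    using that by (auto simp: T children_def)
  have mem_T: "(int l + 1, k) \<in> T \<longleftrightarrow> (int l, k div 2) \<in> T0 \<and> split (int l, k div 2)" for k
  proof
    assume "(int l + 1, k) \<in> T"
    then show "(int l, k div 2) \<in> T0 \<and> split (int l, k div 2)"
      using new[of "int l + 1" k] bnd[of "int l + 1" k] by auto
  next
    assume "(int l, k div 2) \<in> T0 \<and> split (int l, k div 2)"
    moreover have "(int l + 1, k) \<in> children (int l, k div 2)"
      unfolding children_def by (auto; presburger)
    ultimately show "(int l + 1, k) \<in> T" unfolding T by auto
  qed
  have "finite T" using fin by (auto simp: T children_def)
  moreover have "\<forall>(i, k)\<in>T. 0 \<le> i \<and> i \<le> int (Suc l) \<and> k < 2 ^ nat i"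
  proof clarify
    fix i k assume ik: "(i, k) \<in> T"
    show "0 \<le> i \<and> i \<le> int (Suc l) \<and> k < 2 ^ nat i"
    proof (cases "(i, k) \<in> T0")
      case True then show ?thesis using bnd[of i k] by auto
    next
      case False
      from new[OF ik False] have "(int l, k div 2) \<in> T0" "i = int l + 1" by auto
      with bnd[of "int l" "k div 2"] show ?thesis by (auto simp: nat_add_distrib)
    qed
  qed
  moreover have "(0, 0) \<in> T" using root by (simp add: T)
  moreover have "\<forall>(i, k)\<in>T. \<forall>j. 0 \<le> j \<and> j < i \<longrightarrow> (j, k div 2 ^ nat (i - j)) \<in> T"
  proof clarify
    fix i k j assume ik: "(i, k) \<in> T" and j: "0 \<le> (j::int)" "j < i"
    show "(j, k div 2 ^ nat (i - j)) \<in> T"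
    proof (cases "(i, k) \<in> T0")
      case True then show ?thesis using anc[of i k j] j by (simp add: T)
    next
      case False
      from new[OF ik False] have k: "(int l, k div 2) \<in> T0" and i: "i = int l + 1" by auto
      show ?thesis
      proof (cases "j = int l")
        case True then show ?thesis using k i by (simp add: T)
      next
        case False
        with j i have "j < int l" by auto
        moreover have "nat (i - j) = Suc (nat (int l - j))"
          using \<open>j < int l\<close> i by simp
        then have "k div 2 ^ nat (i - j) = k div 2 div 2 ^ nat (int l - j)"
          by (simp add: div_mult2_eq)
        ultimately show ?thesis using anc[OF k j(1)] by (simp add: T)
      qed
    qed
  qed
  moreover have "\<forall>v\<in>T. children v \<subseteq> T \<or> children v \<inter> T = {}"
  proof clarify
    fix i k assume ik: "(i, k) \<in> T" and no: "children (i, k) \<inter> T \<noteq> {}"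
    have "children (i, k) \<subseteq> T"
    proof (cases "(i, k) \<in> T0 \<and> children (i, k) \<inter> T0 \<noteq> {}")
      case True then show ?thesis using bin[of "(i, k)"] by (auto simp: T)
    next
      case False
      have "i = int l"
      proof -
        from no obtain k' where k': "(i + 1, k') \<in> children (i, k)" "(i + 1, k') \<in> T"
          by (auto simp: children_def)
        show ?thesis
        proof (cases "(i + 1, k') \<in> T0")
          case True
          then have "0 \<le> i \<or> i = -1" using bnd by fastforce
          have "i \<ge> 0" using ik new[of i k] bnd[of i k] by fastforce
          have "k' div 2 = k" using k'(1) by (auto simp: children_def)
          then have "(i, k) \<in> T0" using anc[OF True, of i] \<open>i \<ge> 0\<close> by simp
          then show ?thesis using False True k'(1) by blast
        next
          case False
          then show ?thesis using new[OF k'(2)] by auto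
        qed
      qed
      then show ?thesis using no by (auto simp: children_def mem_T)
    qed
    then show "x \<in> T" if "x \<in> children (i, k)" for x using that by blast
  qed
  ultimately show ?case unfolding full_binary_tree_def by blast
qed

lemma tree_prior_full_binary_tree:
  assumes "T \<in> set_pmf (tree_prior \<Gamma> n)" "n > 0"
  shows "full_binary_tree (L_max n) T"
proof -
  have "0 \<le> L_max n" using assms(2) by (simp add: L_max_def)
  then show ?thesis
    using galton_watson_full_binary_tree[of T \<Gamma> "nat (L_max n)"] assms(1)
    by (simp add: tree_prior_def)
qed

lemma finite_haar_index_le: "finite {v \<in> haar_index. fst v \<le> L}"
proof -
  have "{v \<in> haar_index. fst v \<le> L} \<subseteq> insert (-1,0) ({0..L} \<times> {..<2 ^ nat L})"
    by (auto simp: haar_index_def intro: order.strict_trans2 power_increasing)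
  then show ?thesis by (rule finite_subset) auto
qed

lemma prob_std_normal: "prob_space std_normal"
  by (rule prob_space_normal_density) simp

lemma sets_coeff_prior: "sets (coeff_prior T) = sets (PiM haar_index (\<lambda>_. borel))"
  unfolding coeff_prior_def by (intro sets_PiM_cong) auto

lemma prob_coeff_prior: "prob_space (coeff_prior T)"
  unfolding coeff_prior_def
  by (intro prob_space_PiM) (auto intro: prob_std_normal prob_space_return)

lemma measurable_coeff_prior: "coeff_prior \<in> measure_pmf P \<rightarrow>\<^sub>M prob_algebra (PiM haar_index (\<lambda>_. borel))"
  by (auto simp: measurable_def space_prob_algebra sets_coeff_prior prob_coeff_prior)

lemma prob_cart_prior: "prob_space (cart_prior \<Gamma> n)"
  unfolding cart_prior_def
  by (rule prob_space_bind'[of _ "measure_pmf _", OF _ measurable_coeff_prior])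
     (auto simp: space_prob_algebra measure_pmf.prob_space_axioms)

lemma sets_cart_prior: "sets (cart_prior \<Gamma> n) = sets (PiM haar_index (\<lambda>_. borel))"
  unfolding cart_prior_def
  by (rule sets_bind) (auto simp: sets_coeff_prior)

lemma measurable_likelihood: "likelihood n Y \<in> borel_measurable (cart_prior \<Gamma> n)"
  unfolding measurable_cong_sets[OF sets_cart_prior refl] likelihood_def normal_density_def
  by measurable

lemma prob_posterior: assumes "n > 0" shows "prob_space (posterior \<Gamma> n Y)"
proof
  interpret P: prob_space "cart_prior \<Gamma> n" by (rule prob_cart_prior)
  note [measurable] = measurable_likelihood
  let ?D = "\<integral>\<^sup>+ \<beta>'. ennreal (likelihood n Y \<beta>') \<partial>cart_prior \<Gamma> n"
  have pos: "likelihood n Y \<beta> > 0" for \<beta>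
    unfolding likelihood_def using assms by (auto intro!: prod_pos normal_density_pos)
  have "?D \<noteq> 0"
  proof
    assume "?D = 0"
    then have "AE \<beta> in cart_prior \<Gamma> n. ennreal (likelihood n Y \<beta>) = 0"
      by (subst (asm) nn_integral_0_iff_AE) auto
    then have "AE \<beta> in cart_prior \<Gamma> n. False"
      by eventually_elim (use pos in \<open>force simp: ennreal_eq_0_iff not_le[symmetric]\<close>)
    then show False using P.AE_False by simp
  qed
  moreover have "?D < \<infinity>"
  proof -
    define C where "C = (\<Prod>v\<in>{v \<in> haar_index. fst v \<le> L_max n}. 1 / sqrt (2 * pi * (1 / sqrt n)\<^sup>2))"
    have "likelihood n Y \<beta> \<le> C" for \<beta>
      unfolding likelihood_def C_def
      by (intro prod_mono) (auto simp: normal_density_def divide_simps)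
    then have "?D \<le> (\<integral>\<^sup>+ \<beta>'. ennreal C \<partial>cart_prior \<Gamma> n)"
      by (intro nn_integral_mono ennreal_leI)
    also have "\<dots> < \<infinity>" by (simp add: P.emeasure_space_1)
    finally show ?thesis .
  qed
  ultimately show "emeasure (posterior \<Gamma> n Y) (space (posterior \<Gamma> n Y)) = 1"
    unfolding posterior_def
    by (simp add: emeasure_density nn_integral_divide  ennreal_divide_self cong: nn_integral_cong)
qed

lemma sets_posterior_event:
  fixes r f0 :: "real \<Rightarrow> real"
  shows "{\<beta> \<in> space (posterior \<Gamma> n Y). (SUP x\<in>{0..1}. ereal (r x * \<bar>haar_sum (L_max n) \<beta> x - f0 x\<bar>)) > ereal c}
    \<in> sets (posterior \<Gamma> n Y)" (is "?E \<in> _")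
proof -
  define J where "J = {v \<in> haar_index. fst v \<le> L_max n}"
  have fJ: "finite J" unfolding J_def by (rule finite_haar_index_le)
  define U where "U = (\<Union>x\<in>{0..1}. {g :: node \<Rightarrow> real. r x * \<bar>(\<Sum>v\<in>J. g v * haar v x) - f0 x\<bar> > c})"
  have "open U" unfolding U_def
    by (intro open_UN ballI open_Collect_less continuous_intros continuous_on_product_coordinates)
  then have U: "U \<in> sets (PiM UNIV (\<lambda>_. borel))" by (simp add: sets_PiM_equal_borel)
  have sp: "sets (posterior \<Gamma> n Y) = sets (PiM haar_index (\<lambda>_. borel))"
    by (simp add: posterior_def sets_cart_prior)
  then have sp': "space (posterior \<Gamma> n Y) = space (PiM haar_index (\<lambda>_. borel))"
    by (rule sets_eq_imp_space_eq)
  define h where "h = (\<lambda>\<beta> :: node \<Rightarrow> real. \<lambda>v. if v \<in> J then \<beta> v else 0)"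
  have "h \<in> PiM haar_index (\<lambda>_. borel) \<rightarrow>\<^sub>M PiM UNIV (\<lambda>_. borel)"
    unfolding h_def
  proof (rule measurable_PiM_single')
    fix v :: node
    show "(\<lambda>\<beta>. if v \<in> J then \<beta> v else 0) \<in> borel_measurable (PiM haar_index (\<lambda>_. borel))"
      by (cases "v \<in> J") (auto simp: J_def)
  qed auto
  then have "h -` U \<inter> space (PiM haar_index (\<lambda>_. borel)) \<in> sets (PiM haar_index (\<lambda>_. borel))"
    using U by (rule measurable_sets)
  moreover have "?E = h -` U \<inter> space (PiM haar_index (\<lambda>_. borel))"
  proof -
    have "(\<Sum>v\<in>J. h \<beta> v * haar v x) = haar_sum (L_max n) \<beta> x" for \<beta> x
      unfolding haar_sum_def h_def J_def by (rule sum.cong) auto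
    then show ?thesis
      unfolding sp' by (force simp: less_SUP_iff U_def)
  qed
  ultimately show ?thesis by (simp add: sp)
qed

lemma measurable_emeasure_posterior:
  assumes E: "E \<in> sets (PiM haar_index (\<lambda>_. borel))"
  shows "(\<lambda>Y. emeasure (posterior \<Gamma> n Y) E) \<in> borel_measurable (sequence_model n b)"
proof -
  interpret P: prob_space "cart_prior \<Gamma> n" by (rule prob_cart_prior)
  note s = sets_cart_prior[of \<Gamma> n]
  have ss: "sets (sequence_model n b) = sets (PiM haar_index (\<lambda>_. borel))"
    by (simp add: sequence_model_def)
  have l: "(\<lambda>(Y, \<beta>). likelihood n Y \<beta>) \<in> borel_measurable (PiM haar_index (\<lambda>_. borel) \<Otimes>\<^sub>M cart_prior \<Gamma> n)"
    unfolding measurable_cong_sets[OF sets_pair_measure_cong[OF refl s] refl] likelihood_def normal_density_def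
    by measurable
  note [measurable] = l measurable_likelihood
  have [measurable]: "E \<in> sets (cart_prior \<Gamma> n)" using E s by simp
  have "emeasure (posterior \<Gamma> n Y) E = (\<integral>\<^sup>+ \<beta>. ennreal (likelihood n Y \<beta>) / (\<integral>\<^sup>+ \<beta>'. ennreal (likelihood n Y \<beta>') \<partial>cart_prior \<Gamma> n) * indicator E \<beta> \<partial>cart_prior \<Gamma> n)" for Y
    unfolding posterior_def by (subst emeasure_density) auto
  then show ?thesis unfolding measurable_cong_sets[OF ss refl]
    by simp
qed

lemma prob_sequence_model: "prob_space (sequence_model n b)"
  unfolding sequence_model_def
  by (rule prob_space.prob_space_distr[OF prob_space_PiM[OF prob_std_normal]]) measurable

end

theory Submission
  imports Defs
begin

text \<open>
  Write \<open>\<beta>\<^sup>0\<close> for the Haar coefficients of \<open>f\<^sub>0\<close>. By conjugacy, given the tree \<open>T\<close> the posterior makes the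
  internal coefficients independent normal variables, and the posterior weight of \<open>T\<close> is proportional to
  its prior probability times the product over its internal nodes of a marginal likelihood ratio, which
  at \<open>y\<close> equals \<open>exp (n\<^sup>2 y\<^sup>2 / (2 (n + 1))) / sqrt (n + 1)\<close>. Splitting an external node therefore
  multiplies the weight by an explicit factor. On the event that all noise variables up to level
  \<open>L_max n\<close> are at most \<open>3 sqrt (ln n)\<close>, three things follow. First, if \<open>2\<^sup>l \<ge> n\<^sup>1\<^sup>/\<^sup>4\<close> and no descendant carries
  a signal above \<open>sqrt (ln n / n)\<close>, the split probability \<open>\<Gamma>\<^sup>-\<^sup>l\<close> beats the likelihood ratio, which is at most \<open>n\<^sup>8\<close>, once
  \<open>\<Gamma>\<close> is large; hence such nodes are not internal. Second, growing the tree along the path down to a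
  node costs at most \<open>exp (C ln\<^sup>2 n)\<close>, so every signal above \<open>B ln n / sqrt n\<close> is caught. Third, internal
  coefficients are within \<open>7 sqrt (ln n / n)\<close> of \<open>\<beta>\<^sup>0\<close>. At a point \<open>x\<close> the errors on the levels with
  \<open>2\<^sup>l\<close> of smaller order than \<open>(n / ln n)\<^bsup>1 / (2 t x + 1)\<^esup>\<close> then add up to \<open>sqrt (ln n)\<close> times the local rate, and
  on the finer levels only the bias, of the order of the local rate, remains.
\<close>


section \<open>Gaussian densities\<close>

text \<open>No regularity of \<open>t\<close> across points is available, so near x everything is
  compared with \<open>f x\<close> alone: on the dyadic interval of level l around x, the Hoelder
  condition at x bounds the coefficients of all descendants, also of those whose intervals miss x.
  Noise nodes are therefore singled out by the size of the signals below them and not through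
  \<open>t\<close>. The condition t x \<le> 1 puts the critical resolution above (n / ln n)^(1/3),
  hence above n^(1/4) for large n; from n^(1/4) on, \<Gamma>^(-l) is a high power of 1 / n. The
  detection threshold is ln n / sqrt n and not sqrt (ln n / n) because of silent ancestors: a deep
  signal is reached through up to log n splits which nothing but the signal itself pays for. The
  lost factor sqrt (ln n) is what the assumption on M_n / sqrt (ln n) absorbs. All exceptional
  posterior events concern a single coordinate, so a union bound over at most 2 n^2 nodes takes the
  place of testing and entropy arguments.\<close>

lemma normal_density_tail:
  fixes \<mu> \<sigma> a :: real
  assumes "\<sigma> > 0" "a \<ge> 0"
  shows "(\<integral>\<^sup>+ x. ennreal (normal_density \<mu> \<sigma> x) * indicator {x. a < \<bar>x - \<mu>\<bar>} x \<partial>lborel)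
    \<le> ennreal (2 * exp (- a\<^sup>2 / (2 * \<sigma>\<^sup>2)))"
proof -
  let ?c = "exp (- a\<^sup>2 / (2 * \<sigma>\<^sup>2))"
  \<comment> \<open>Completing the square: beyond distance a on the side given by s, the density is
    at most exp (- a^2 / (2 \<sigma>^2)) times the density recentred at \<mu> + s * a. The two signs
    serve the two tails, and each recentred density has mass 1, whence the factor 2.\<close>
  have shift: "normal_density \<mu> \<sigma> x \<le> ?c * normal_density (\<mu> + s * a) \<sigma> x"
    if "a \<le> s * (x - \<mu>)" "s = 1 \<or> s = -1" for x s
  proof -
    have "a * a \<le> a * (s * (x - \<mu>))" using that assms by (intro mult_left_mono) auto
    then have "a\<^sup>2 + (x - (\<mu> + s * a))\<^sup>2 \<le> (x - \<mu>)\<^sup>2"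
      using that(2) by (auto simp: power2_eq_square algebra_simps)
    then have "- (x - \<mu>)\<^sup>2 / (2 * \<sigma>\<^sup>2) \<le> - a\<^sup>2 / (2 * \<sigma>\<^sup>2) + - (x - (\<mu> + s * a))\<^sup>2 / (2 * \<sigma>\<^sup>2)"
      unfolding add_divide_distrib[symmetric] using assms by (intro divide_right_mono) auto
    then show ?thesis
      unfolding normal_density_def by (simp add: exp_add[symmetric] divide_right_mono)
  qed
  have "ennreal (normal_density \<mu> \<sigma> x) * indicator {x. a < \<bar>x - \<mu>\<bar>} x
      \<le> ennreal ?c * (ennreal (normal_density (\<mu> + 1 * a) \<sigma> x) + ennreal (normal_density (\<mu> + -1 * a) \<sigma> x))" for x
  proof (cases "a < \<bar>x - \<mu>\<bar>")
    case True
    then have "a \<le> 1 * (x - \<mu>) \<or> a \<le> -1 * (x - \<mu>)" by (cases "x \<ge> \<mu>") auto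
    then have "normal_density \<mu> \<sigma> x \<le> ?c * (normal_density (\<mu> + 1 * a) \<sigma> x + normal_density (\<mu> + -1 * a) \<sigma> x)"
    proof
      assume "a \<le> 1 * (x - \<mu>)"
      from shift[OF this] have "normal_density \<mu> \<sigma> x \<le> ?c * normal_density (\<mu> + 1 * a) \<sigma> x" by simp
      also have "\<dots> \<le> ?c * (normal_density (\<mu> + 1 * a) \<sigma> x + normal_density (\<mu> + -1 * a) \<sigma> x)"
        by (intro mult_left_mono) auto
      finally show ?thesis .
    next
      assume "a \<le> -1 * (x - \<mu>)"
      from shift[OF this] have "normal_density \<mu> \<sigma> x \<le> ?c * normal_density (\<mu> + -1 * a) \<sigma> x" by simp
      also have "\<dots> \<le> ?c * (normal_density (\<mu> + 1 * a) \<sigma> x + normal_density (\<mu> + -1 * a) \<sigma> x)"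
        by (intro mult_left_mono) auto
      finally show ?thesis .
    qed
    then have "ennreal (normal_density \<mu> \<sigma> x) \<le> ennreal (?c * (normal_density (\<mu> + 1 * a) \<sigma> x + normal_density (\<mu> + -1 * a) \<sigma> x))"
      by (rule ennreal_leI)
    then show ?thesis using True
      by (simp add: ennreal_mult ennreal_plus)
  qed auto
  then have "(\<integral>\<^sup>+ x. ennreal (normal_density \<mu> \<sigma> x) * indicator {x. a < \<bar>x - \<mu>\<bar>} x \<partial>lborel)
     \<le> (\<integral>\<^sup>+ x. ennreal ?c * (ennreal (normal_density (\<mu> + 1 * a) \<sigma> x) + ennreal (normal_density (\<mu> + -1 * a) \<sigma> x)) \<partial>lborel)"
    by (rule nn_integral_mono)
  also have "\<dots> = ennreal ?c * ((\<integral>\<^sup>+ x. ennreal (normal_density (\<mu> + 1 * a) \<sigma> x) \<partial>lborel) +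
     (\<integral>\<^sup>+ x. ennreal (normal_density (\<mu> + -1 * a) \<sigma> x) \<partial>lborel))"
    by (subst nn_integral_cmult, measurable) (subst nn_integral_add, auto)
  also have "\<dots> = ennreal ?c * (1 + 1)"
    using assms by (subst (1 2) nn_integral_eq_integral) (auto simp: integrable_normal_density integral_normal_density)
  also have "\<dots> = ennreal (2 * ?c)"
    by (simp add: ennreal_mult mult.commute)
  finally show ?thesis by (simp add: add.commute)
qed

text \<open>Bayes' rule for one coefficient with a standard normal prior and noise variance 1 / n:
  the marginal law of y is N(0, 1 + 1/n), the posterior N(n y / (n + 1), 1 / (n + 1)). Exponents and
  normalizers are matched separately, the former by completing the square in b.\<close>

lemma normal_density_conjugate:
  fixes b y :: real
  assumes "n > (0::nat)"
  shows "std_normal_density b * normal_density b (1 / sqrt n) y =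
    normal_density 0 (sqrt (1 + 1 / n)) y * normal_density (n * y / (n + 1)) (1 / sqrt (n + 1)) b"
proof -
  have n: "real n > 0" using assms by simp
  have 1: "- (b - 0)\<^sup>2 / (2 * 1\<^sup>2) + - (y - b)\<^sup>2 / (2 * (1 / sqrt n)\<^sup>2) =
    - (y - 0)\<^sup>2 / (2 * (sqrt (1 + 1 / n))\<^sup>2) + - (b - n * y / (n + 1))\<^sup>2 / (2 * (1 / sqrt (n + 1))\<^sup>2)"
  proof -
    have e: "1 + 1 / real n = (n + 1) / n" "b - n * y / (n + 1) = ((n + 1) * b - n * y) / (n + 1)"
      using n by (simp_all add: field_simps)
    have "(b\<^sup>2 + n * (y - b)\<^sup>2) * (n + 1) = n * y\<^sup>2 + ((n + 1) * b - n * y)\<^sup>2"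
      by (simp add: algebra_simps power2_eq_square)
    then have "b\<^sup>2 + n * (y - b)\<^sup>2 = (n * y\<^sup>2 + ((n + 1) * b - n * y)\<^sup>2) / (n + 1)"
      by (subst eq_divide_eq) simp
    also have "(n * y\<^sup>2 + ((n + 1) * b - n * y)\<^sup>2) / (n + 1) = n * y\<^sup>2 / (n + 1) + (n + 1) * (((n + 1) * b - n * y) / (n + 1))\<^sup>2"
      using n by (simp add: power2_eq_square add_divide_distrib)
    finally have a1: "- (b\<^sup>2 + n * (y - b)\<^sup>2) / 2 =
      - (n * y\<^sup>2 / (n + 1) + (n + 1) * (((n + 1) * b - n * y) / (n + 1))\<^sup>2) / 2" by simp
    have a2: "- (y - 0)\<^sup>2 / (2 * (sqrt (1 + 1 / n))\<^sup>2) = - (n * y\<^sup>2 / (n + 1)) / 2"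
      using n by (simp add: field_simps)
    have a3: "- q\<^sup>2 / (2 * (1 / sqrt (n + 1))\<^sup>2) = - ((n + 1) * q\<^sup>2) / 2" for q :: real
      using n by (simp add: power_one_over)
    have a4: "- (b - 0)\<^sup>2 / (2 * 1\<^sup>2) + - (y - b)\<^sup>2 / (2 * (1 / sqrt n)\<^sup>2) = - (b\<^sup>2 + n * (y - b)\<^sup>2) / 2"
      using n by (simp add: power_one_over)
    show ?thesis unfolding e(2) a4 a2 a3 a1 by (simp only: minus_add_distrib add_divide_distrib)
  qed
  have 2: "sqrt (2 * pi * 1\<^sup>2) * sqrt (2 * pi * (1 / sqrt n)\<^sup>2) =
     sqrt (2 * pi * (sqrt (1 + 1 / n))\<^sup>2) * sqrt (2 * pi * (1 / sqrt (n + 1))\<^sup>2)"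
  proof -
    have "(sqrt (1 + 1 / real n))\<^sup>2 = (n + 1) / n" "(1 / sqrt n)\<^sup>2 = 1 / n" "(1 / sqrt (n + 1))\<^sup>2 = 1 / (n + 1)"
      using n by (simp_all add: power_one_over add_divide_distrib)
    then show ?thesis unfolding real_sqrt_mult[symmetric] using n by simp
  qed
  have "std_normal_density b * normal_density b (1 / sqrt n) y =
    exp (- (b - 0)\<^sup>2 / (2 * 1\<^sup>2) + - (y - b)\<^sup>2 / (2 * (1 / sqrt n)\<^sup>2)) / (sqrt (2 * pi * 1\<^sup>2) * sqrt (2 * pi * (1 / sqrt n)\<^sup>2))"
    unfolding normal_density_def exp_add by simp
  also have "\<dots> = normal_density 0 (sqrt (1 + 1 / n)) y * normal_density (n * y / (n + 1)) (1 / sqrt (n + 1)) b"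
    unfolding 1 2 unfolding normal_density_def exp_add by simp
  finally show ?thesis by (simp add: add.commute)
qed

text \<open>Compares the two marginal laws of an observation, coefficient drawn from the prior
  against coefficient zero; the quotient is what an internal node contributes to the posterior
  weight of its tree.\<close>

lemma normal_density_ratio:
  fixes y :: real
  assumes "n > (0::nat)"
  shows "normal_density 0 (sqrt (1 + 1 / n)) y =
    exp (n\<^sup>2 * y\<^sup>2 / (2 * (n + 1))) / sqrt (n + 1) * normal_density 0 (1 / sqrt n) y"
proof -
  have n: "real n > 0" using assms by simp
  have 1: "- (y - 0)\<^sup>2 / (2 * (sqrt (1 + 1 / n))\<^sup>2) = n\<^sup>2 * y\<^sup>2 / (2 * (n + 1)) + - (y - 0)\<^sup>2 / (2 * (1 / sqrt n)\<^sup>2)"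
    using n by (simp add: power_divide field_simps power2_eq_square)
  have 2: "sqrt (2 * pi * (sqrt (1 + 1 / n))\<^sup>2) = sqrt (n + 1) * sqrt (2 * pi * (1 / sqrt n)\<^sup>2)"
    unfolding real_sqrt_mult[symmetric] using n by (simp add: power_divide field_simps)
  show ?thesis unfolding normal_density_def 1 2 exp_add by (simp add: add.commute)
qed

section \<open>The law of the Galton-Watson tree\<close>

definition full_trees :: "nat \<Rightarrow> node set set" where
  "full_trees L = {T. full_binary_tree (int L) T}"

lemma finite_full_trees: "finite (full_trees L)"
proof (rule finite_subset)
  show "full_trees L \<subseteq> Pow ({0..int L} \<times> {..<2 ^ L})"
  proof
    fix T assume "T \<in> full_trees L"
    then have *: "\<forall>(l, k)\<in>T. 0 \<le> l \<and> l \<le> int L \<and> k < 2 ^ nat l"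
      by (auto simp: full_trees_def full_binary_tree_def)
    have "k < 2 ^ L" if "(l, k) \<in> T" for l k
    proof -
      have "k < 2 ^ nat l" "nat l \<le> L" using * that by auto
      then show ?thesis by (meson less_le_trans one_le_numeral power_increasing)
    qed
    with * show "T \<in> Pow ({0..int L} \<times> {..<2 ^ L})" by auto
  qed
qed auto

lemma full_treesD:
  assumes "T \<in> full_trees L"
  shows "finite T" "(0, 0) \<in> T"
    and "\<And>i k. (i, k) \<in> T \<Longrightarrow> 0 \<le> i \<and> i \<le> int L \<and> k < 2 ^ nat i"
    and "\<And>i k j. (i, k) \<in> T \<Longrightarrow> 0 \<le> j \<Longrightarrow> j < i \<Longrightarrow> (j, k div 2 ^ nat (i - j)) \<in> T"
    and "\<And>v. v \<in> T \<Longrightarrow> \<not> children v \<subseteq> T \<Longrightarrow> children v \<inter> T = {}"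
  using assms unfolding full_trees_def full_binary_tree_def by blast+

lemma full_treesI:
  assumes "finite T" "(0, 0) \<in> T"
    and "\<And>i k. (i, k) \<in> T \<Longrightarrow> 0 \<le> i \<and> i \<le> int L \<and> k < 2 ^ nat i"
    and "\<And>i k j. (i, k) \<in> T \<Longrightarrow> 0 \<le> j \<Longrightarrow> j < i \<Longrightarrow> (j, k div 2 ^ nat (i - j)) \<in> T"
    and "\<And>v. v \<in> T \<Longrightarrow> \<not> children v \<subseteq> T \<Longrightarrow> children v \<inter> T = {}"
  shows "T \<in> full_trees L"
  unfolding full_trees_def full_binary_tree_def mem_Collect_eq
proof (intro conjI)
  show "\<forall>(l, k)\<in>T. 0 \<le> l \<and> l \<le> int L \<and> k < 2 ^ nat l" using assms(3) by blast
  show "\<forall>(l, k)\<in>T. \<forall>j. 0 \<le> j \<and> j < l \<longrightarrow> (j, k div 2 ^ nat (l - j)) \<in> T" using assms(4) by blast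
  show "\<forall>v\<in>T. children v \<subseteq> T \<or> children v \<inter> T = {}" using assms(5) by blast
qed (fact assms)+

lemma mem_children: "(i, m) \<in> children (l, k) \<longleftrightarrow> i = l + 1 \<and> m div 2 = k"
  unfolding children_def by (auto; presburger)

lemma children_ne: "children v \<noteq> {}"
  by (cases v) (auto simp: children_def)

lemma finite_children: "finite (children v)"
  by (cases v) (auto simp: children_def)

lemma card_children: "card (children v) = 2"
  by (cases v) (auto simp: children_def)

lemma fst_children: "w \<in> children v \<Longrightarrow> fst w = fst v + 1"
  by (cases v) (auto simp: children_def)

lemma children_unique: "w \<in> children v \<Longrightarrow> w \<in> children v' \<Longrightarrow> v = v'"
  by (cases v; cases v'; cases w) (auto simp: mem_children)

lemma tree_parent:
  assumes "T \<in> full_trees L" "w \<in> T" "w \<in> children v" "0 \<le> fst v"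
  shows "v \<in> T" "children v \<subseteq> T"
proof -
  obtain l k m where v: "v = (l, k)" and w: "w = (l + 1, m)" "m div 2 = k"
    using assms(3) by (cases v; cases w) (auto simp: mem_children)
  show "v \<in> T" using full_treesD(4)[OF assms(1), of "l + 1" m l] assms w v by auto
  then show "children v \<subseteq> T" using full_treesD(5)[OF assms(1)] assms by blast
qed

lemma tree_truncate:
  assumes T: "T \<in> full_trees (Suc l)"
  shows "{v \<in> T. fst v \<le> int l} \<in> full_trees l"
proof (rule full_treesI)
  note t = full_treesD[OF T]
  show "finite {v \<in> T. fst v \<le> int l}" using t by auto
  show "(0, 0) \<in> {v \<in> T. fst v \<le> int l}" using t by auto
  show "0 \<le> i \<and> i \<le> int l \<and> k < 2 ^ nat i" if "(i, k) \<in> {v \<in> T. fst v \<le> int l}" for i k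
    using t(3)[of i k] that by auto
  show "(j, k div 2 ^ nat (i - j)) \<in> {v \<in> T. fst v \<le> int l}"
    if "(i, k) \<in> {v \<in> T. fst v \<le> int l}" "0 \<le> j" "j < i" for i k j
    using t(4)[of i k j] that by auto
  show "children v \<inter> {v \<in> T. fst v \<le> int l} = {}"
    if v: "v \<in> {v \<in> T. fst v \<le> int l}" "\<not> children v \<subseteq> {v \<in> T. fst v \<le> int l}" for v
  proof (cases "fst v = int l")
    case True then show ?thesis by (auto dest: fst_children)
  next
    case False
    then have "\<not> children v \<subseteq> T" using v by (auto dest: fst_children)
    then show ?thesis using t(5)[of v] v by auto
  qed
qed

lemma pmf_galton_watson_Suc:
  fixes \<Gamma> :: real
  assumes \<Gamma>: "\<Gamma> \<ge> 1" and T: "T \<in> full_trees (Suc l)"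
  defines "p \<equiv> \<Gamma> powi (- int l)"
  shows "pmf (galton_watson \<Gamma> (Suc l)) T = pmf (galton_watson \<Gamma> l) {v \<in> T. fst v \<le> int l} *
    (\<Prod>v\<in>{v \<in> T. fst v = int l}. if children v \<subseteq> T then p else 1 - p)"
proof -
  note t = full_treesD[OF T]
  define T0 where "T0 = {v \<in> T. fst v \<le> int l}"
  define A where "A = {v \<in> T. fst v = int l}"
  define c where "c = (\<Prod>v\<in>A. if children v \<subseteq> T then p else 1 - p)"
  define g where "g = (\<lambda>T' s. T' \<union> (\<Union>v\<in>{v \<in> T'. fst v = int l \<and> s v}. children v))"
  define F where "F = (\<lambda>T'. map_pmf (g T') (Pi_pmf {v \<in> T'. fst v = int l} False (\<lambda>_. bernoulli_pmf p)))"
  have p: "0 \<le> p" "p \<le> 1"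
    using \<Gamma> unfolding p_def by (auto simp: power_int_minus field_simps)
  have fA: "finite A" using t(1) by (simp add: A_def)
  have T0A: "{v \<in> T0. fst v = int l} = A" by (auto simp: T0_def A_def)
  \<comment> \<open>Step l adds nodes of level l + 1 only, so the previous generation is recovered
    from T by truncation; every other tree of that generation contributes nothing.\<close>
  have ne: "T \<notin> set_pmf (F T')" if T': "T' \<in> set_pmf (galton_watson \<Gamma> l)" "T' \<noteq> T0" for T'
  proof
    assume "T \<in> set_pmf (F T')"
    then obtain s where s: "T = g T' s" by (auto simp: F_def)
    have "full_binary_tree (int l) T'" by (rule galton_watson_full_binary_tree[OF T'(1)])
    then have "\<And>v. v \<in> T' \<Longrightarrow> fst v \<le> int l" by (auto simp: full_binary_tree_def)
    then have "T' = {v \<in> g T' s. fst v \<le> int l}" by (auto simp: g_def dest: fst_children)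
    then show False using s T'(2) by (simp add: T0_def)
  qed
  have eq: "pmf (F T0) T = c"
  proof -
    \<comment> \<open>The only split pattern producing T. It is False off \<open>A\<close>, in
      agreement with the default value of \<open>Pi_pmf\<close>; patterns differing off
      \<open>A\<close> would produce the same tree.\<close>
    define s0 where "s0 = (\<lambda>v. v \<in> A \<and> children v \<subseteq> T)"
    have g0: "g T0 s = T \<longleftrightarrow> s = s0" if s: "\<And>v. v \<notin> A \<Longrightarrow> \<not> s v" for s
    proof
      assume gs: "g T0 s = T"
      show "s = s0"
      proof
        fix v show "s v = s0 v"
        proof
          assume "s v"
          then have "v \<in> A" using s by blast
          then have "v \<in> {v \<in> T0. fst v = int l}" using T0A by blast
          then have "children v \<subseteq> g T0 s" using \<open>s v\<close> unfolding g_def by blast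
          then show "s0 v" using \<open>v \<in> A\<close> gs by (simp add: s0_def)
        next
          assume "s0 v"
          then have v: "v \<in> A" "children v \<subseteq> T" by (auto simp: s0_def)
          obtain w where w: "w \<in> children v" using children_ne by blast
          then have "fst w = int l + 1" using v by (auto simp: A_def dest: fst_children)
          then have "w \<in> g T0 s" "w \<notin> T0" using w v gs by (auto simp: T0_def)
          then obtain v' where "w \<in> children v'" "s v'" by (auto simp: g_def)
          then show "s v" using children_unique[OF w] by auto
        qed
      qed
    next
      assume s: "s = s0"
      have "w \<in> g T0 s0" if w: "w \<in> T" for w
      proof (cases "fst w \<le> int l")
        case True then show ?thesis using w by (auto simp: g_def T0_def)
      next
        case False
        obtain m where m: "w = (int l + 1, m)" using False w t(3)[of "fst w" "snd w"] by (cases w) auto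
        then have wc: "w \<in> children (int l, m div 2)" by (auto simp: mem_children)
        from tree_parent[OF T w wc] have "(int l, m div 2) \<in> T0" "s0 (int l, m div 2)"
          by (auto simp: T0_def s0_def A_def)
        then show ?thesis using wc by (auto simp: g_def)
      qed
      moreover have "g T0 s0 \<subseteq> T" by (auto simp: g_def T0_def s0_def)
      ultimately show "g T0 s = T" using s by auto
    qed
    have "pmf (F T0) T = measure (Pi_pmf A False (\<lambda>_. bernoulli_pmf p)) (g T0 -` {T})"
      by (simp add: F_def T0A pmf_map)
    also have "\<dots> = measure (Pi_pmf A False (\<lambda>_. bernoulli_pmf p)) {s0}"
    proof (rule measure_pmf.finite_measure_eq_AE)
      show "AE s in Pi_pmf A False (\<lambda>_. bernoulli_pmf p). (s \<in> g T0 -` {T}) = (s \<in> {s0})"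
        unfolding AE_measure_pmf_iff
      proof
        fix s assume "s \<in> set_pmf (Pi_pmf A False (\<lambda>_. bernoulli_pmf p))"
        then have "\<And>v. v \<notin> A \<Longrightarrow> \<not> s v" using set_Pi_pmf_subset[OF fA, of False "\<lambda>_. bernoulli_pmf p"] by auto
        then show "(s \<in> g T0 -` {T}) = (s \<in> {s0})" using g0[of s] by simp
      qed
    qed auto
    also have "\<dots> = pmf (Pi_pmf A False (\<lambda>_. bernoulli_pmf p)) s0" by (simp add: measure_pmf_single)
    also have "\<dots> = (\<Prod>v\<in>A. pmf (bernoulli_pmf p) (s0 v))"
      by (rule pmf_Pi'[OF fA]) (auto simp: s0_def)
    also have "\<dots> = c" unfolding c_def using p by (intro prod.cong) (auto simp: s0_def)
    finally show ?thesis .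
  qed
  have "pmf (galton_watson \<Gamma> (Suc l)) T = measure_pmf.expectation (galton_watson \<Gamma> l) (\<lambda>T'. pmf (F T') T)"
    by (simp add: pmf_bind F_def g_def p_def)
  also have "\<dots> = measure_pmf.expectation (galton_watson \<Gamma> l) (\<lambda>T'. indicator {T0} T' * c)"
    using ne eq by (intro integral_cong_AE) (auto simp: AE_measure_pmf_iff pmf_eq_0_set_pmf split: split_indicator)
  also have "\<dots> = pmf (galton_watson \<Gamma> l) T0 * c"
    by (simp add: measure_pmf_single)
  finally show ?thesis by (simp add: c_def T0_def A_def)
qed

text \<open>The product stops below level L: nodes of depth L are never offered a split and carry no
  factor.\<close>

lemma pmf_galton_watson:
  fixes \<Gamma> :: real
  assumes \<Gamma>: "\<Gamma> \<ge> 1" and "T \<in> full_trees L"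
  shows "pmf (galton_watson \<Gamma> L) T =
    (\<Prod>v\<in>{v \<in> T. fst v < int L}. if children v \<subseteq> T then \<Gamma> powi (- fst v) else 1 - \<Gamma> powi (- fst v))"
  using assms(2)
proof (induction L arbitrary: T)
  case 0
  have "T = {(0, 0)}" using full_treesD(2,3)[OF 0] by force
  moreover have "{v \<in> T. fst v < int 0} = {}" using full_treesD(3)[OF 0] by force
  ultimately show ?case by (simp only: prod.empty) simp
next
  case (Suc l)
  let ?T0 = "{v \<in> T. fst v \<le> int l}"
  have e: "{v \<in> ?T0. fst v < int l} = {v \<in> T. fst v < int l}" by auto
  have s: "{v \<in> T. fst v < int (Suc l)} = {v \<in> T. fst v < int l} \<union> {v \<in> T. fst v = int l}" by auto
  \<comment> \<open>Truncation at level l does not affect which nodes of level below l have both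
    children.\<close>
  have "pmf (galton_watson \<Gamma> l) ?T0 =
    (\<Prod>v\<in>{v \<in> T. fst v < int l}. if children v \<subseteq> T then \<Gamma> powi (- fst v) else 1 - \<Gamma> powi (- fst v))"
    unfolding Suc.IH[OF tree_truncate[OF Suc.prems]] e
    by (intro prod.cong if_cong) (auto dest: fst_children)
  moreover have "(\<Prod>v\<in>{v \<in> T. fst v = int l}. if children v \<subseteq> T then \<Gamma> powi (- int l) else 1 - \<Gamma> powi (- int l)) =
    (\<Prod>v\<in>{v \<in> T. fst v = int l}. if children v \<subseteq> T then \<Gamma> powi (- fst v) else 1 - \<Gamma> powi (- fst v))"
    by (intro prod.cong) auto
  ultimately show ?case
    unfolding pmf_galton_watson_Suc[OF \<Gamma> Suc.prems] s using full_treesD(1)[OF Suc.prems]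
    by (subst prod.union_disjoint) auto
qed

section \<open>Splitting and pruning nodes of a weighted tree\<close>

definition tree_weight :: "real \<Rightarrow> nat \<Rightarrow> (node \<Rightarrow> real) \<Rightarrow> node set \<Rightarrow> real" where
  "tree_weight \<Gamma> L r T = pmf (galton_watson \<Gamma> L) T * (\<Prod>v\<in>internal_nodes T. r v)"

text \<open>Factor by which the weight of a tree changes when its external node \<open>u\<close> is split.\<close>

definition split_odds :: "real \<Rightarrow> nat \<Rightarrow> (node \<Rightarrow> real) \<Rightarrow> node \<Rightarrow> real" where
  "split_odds \<Gamma> L r u = \<Gamma> powi (- fst u) / (1 - \<Gamma> powi (- fst u)) *
     (if fst u + 1 < int L then (1 - \<Gamma> powi (- (fst u + 1)))\<^sup>2 else 1) * r u"

definition external_at :: "nat \<Rightarrow> node \<Rightarrow> node set set" where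
  "external_at L u = {T \<in> full_trees L. u \<in> T \<and> \<not> children u \<subseteq> T}"

text \<open>For u below depth L, these are the trees that arise by splitting u in a tree of
  \<open>external_at L u\<close>. Asking both children to be leaves ensures that removing them
  leaves a full tree.\<close>

definition bottom_at :: "nat \<Rightarrow> node \<Rightarrow> node set set" where
  "bottom_at L u = {T \<in> full_trees L. children u \<subseteq> T \<and> (\<forall>w\<in>children u. \<not> children w \<subseteq> T)}"

section \<open>Splitting a leaf and undoing it\<close>

lemma fst_nonneg_tree: "T \<in> full_trees L \<Longrightarrow> v \<in> T \<Longrightarrow> 0 \<le> fst v"
  using full_treesD(3)[of T L "fst v" "snd v"] by simp

lemma split_tree:
  assumes T: "T \<in> external_at L u" and u: "fst u < int L"
  shows "T \<union> children u \<in> bottom_at L u"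
    and "internal_nodes (T \<union> children u) = insert u (internal_nodes T)"
    and "children u \<inter> T = {}"
    and "\<And>v. v \<in> T \<Longrightarrow> children v \<subseteq> T \<union> children u \<longleftrightarrow> v = u \<or> children v \<subseteq> T"
    and "\<And>v. v \<in> children u \<Longrightarrow> children v \<inter> (T \<union> children u) = {}"
proof -
  have tr: "T \<in> full_trees L" and uT: "u \<in> T" and cu: "\<not> children u \<subseteq> T"
    using T by (auto simp: external_at_def)
  note t = full_treesD[OF tr]
  show disj: "children u \<inter> T = {}" using t(5)[OF uT cu] .
  show c2: "children v \<inter> (T \<union> children u) = {}" if v: "v \<in> children u" for v
  proof -
    have "w \<notin> T" if "w \<in> children v" for w
      using tree_parent(1)[OF tr _ that] fst_nonneg_tree[OF tr uT] fst_children[OF v] v disj by force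
    moreover have "w \<notin> children u" if "w \<in> children v" for w
      using fst_children[OF that] fst_children[OF v] fst_children[of w u] by linarith
    ultimately show ?thesis by blast
  qed
  show c1: "children v \<subseteq> T \<union> children u \<longleftrightarrow> v = u \<or> children v \<subseteq> T" if v: "v \<in> T" for v
  proof
    assume a: "children v \<subseteq> T \<union> children u"
    show "v = u \<or> children v \<subseteq> T"
    proof (rule disjCI)
      assume "\<not> children v \<subseteq> T"
      then obtain w where "w \<in> children v" "w \<in> children u" using a by auto
      then show "v = u" by (rule children_unique)
    qed
  qed auto
  have c3: "\<not> children v \<subseteq> T \<union> children u" if v: "v \<in> children u" for v
    using c2[OF that] children_ne[of v] by auto
  show "internal_nodes (T \<union> children u) = insert u (internal_nodes T)"
    unfolding internal_nodes_def using c1 c3 uT by auto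
  obtain l k where lk: "u = (l, k)" by (cases u)
  have l: "0 \<le> l" "k < 2 ^ nat l" using t(3)[of l k] uT lk by auto
  have "T \<union> children u \<in> full_trees L"
  proof (rule full_treesI)
    show "finite (T \<union> children u)" using t(1) finite_children by auto
    show "(0, 0) \<in> T \<union> children u" using t(2) by auto
    show "0 \<le> i \<and> i \<le> int L \<and> m < 2 ^ nat i" if "(i, m) \<in> T \<union> children u" for i m
    proof (cases "(i, m) \<in> T")
      case True then show ?thesis by (rule t(3))
    next
      case False
      then have "i = l + 1" "m div 2 = k" using that lk by (auto simp: mem_children)
      then show ?thesis using l u lk by (auto simp: nat_add_distrib)
    qed
    show "(j, m div 2 ^ nat (i - j)) \<in> T \<union> children u"
      if im: "(i, m) \<in> T \<union> children u" and j: "0 \<le> j" "j < i" for i m j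
    proof (cases "(i, m) \<in> T")
      case True then show ?thesis using t(4)[OF True j] by simp
    next
      case False
      then have i: "i = l + 1" "m div 2 = k" using im lk by (auto simp: mem_children)
      show ?thesis
      proof (cases "j = l")
        case True then show ?thesis using i uT lk by simp
      next
        case False
        then have "nat (i - j) = Suc (nat (l - j))" using i j by simp
        then have "m div 2 ^ nat (i - j) = k div 2 ^ nat (l - j)"
          using i by (simp add: div_mult2_eq)
        then show ?thesis using t(4)[of l k j] uT lk j i False by auto
      qed
    qed
    show "children v \<inter> (T \<union> children u) = {}"
      if v: "v \<in> T \<union> children u" "\<not> children v \<subseteq> T \<union> children u" for v
    proof (cases "v \<in> children u")
      case True then show ?thesis by (rule c2)
    next
      case False
      then have vT: "v \<in> T" "v \<noteq> u" "\<not> children v \<subseteq> T" using v by auto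
      then have "children v \<inter> T = {}" using t(5) by blast
      moreover have "children v \<inter> children u = {}" using children_unique vT(2) by blast
      ultimately show ?thesis by blast
    qed
  qed
  then show "T \<union> children u \<in> bottom_at L u" using c3 by (auto simp: bottom_at_def)
qed

lemma prune_tree:
  assumes T: "T \<in> bottom_at L u" and u: "0 \<le> fst u"
  shows "T - children u \<in> external_at L u"
proof -
  have tr: "T \<in> full_trees L" and cu: "children u \<subseteq> T" and ncc: "\<And>w. w \<in> children u \<Longrightarrow> \<not> children w \<subseteq> T"
    using T by (auto simp: bottom_at_def)
  note t = full_treesD[OF tr]
  have cc: "children w \<inter> T = {}" if "w \<in> children u" for w using t(5) ncc[OF that] cu that by blast
  obtain w0 where w0: "w0 \<in> children u" using children_ne by blast
  have uT: "u \<in> T" using tree_parent(1)[OF tr _ w0 u] w0 cu by auto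
  have un: "u \<notin> children u" by (auto dest: fst_children)
  have "T - children u \<in> full_trees L"
  proof (rule full_treesI)
    show "finite (T - children u)" using t(1) by auto
    show "(0, 0) \<in> T - children u" using t(2) u by (auto dest: fst_children)
    show "0 \<le> i \<and> i \<le> int L \<and> m < 2 ^ nat i" if "(i, m) \<in> T - children u" for i m
      using that t(3) by auto
    show "(j, m div 2 ^ nat (i - j)) \<in> T - children u"
      if im: "(i, m) \<in> T - children u" and j: "0 \<le> j" "j < i" for i m j
    proof -
      let ?w = "(j, m div 2 ^ nat (i - j))"
      \<comment> \<open>If a child of u were an ancestor of a surviving node, the next node of that
        path would be a grandchild of u; but the children of u are leaves.\<close>
      have "?w \<notin> children u"
      proof
        assume w: "?w \<in> children u"
        define w' where "w' = (j + 1, m div 2 ^ nat (i - (j + 1)))"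
        have "w' \<in> T"
        proof (cases "j + 1 = i")
          case True then show ?thesis using im by (auto simp: w'_def)
        next
          case False then show ?thesis using t(4)[of i m "j + 1"] im j by (auto simp: w'_def)
        qed
        moreover have "nat (i - j) = Suc (nat (i - (j + 1)))" using j by simp
        then have "w' \<in> children ?w" unfolding w'_def mem_children
          by (simp add: div_mult2_eq mult.commute[of 2])
        ultimately show False using cc[OF w] by blast
      qed
      then show ?thesis using t(4)[of i m j] im j by simp
    qed
    show "children v \<inter> (T - children u) = {}"
      if v: "v \<in> T - children u" "\<not> children v \<subseteq> T - children u" for v
    proof (cases "v = u")
      case False
      then have "children v \<inter> children u = {}" using children_unique by blast
      then have "\<not> children v \<subseteq> T" using v by blast
      then show ?thesis using t(5) v by blast
    qed auto
  qed
  then show ?thesis using uT un w0 by (auto simp: external_at_def)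
qed

lemma bij_split:
  assumes u: "0 \<le> fst u" "fst u < int L"
  shows "bij_betw (\<lambda>T. T \<union> children u) (external_at L u) (bottom_at L u)"
proof (rule bij_betwI[where g = "\<lambda>T. T - children u"])
  show "(\<lambda>T. T \<union> children u) \<in> external_at L u \<rightarrow> bottom_at L u"
    using split_tree(1) u by blast
  show "(\<lambda>T. T - children u) \<in> bottom_at L u \<rightarrow> external_at L u"
    using prune_tree u by blast
  show "T \<union> children u - children u = T" if "T \<in> external_at L u" for T
    using split_tree(3)[OF that u(2)] by auto
  show "T - children u \<union> children u = T" if "T \<in> bottom_at L u" for T
    using that by (auto simp: bottom_at_def)
qed

text \<open>Level 0 is left out because \<Gamma>^0 = 1: the root splits with certainty, and 1 - p
  would vanish in the denominator of \<open>split_odds\<close>.\<close>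

lemma split_prob:
  fixes \<Gamma> :: real
  assumes "\<Gamma> > 1" "l \<ge> (1 :: int)"
  shows "0 < \<Gamma> powi (- l)" "\<Gamma> powi (- l) \<le> 1 / \<Gamma>" "\<Gamma> powi (- l) < 1"
proof -
  have e: "\<Gamma> powi (- l) = 1 / \<Gamma> ^ nat l" using assms by (simp add: power_int_def inverse_eq_divide power_one_over)
  have "\<Gamma> ^ 1 \<le> \<Gamma> ^ nat l" using assms by (intro power_increasing) auto
  then show "\<Gamma> powi (- l) \<le> 1 / \<Gamma>" "0 < \<Gamma> powi (- l)" unfolding e using assms by (auto simp: field_simps)
  moreover have "1 / \<Gamma> < 1" using assms by simp
  ultimately show "\<Gamma> powi (- l) < 1" by linarith
qed

lemma finite_internal_nodes: "T \<in> full_trees L \<Longrightarrow> finite (internal_nodes T)"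
  using full_treesD(1) by (auto simp: internal_nodes_def)

text \<open>Splitting u turns its prior factor 1 - p into p and adds a factor 1 - p of the next
  level for each of the two new leaves, unless these have depth L. All other factors stay, so the
  ratio does not depend on T.\<close>

lemma tree_weight_split:
  fixes \<Gamma> :: real
  assumes \<Gamma>: "\<Gamma> > 1" and T: "T \<in> external_at L u" and u: "1 \<le> fst u" "fst u < int L"
  shows "tree_weight \<Gamma> L r (T \<union> children u) = split_odds \<Gamma> L r u * tree_weight \<Gamma> L r T"
proof -
  note s = split_tree[OF T u(2)]
  have tr: "T \<in> full_trees L" and uT: "u \<in> T" and cu: "\<not> children u \<subseteq> T"
    using T by (auto simp: external_at_def)
  have tr': "T \<union> children u \<in> full_trees L" using s(1) by (simp add: bottom_at_def)
  define p where "p = (\<lambda>l::int. \<Gamma> powi (- l))"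
  define A where "A = {v \<in> T. fst v < int L}"
  define B where "B = {v \<in> children u. fst v < int L}"
  have fin: "finite A" "finite B" using full_treesD(1)[OF tr] finite_children by (auto simp: A_def B_def)
  have uA: "u \<in> A" using uT u by (simp add: A_def)
  have AB: "{v \<in> T \<union> children u. fst v < int L} = A \<union> B" "A \<inter> B = {}"
    using s(3) by (auto simp: A_def B_def)
  have p1: "p (fst u) < 1" using split_prob[OF \<Gamma> u(1)] by (simp add: p_def)
  have PB: "(\<Prod>v\<in>B. if children v \<subseteq> T \<union> children u then p (fst v) else 1 - p (fst v)) =
      (if fst u + 1 < int L then (1 - p (fst u + 1))\<^sup>2 else 1)"
  proof -
    have "(\<Prod>v\<in>B. if children v \<subseteq> T \<union> children u then p (fst v) else 1 - p (fst v)) = (\<Prod>v\<in>B. 1 - p (fst u + 1))"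
    proof (intro prod.cong refl)
      fix v assume "v \<in> B"
      then have v: "v \<in> children u" by (simp add: B_def)
      then have "\<not> children v \<subseteq> T \<union> children u" using s(5)[OF v] children_ne[of v] by blast
      then show "(if children v \<subseteq> T \<union> children u then p (fst v) else 1 - p (fst v)) = 1 - p (fst u + 1)"
        using fst_children[OF v] by simp
    qed
    also have "B = (if fst u + 1 < int L then children u else {})"
    proof (rule set_eqI)
      fix v show "v \<in> B \<longleftrightarrow> v \<in> (if fst u + 1 < int L then children u else {})"
        using fst_children[of v u] by (cases "v \<in> children u") (simp_all add: B_def)
    qed
    then have "(\<Prod>v\<in>B. 1 - p (fst u + 1)) = (if fst u + 1 < int L then (1 - p (fst u + 1))\<^sup>2 else 1)"
      by (simp add: card_children)
    finally show ?thesis .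
  qed
  have PA: "(\<Prod>v\<in>A. if children v \<subseteq> T \<union> children u then p (fst v) else 1 - p (fst v)) =
     p (fst u) / (1 - p (fst u)) * (\<Prod>v\<in>A. if children v \<subseteq> T then p (fst v) else 1 - p (fst v))"
  proof -
    have "(\<Prod>v\<in>A - {u}. if children v \<subseteq> T \<union> children u then p (fst v) else 1 - p (fst v)) =
       (\<Prod>v\<in>A - {u}. if children v \<subseteq> T then p (fst v) else 1 - p (fst v))"
      using s(4) by (intro prod.cong refl if_cong) (auto simp: A_def)
    then show ?thesis using cu p1
      by (subst (1 2) prod.remove[OF fin(1) uA]) auto
  qed
  have "pmf (galton_watson \<Gamma> L) (T \<union> children u) =
     p (fst u) / (1 - p (fst u)) * (if fst u + 1 < int L then (1 - p (fst u + 1))\<^sup>2 else 1) * pmf (galton_watson \<Gamma> L) T"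
    unfolding pmf_galton_watson[OF less_imp_le[OF \<Gamma>] tr'] pmf_galton_watson[OF less_imp_le[OF \<Gamma>] tr] AB(1)
    unfolding A_def[symmetric] prod.union_disjoint[OF fin AB(2)] using PA PB unfolding p_def by simp
  moreover have "(\<Prod>v\<in>internal_nodes (T \<union> children u). r v) = r u * (\<Prod>v\<in>internal_nodes T. r v)"
  proof -
    have "u \<notin> internal_nodes T" using cu u by (auto simp: internal_nodes_def)
    then show ?thesis unfolding s(2) using finite_internal_nodes[OF tr] by simp
  qed
  ultimately show ?thesis unfolding tree_weight_def split_odds_def p_def by simp
qed

lemma sum_weight_bottom:
  fixes \<Gamma> :: real
  assumes \<Gamma>: "\<Gamma> > 1" and u: "1 \<le> fst u" "fst u < int L"
  shows "(\<Sum>T\<in>bottom_at L u. tree_weight \<Gamma> L r T) = split_odds \<Gamma> L r u * (\<Sum>T\<in>external_at L u. tree_weight \<Gamma> L r T)"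
proof -
  have "(\<Sum>T\<in>bottom_at L u. tree_weight \<Gamma> L r T) = (\<Sum>T\<in>external_at L u. tree_weight \<Gamma> L r (T \<union> children u))"
    using bij_split[of u L] u by (intro sum.reindex_bij_betw[symmetric]) auto
  also have "\<dots> = (\<Sum>T\<in>external_at L u. split_odds \<Gamma> L r u * tree_weight \<Gamma> L r T)"
    using tree_weight_split[OF \<Gamma> _ u] by (intro sum.cong) auto
  finally show ?thesis by (simp add: sum_distrib_left)
qed

lemma tree_weight_nonneg: "(\<And>v. r v > 0) \<Longrightarrow> 0 \<le> tree_weight \<Gamma> L r T"
  unfolding tree_weight_def by (intro mult_nonneg_nonneg prod_nonneg) (auto intro: less_imp_le)

lemma split_odds_pos:
  assumes "\<Gamma> > 1" "1 \<le> fst u" "r u > 0"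
  shows "0 < split_odds \<Gamma> L r u"
  unfolding split_odds_def using split_prob[OF assms(1,2)] split_prob[OF assms(1), of "fst u + 1"] assms by auto

section \<open>Total weight of trees by the status of a node\<close>

lemma sum_UN_le:
  fixes f :: "'b \<Rightarrow> real"
  assumes "finite S" "\<And>u. finite (B u)" "\<And>x. 0 \<le> f x"
  shows "(\<Sum>x\<in>(\<Union>u\<in>S. B u). f x) \<le> (\<Sum>u\<in>S. \<Sum>x\<in>B u. f x)"
  using assms(1)
proof (induction rule: finite_induct)
  case (insert u S)
  have "(\<Sum>x\<in>B u \<union> (\<Union>u\<in>S. B u). f x) \<le> (\<Sum>x\<in>B u. f x) + (\<Sum>x\<in>(\<Union>u\<in>S. B u). f x)"
    using assms insert.hyps by (subst sum.union_inter[symmetric]) (auto intro!: sum_nonneg)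
  then show ?case using insert by simp
qed simp

text \<open>Since S is closed under children, an internal node of S of greatest level has only
  leaves as children. Hence every tree in question lies in some \<open>bottom_at L u\<close>, whose
  weight is the odds of u times that of \<open>external_at L u\<close>. Looking at the deepest node
  makes the shape of the subtree above it within S irrelevant.\<close>

lemma weight_internal_le:
  fixes \<Gamma> :: real
  assumes \<Gamma>: "\<Gamma> > 1" and r: "\<And>v. r v > 0" and fS: "finite S"
    and S: "\<And>u. u \<in> S \<Longrightarrow> 1 \<le> fst u \<and> fst u < int L"
    and closed: "\<And>u w. u \<in> S \<Longrightarrow> w \<in> children u \<Longrightarrow> fst w < int L \<Longrightarrow> w \<in> S"
  shows "(\<Sum>T\<in>{T \<in> full_trees L. S \<inter> internal_nodes T \<noteq> {}}. tree_weight \<Gamma> L r T)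
    \<le> (\<Sum>u\<in>S. split_odds \<Gamma> L r u) * (\<Sum>T\<in>full_trees L. tree_weight \<Gamma> L r T)"
proof -
  let ?W = "tree_weight \<Gamma> L r"
  note nn = tree_weight_nonneg[OF r]
  have fb: "finite (bottom_at L u)" for u unfolding bottom_at_def using finite_full_trees by simp
  have "{T \<in> full_trees L. S \<inter> internal_nodes T \<noteq> {}} \<subseteq> (\<Union>u\<in>S. bottom_at L u)"
  proof
    fix T assume "T \<in> {T \<in> full_trees L. S \<inter> internal_nodes T \<noteq> {}}"
    then obtain v where T: "T \<in> full_trees L" and v: "v \<in> S" "v \<in> internal_nodes T" by blast
    let ?I = "S \<inter> internal_nodes T"
    have fI: "finite ?I" "?I \<noteq> {}" using fS v by auto
    define m where "m = Max (fst ` ?I)"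
    have "m \<in> fst ` ?I" unfolding m_def using fI by (intro Max_in) auto
    then obtain u where u: "u \<in> ?I" "fst u = m" by auto
    have max: "fst w \<le> m" if "w \<in> ?I" for w unfolding m_def using fI that by (intro Max_ge) auto
    have cu: "children u \<subseteq> T" using u S[of u] by (auto simp: internal_nodes_def)
    have "\<not> children w \<subseteq> T" if w: "w \<in> children u" for w
    proof
      assume c: "children w \<subseteq> T"
      obtain w' where w': "w' \<in> children w" using children_ne by blast
      \<comment> \<open>The grandchild w' respects the depth bound, so w has level below L, which is
        the side condition for closedness of S.\<close>
      have "fst w' \<le> int L" using full_treesD(3)[OF T, of "fst w'" "snd w'"] w' c by auto
      then have "fst w < int L" using fst_children[OF w'] by simp
      then have "w \<in> S" using closed u w by blast
      moreover have "w \<in> internal_nodes T" using c cu w by (auto simp: internal_nodes_def)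
      ultimately have "fst w \<le> m" using max by auto
      then show False using fst_children[OF w] u by simp
    qed
    then show "T \<in> (\<Union>u\<in>S. bottom_at L u)" using u T cu by (auto simp: bottom_at_def)
  qed
  then have "(\<Sum>T\<in>{T \<in> full_trees L. S \<inter> internal_nodes T \<noteq> {}}. ?W T) \<le> (\<Sum>T\<in>(\<Union>u\<in>S. bottom_at L u). ?W T)"
  proof (rule sum_mono2[rotated])
    show "finite (\<Union>u\<in>S. bottom_at L u)" using fS fb by (rule finite_UN_I)
    show "0 \<le> ?W T" for T by (rule nn)
  qed
  also have "\<dots> \<le> (\<Sum>u\<in>S. \<Sum>T\<in>bottom_at L u. ?W T)"
    using fS fb nn by (rule sum_UN_le)
  also have "\<dots> \<le> (\<Sum>u\<in>S. split_odds \<Gamma> L r u * (\<Sum>T\<in>full_trees L. ?W T))"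
  proof (rule sum_mono)
    fix u assume u: "u \<in> S"
    note su = S[OF u]
    have "(\<Sum>T\<in>external_at L u. ?W T) \<le> (\<Sum>T\<in>full_trees L. ?W T)"
      using nn finite_full_trees by (intro sum_mono2) (auto simp: external_at_def)
    then show "(\<Sum>T\<in>bottom_at L u. ?W T) \<le> split_odds \<Gamma> L r u * (\<Sum>T\<in>full_trees L. ?W T)"
      unfolding sum_weight_bottom[OF \<Gamma> conjunct1[OF su] conjunct2[OF su]]
      using split_odds_pos[of \<Gamma> u r L] \<Gamma> su r by (intro mult_left_mono) (auto intro: less_imp_le)
  qed
  finally show ?thesis by (simp add: sum_distrib_right)
qed

text \<open>If a node is not internal, it or one of its ancestors is external in the tree. Let G u
  be the weight of the trees with u external. Splitting u yields trees in which the next node of the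
  path is external, so G u is at most R times G of that node. Summing along the path gives l R^l G
  v, and one last split, at v itself, brings in the actual odds of v, which are large when v carries
  a strong signal.\<close>

lemma weight_not_internal_le:
  fixes \<Gamma> :: real
  assumes \<Gamma>: "\<Gamma> > 1" and r: "\<And>v. r v > 0" and R: "R \<ge> 1"
    and odds: "\<And>u. 1 \<le> fst u \<Longrightarrow> fst u < int L \<Longrightarrow> 1 / split_odds \<Gamma> L r u \<le> R"
    and l: "l < L" and k: "k < 2 ^ l"
  shows "(\<Sum>T\<in>{T \<in> full_trees L. (int l, k) \<notin> internal_nodes T}. tree_weight \<Gamma> L r T)
    \<le> l * R ^ l / split_odds \<Gamma> L r (int l, k) * (\<Sum>T\<in>full_trees L. tree_weight \<Gamma> L r T)"
proof -
  let ?W = "tree_weight \<Gamma> L r" and ?\<rho> = "split_odds \<Gamma> L r"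
  define G where "G = (\<lambda>u. \<Sum>T\<in>external_at L u. ?W T)"
  define H where "H = (\<lambda>v. \<Sum>T\<in>{T \<in> full_trees L. v \<notin> internal_nodes T}. ?W T)"
  note nn = tree_weight_nonneg[OF r]
  have fe: "finite (external_at L u)" for u unfolding external_at_def using finite_full_trees by simp
  have G0: "0 \<le> G u" for u unfolding G_def using nn by (intro sum_nonneg) auto
  have GB: "G u = 1 / ?\<rho> u * (\<Sum>T\<in>bottom_at L u. ?W T)" if u: "1 \<le> fst u" "fst u < int L" for u
    using split_odds_pos[of \<Gamma> u r L] \<Gamma> u r unfolding sum_weight_bottom[OF \<Gamma> u] G_def by simp
  have Gle: "G (int l', k div 2) \<le> R * G (int (Suc l'), k)" if "1 \<le> l'" "Suc l' < L" for l' k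
  proof -
    let ?u = "(int l', k div 2)" and ?v = "(int (Suc l'), k)"
    have vu: "?v \<in> children ?u" by (simp add: mem_children)
    have "(\<Sum>T\<in>bottom_at L ?u. ?W T) \<le> G ?v" unfolding G_def
      using vu nn fe by (intro sum_mono2) (auto simp: external_at_def bottom_at_def)
    moreover have "0 < ?\<rho> ?u" using split_odds_pos[of \<Gamma> ?u r L] \<Gamma> that r by auto
    ultimately have "G ?u \<le> 1 / ?\<rho> ?u * G ?v"
      using that by (subst GB) (auto intro!: divide_right_mono)
    also have "\<dots> \<le> R * G ?v" using odds[of ?u] that G0 by (intro mult_right_mono) auto
    finally show ?thesis .
  qed
  have Hle: "H (int l', k) \<le> l' * R ^ l' * G (int l', k)" if "l' < L" "k < 2 ^ l'" for l' k
    using that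
  proof (induction l' arbitrary: k)
    case 0
    \<comment> \<open>The root splits with probability one, so trees with external root have weight
      zero and the path sum starts at level 1.\<close>
    have "?W T = 0" if T: "T \<in> full_trees L" "(0, 0) \<notin> internal_nodes T" for T
    proof -
      have "\<not> children (0, 0) \<subseteq> T" using T full_treesD(2)[OF T(1)] by (auto simp: internal_nodes_def)
      then have "pmf (galton_watson \<Gamma> L) T = 0"
        unfolding pmf_galton_watson[OF less_imp_le[OF \<Gamma>] T(1)] using full_treesD(1,2)[OF T(1)] 0
        by (intro prod_zero bexI[of _ "(0, 0)"]) auto
      then show ?thesis by (simp add: tree_weight_def)
    qed
    then have "H (int 0, k) = 0" using 0 unfolding H_def by (intro sum.neutral) auto
    then show ?case by simp
  next
    case (Suc l')
    let ?u = "(int l', k div 2)" and ?v = "(int (Suc l'), k)"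
    have vu: "?v \<in> children ?u" by (simp add: mem_children)
    have "{T \<in> full_trees L. ?v \<notin> internal_nodes T} \<subseteq> external_at L ?v \<union> {T \<in> full_trees L. ?u \<notin> internal_nodes T}"
      using vu by (auto simp: external_at_def internal_nodes_def)
    then have "H ?v \<le> (\<Sum>T\<in>external_at L ?v \<union> {T \<in> full_trees L. ?u \<notin> internal_nodes T}. ?W T)"
      unfolding H_def using nn fe finite_full_trees by (intro sum_mono2) auto
    also have "\<dots> \<le> G ?v + H ?u" unfolding G_def H_def
      using nn fe finite_full_trees by (subst sum.union_inter[symmetric]) (auto intro!: sum_nonneg)
    also have "H ?u \<le> l' * R ^ l' * G ?u" using Suc by (intro Suc.IH) auto
    also have "\<dots> \<le> l' * R ^ Suc l' * G ?v"
    proof (cases "l' = 0")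
      case False
      then have "l' * R ^ l' * G ?u \<le> l' * R ^ l' * (R * G ?v)"
        using Gle[of l' k] Suc.prems R by (intro mult_left_mono) auto
      then show ?thesis by (simp add: mult_ac)
    qed simp
    also have "G ?v + l' * R ^ Suc l' * G ?v \<le> R ^ Suc l' * G ?v + l' * R ^ Suc l' * G ?v"
    proof -
      have "1 * G ?v \<le> R ^ Suc l' * G ?v" using R G0 by (intro mult_right_mono one_le_power) auto
      then show ?thesis by simp
    qed
    also have "\<dots> = Suc l' * R ^ Suc l' * G ?v" by (simp add: algebra_simps)
    finally show ?case by simp
  qed
  show ?thesis
  proof (cases "l = 0")
    case True then show ?thesis using Hle[OF l k] by (simp add: H_def)
  next
    case False
    let ?v = "(int l, k)"
    have "(\<Sum>T\<in>bottom_at L ?v. ?W T) \<le> (\<Sum>T\<in>full_trees L. ?W T)"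
      using nn finite_full_trees by (intro sum_mono2) (auto simp: bottom_at_def)
    moreover have "0 < ?\<rho> ?v" using split_odds_pos[of \<Gamma> ?v r L] \<Gamma> False r by auto
    ultimately have "G ?v \<le> 1 / ?\<rho> ?v * (\<Sum>T\<in>full_trees L. ?W T)"
      using False l by (subst GB) (auto intro!: divide_right_mono)
    then have "l * R ^ l * G ?v \<le> l * R ^ l * (1 / ?\<rho> ?v * (\<Sum>T\<in>full_trees L. ?W T))"
      using R by (intro mult_left_mono) auto
    with Hle[OF l k] show ?thesis by (simp add: H_def)
  qed
qed

section \<open>The posterior of a single coefficient\<close>

text \<open>Only finitely many coordinates matter, so the infinite product measure is projected onto
  \<open>J\<close>, where Fubini applies.\<close>

lemma nn_integral_PiM_prod:
  fixes M :: "'i \<Rightarrow> 'a measure"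
  assumes M: "\<And>i. prob_space (M i)" and J: "finite J" "J \<subseteq> I"
    and f: "\<And>i. i \<in> J \<Longrightarrow> f i \<in> borel_measurable (M i)"
  shows "(\<integral>\<^sup>+ x. (\<Prod>i\<in>J. f i (x i)) \<partial>PiM I M) = (\<Prod>i\<in>J. \<integral>\<^sup>+ x. f i x \<partial>M i)"
proof -
  interpret product_prob_space M I
    using M by (auto simp: product_prob_space_def product_prob_space_axioms_def product_sigma_finite_def
        intro: prob_space_imp_sigma_finite)
  have "(\<integral>\<^sup>+ x. (\<Prod>i\<in>J. f i (x i)) \<partial>PiM I M) = (\<integral>\<^sup>+ x. (\<Prod>i\<in>J. f i (restrict x J i)) \<partial>PiM I M)"
    by (intro nn_integral_cong prod.cong) auto
  also have "\<dots> = (\<integral>\<^sup>+ x. (\<Prod>i\<in>J. f i (x i)) \<partial>distr (PiM I M) (PiM J M) (\<lambda>x. restrict x J))"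
  proof (rule nn_integral_distr[symmetric])
    show "(\<lambda>x. restrict x J) \<in> PiM I M \<rightarrow>\<^sub>M PiM J M" using J(2) by (rule measurable_restrict_subset)
    have "(\<lambda>x. f i (x i)) \<in> borel_measurable (PiM J M)" if "i \<in> J" for i
      using measurable_compose[OF measurable_component_singleton[of i J M] f] that by simp
    then show "(\<lambda>x. \<Prod>i\<in>J. f i (x i)) \<in> borel_measurable (distr (PiM I M) (PiM J M) (\<lambda>x. restrict x J))"
      by (simp add: borel_measurable_prod_ennreal)
  qed
  also have "\<dots> = (\<integral>\<^sup>+ x. (\<Prod>i\<in>J. f i (x i)) \<partial>PiM J M)"
    using distr_PiM_restrict_finite[OF J] by simp
  also have "\<dots> = (\<Prod>i\<in>J. \<integral>\<^sup>+ x. f i x \<partial>M i)"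
    using J f by (intro product_nn_integral_prod) auto
  finally show ?thesis .
qed

text \<open>The Bayes factor of a standard normal coefficient against a zero coefficient, given the
  observation y.\<close>

definition marginal_ratio :: "nat \<Rightarrow> real \<Rightarrow> real" where
  "marginal_ratio n y = exp (n\<^sup>2 * y\<^sup>2 / (2 * (n + 1))) / sqrt (n + 1)"

abbreviation level_nodes :: "nat \<Rightarrow> node set" where
  "level_nodes n \<equiv> {v \<in> haar_index. fst v \<le> L_max n}"

abbreviation max_depth :: "nat \<Rightarrow> nat" where
  "max_depth n \<equiv> nat (L_max n)"

lemma L_max_nonneg: "n > 0 \<Longrightarrow> 0 \<le> L_max n"
  by (simp add: L_max_def)

lemma marginal_ratio_pos: "marginal_ratio n y > 0"
  unfolding marginal_ratio_def by simp

lemma internal_nodes_subset: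
  assumes "T \<in> full_trees (max_depth n)" "n > 0"
  shows "internal_nodes T \<subseteq> level_nodes n"
proof
  fix v assume v: "v \<in> internal_nodes T"
  show "v \<in> level_nodes n"
  proof (cases "v = (-1, 0)")
    case True then show ?thesis using L_max_nonneg[OF assms(2)] by (simp add: haar_index_def)
  next
    case False
    then have "v \<in> T" using v by (simp add: internal_nodes_def)
    then show ?thesis using full_treesD(3)[OF assms(1), of "fst v" "snd v"] L_max_nonneg[OF assms(2)]
      by (cases v) (auto simp: haar_index_def)
  qed
qed

lemma nn_integral_slab_marginal:
  assumes n: "n > (0::nat)" and A: "A \<in> sets borel"
  shows "(\<integral>\<^sup>+ b. ennreal (normal_density b (1 / sqrt n) y) * indicator A b \<partial>std_normal) =
    ennreal (normal_density 0 (sqrt (1 + 1 / n)) y) *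
    (\<integral>\<^sup>+ b. ennreal (normal_density (n * y / (n + 1)) (1 / sqrt (n + 1)) b) * indicator A b \<partial>lborel)"
proof -
  have m: "(\<lambda>b. normal_density b (1 / sqrt n) y) \<in> borel_measurable borel"
    unfolding normal_density_def by measurable
  have "(\<integral>\<^sup>+ b. ennreal (normal_density b (1 / sqrt n) y) * indicator A b \<partial>std_normal) =
    (\<integral>\<^sup>+ b. ennreal (std_normal_density b) * (ennreal (normal_density b (1 / sqrt n) y) * indicator A b) \<partial>lborel)"
    using m A by (subst nn_integral_density) auto
  also have "\<dots> = (\<integral>\<^sup>+ b. ennreal (normal_density 0 (sqrt (1 + 1 / n)) y) *
      (ennreal (normal_density (n * y / (n + 1)) (1 / sqrt (n + 1)) b) * indicator A b) \<partial>lborel)"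
    unfolding mult.assoc[symmetric]
    by (simp add: ennreal_mult[symmetric] normal_density_conjugate[OF n] add.commute)
  also have "\<dots> = ennreal (normal_density 0 (sqrt (1 + 1 / n)) y) *
    (\<integral>\<^sup>+ b. ennreal (normal_density (n * y / (n + 1)) (1 / sqrt (n + 1)) b) * indicator A b \<partial>lborel)"
    using A by (intro nn_integral_cmult) auto
  finally show ?thesis by (simp add: add.commute)
qed

text \<open>Reduces posterior statements about one coordinate to finite sums over trees. Given T the
  coordinates are independent: an internal v has the conjugate normal law, which gives A mass at
  most \<kappa>, and any other v sits at 0.\<close>

lemma posterior_coord_le:
  fixes Y :: "node \<Rightarrow> real" and v :: node and \<Gamma> \<kappa> :: real
  assumes n: "n > 0" and v: "v \<in> level_nodes n" and A: "A \<in> sets borel" and \<kappa>: "0 \<le> \<kappa>"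
    and slab: "(\<integral>\<^sup>+ b. ennreal (normal_density (n * Y v / (n + 1)) (1 / sqrt (n + 1)) b) * indicator A b \<partial>lborel) \<le> ennreal \<kappa>"
  defines "W \<equiv> tree_weight \<Gamma> (max_depth n) (\<lambda>u. marginal_ratio n (Y u))"
  shows "emeasure (posterior \<Gamma> n Y) {\<beta> \<in> space (posterior \<Gamma> n Y). \<beta> v \<in> A} \<le>
    ennreal ((\<Sum>T\<in>full_trees (max_depth n). W T * (if v \<in> internal_nodes T then \<kappa> else indicator A 0)) /
      (\<Sum>T\<in>full_trees (max_depth n). W T))"
proof -
  let ?J = "level_nodes n" and ?C = "cart_prior \<Gamma> n" and ?Tr = "full_trees (max_depth n)"
  have fJ: "finite ?J" by (rule finite_haar_index_le)
  define m0 where "m0 = (\<lambda>u. normal_density 0 (1 / sqrt n) (Y u))"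
  \<comment> \<open>Density of the data when all coefficients vanish; it is common to all trees and
    cancels in the quotient.\<close>
  define c0 where "c0 = (\<Prod>u\<in>?J. m0 u)"
  have m0: "m0 u > 0" for u unfolding m0_def using n by (intro normal_density_pos) simp
  have c0: "c0 > 0" unfolding c0_def using m0 by (intro prod_pos) auto
  have m1: "normal_density 0 (sqrt (1 + 1 / n)) (Y u) = marginal_ratio n (Y u) * m0 u" for u
    unfolding marginal_ratio_def m0_def using normal_density_ratio[OF n, of "Y u"] by simp
  define I where "I = (\<lambda>B :: real set. \<integral>\<^sup>+ b. ennreal (normal_density (n * Y v / (n + 1)) (1 / sqrt (n + 1)) b) * indicator B b \<partial>lborel)"
  have marg: "(\<integral>\<^sup>+ \<beta>. ennreal (likelihood n Y \<beta>) * indicator B (\<beta> v) \<partial>coeff_prior T) =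
      ennreal (c0 * (\<Prod>u\<in>internal_nodes T. marginal_ratio n (Y u))) * (if v \<in> internal_nodes T then I B else indicator B 0)"
    if T: "T \<in> ?Tr" and B: "B \<in> sets borel" for T B
  proof -
    define M where "M = (\<lambda>u. if u \<in> internal_nodes T then std_normal else return borel 0)"
    \<comment> \<open>The restriction on coordinate v is put into its own factor, which keeps the
      integrand a product over coordinates.\<close>
    define h where "h = (\<lambda>u b. ennreal (normal_density b (1 / sqrt n) (Y u)) * (if u = v then indicator B b else 1))"
    define q where "q = (\<lambda>u. m0 u * (if u \<in> internal_nodes T then marginal_ratio n (Y u) else 1))"
    have q0: "q u \<ge> 0" for u unfolding q_def using m0[of u] marginal_ratio_pos[of n "Y u"] by simp
    have nm: "(\<lambda>b. normal_density b (1 / sqrt n) y) \<in> borel_measurable borel" for y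
      unfolding normal_density_def by measurable
    have hm: "h u \<in> borel_measurable borel" for u
      unfolding h_def using nm B by auto
    have sM: "sets (M u) = sets borel" for u by (simp add: M_def)
    have pM: "prob_space (M u)" for u by (auto simp: M_def prob_std_normal intro: prob_space_return)
    have one: "(\<integral>\<^sup>+ b. ennreal (normal_density \<mu> (1 / sqrt (n + 1)) b) \<partial>lborel) = 1" for \<mu>
      by (subst nn_integral_eq_integral) (auto simp: integrable_normal_density integral_normal_density)
    have int: "(\<integral>\<^sup>+ b. h u b \<partial>M u) = ennreal (q u) * (if u = v then if v \<in> internal_nodes T then I B else indicator B 0 else 1)" for u
    proof (cases "u \<in> internal_nodes T")
      case True
      show ?thesis
      proof (cases "u = v")
        case True
        with \<open>u \<in> internal_nodes T\<close> show ?thesis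
          using nn_integral_slab_marginal[OF n B, of "Y v"] m1[of v] by (simp add: M_def h_def q_def I_def mult.commute add.commute)
      next
        case False
        with \<open>u \<in> internal_nodes T\<close> show ?thesis
          using nn_integral_slab_marginal[OF n, of UNIV "Y u"] m1[of u] one[of "n * Y u / (n + 1)"]
          by (simp add: M_def h_def q_def mult.commute add.commute)
      qed
    next
      case False
      then have "(\<integral>\<^sup>+ b. h u b \<partial>M u) = h u 0"
        using hm by (simp add: M_def nn_integral_return)
      then show ?thesis using False by (auto simp: h_def q_def m0_def)
    qed
    have "(\<integral>\<^sup>+ \<beta>. ennreal (likelihood n Y \<beta>) * indicator B (\<beta> v) \<partial>coeff_prior T) =
      (\<integral>\<^sup>+ \<beta>. (\<Prod>u\<in>?J. h u (\<beta> u)) \<partial>PiM haar_index M)"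
      unfolding coeff_prior_def M_def[symmetric]
    proof (rule nn_integral_cong)
      fix \<beta>
      show "ennreal (likelihood n Y \<beta>) * indicator B (\<beta> v) = (\<Prod>u\<in>?J. h u (\<beta> u))"
        unfolding h_def prod.distrib using fJ v
        by (simp add: likelihood_def prod_ennreal)
    qed
    also have "\<dots> = (\<Prod>u\<in>?J. \<integral>\<^sup>+ b. h u b \<partial>M u)"
      using hm sM pM fJ by (intro nn_integral_PiM_prod) (auto cong: measurable_cong_sets)
    also have "\<dots> = (\<Prod>u\<in>?J. ennreal (q u)) * (if v \<in> internal_nodes T then I B else indicator B 0)"
      unfolding int prod.distrib using fJ v by simp
    also have "(\<Prod>u\<in>?J. ennreal (q u)) = ennreal (\<Prod>u\<in>?J. q u)"
      using q0 by (intro prod_ennreal) auto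
    also have "(\<Prod>u\<in>?J. q u) = c0 * (\<Prod>u\<in>internal_nodes T. marginal_ratio n (Y u))"
    proof -
      have "(\<Prod>u\<in>?J. if u \<in> internal_nodes T then marginal_ratio n (Y u) else 1) =
          (\<Prod>u\<in>?J \<inter> internal_nodes T. marginal_ratio n (Y u))"
        using fJ by (simp add: prod.inter_restrict)
      also have "?J \<inter> internal_nodes T = internal_nodes T"
        using internal_nodes_subset[OF T n] by blast
      finally show ?thesis by (simp add: q_def prod.distrib c0_def)
    qed
    finally show ?thesis .
  qed
  have vI: "v \<in> haar_index" using v by simp
  have cart: "(\<integral>\<^sup>+ \<beta>. ennreal (likelihood n Y \<beta>) * indicator B (\<beta> v) \<partial>?C) =
      (\<Sum>T\<in>?Tr. ennreal (c0 * W T) * (if v \<in> internal_nodes T then I B else indicator B 0))"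
    if B: "B \<in> sets borel" for B
  proof -
    have lm: "likelihood n Y \<in> borel_measurable (PiM haar_index (\<lambda>_. borel))"
      unfolding likelihood_def normal_density_def by measurable
    have m: "(\<lambda>\<beta>. ennreal (likelihood n Y \<beta>) * indicator B (\<beta> v)) \<in> borel_measurable (PiM haar_index (\<lambda>_. borel))"
      using lm B vI by measurable
    have "(\<integral>\<^sup>+ \<beta>. ennreal (likelihood n Y \<beta>) * indicator B (\<beta> v) \<partial>?C) =
      (\<integral>\<^sup>+ T. \<integral>\<^sup>+ \<beta>. ennreal (likelihood n Y \<beta>) * indicator B (\<beta> v) \<partial>coeff_prior T \<partial>measure_pmf (tree_prior \<Gamma> n))"
      unfolding cart_prior_def
      by (rule nn_integral_bind[OF m]) (rule measurable_prob_algebraD[OF measurable_coeff_prior])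
    also have "\<dots> = (\<Sum>T\<in>?Tr. (\<integral>\<^sup>+ \<beta>. ennreal (likelihood n Y \<beta>) * indicator B (\<beta> v) \<partial>coeff_prior T) * pmf (tree_prior \<Gamma> n) T)"
      by (rule nn_integral_measure_pmf_support)
        (use finite_full_trees[of "max_depth n"] galton_watson_full_binary_tree[of _ \<Gamma> "max_depth n"] in
          \<open>auto simp: full_trees_def tree_prior_def simp del: int_nat_eq\<close>)
    also have "\<dots> = (\<Sum>T\<in>?Tr. ennreal (c0 * W T) * (if v \<in> internal_nodes T then I B else indicator B 0))"
    proof (rule sum.cong[OF refl])
      fix T assume T: "T \<in> ?Tr"
      have "ennreal (c0 * (\<Prod>u\<in>internal_nodes T. marginal_ratio n (Y u))) * pmf (tree_prior \<Gamma> n) T = ennreal (c0 * W T)"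
        using c0 marginal_ratio_pos[THEN less_imp_le]
        by (subst ennreal_mult[symmetric]) (auto simp: W_def tree_weight_def tree_prior_def mult_ac intro!: prod_nonneg mult_nonneg_nonneg)
      then show "(\<integral>\<^sup>+ \<beta>. ennreal (likelihood n Y \<beta>) * indicator B (\<beta> v) \<partial>coeff_prior T) * pmf (tree_prior \<Gamma> n) T =
        ennreal (c0 * W T) * (if v \<in> internal_nodes T then I B else indicator B 0)"
        unfolding marg[OF T B] by (metis mult.assoc mult.commute)
    qed
    finally show ?thesis .
  qed
  have W0: "W T \<ge> 0" for T unfolding W_def by (intro tree_weight_nonneg marginal_ratio_pos)
  have D: "(\<integral>\<^sup>+ \<beta>. ennreal (likelihood n Y \<beta>) \<partial>?C) = ennreal (c0 * (\<Sum>T\<in>?Tr. W T))"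
  proof -
    have "I UNIV = 1" unfolding I_def
      by (simp add: nn_integral_eq_integral integrable_normal_density integral_normal_density)
    then have "(\<integral>\<^sup>+ \<beta>. ennreal (likelihood n Y \<beta>) \<partial>?C) = (\<Sum>T\<in>?Tr. ennreal (c0 * W T))"
      using cart[of UNIV] by (simp cong: if_cong)
    also have "\<dots> = ennreal (c0 * (\<Sum>T\<in>?Tr. W T))"
      using c0 W0 by (subst sum_ennreal) (auto simp: sum_distrib_left)
    finally show ?thesis .
  qed
  define k where "k = (\<lambda>T. if v \<in> internal_nodes T then \<kappa> else indicator A 0)"
  have k0: "0 \<le> k T" for T unfolding k_def using \<kappa> by simp
  have N: "(\<integral>\<^sup>+ \<beta>. ennreal (likelihood n Y \<beta>) * indicator A (\<beta> v) \<partial>?C) \<le> ennreal (c0 * (\<Sum>T\<in>?Tr. W T * k T))"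
  proof -
    have IA: "I A \<le> ennreal \<kappa>" using slab unfolding I_def by (simp add: add.commute)
    have "(\<Sum>T\<in>?Tr. ennreal (c0 * W T) * (if v \<in> internal_nodes T then I A else indicator A 0)) \<le>
        (\<Sum>T\<in>?Tr. ennreal (c0 * W T) * ennreal (k T))"
      using IA unfolding k_def by (intro sum_mono mult_left_mono) (auto simp: indicator_def)
    also have "\<dots> = ennreal (c0 * (\<Sum>T\<in>?Tr. W T * k T))"
      using c0 W0 k0 by (subst ennreal_mult[symmetric]; (subst sum_ennreal)?) (auto simp: sum_distrib_left mult_ac)
    finally show ?thesis unfolding cart[OF A] .
  qed
  have sp: "sets (posterior \<Gamma> n Y) = sets (PiM haar_index (\<lambda>_. borel))"
    by (simp add: posterior_def sets_cart_prior)
  have E: "{\<beta> \<in> space (posterior \<Gamma> n Y). \<beta> v \<in> A} \<in> sets ?C"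
    unfolding sets_cart_prior sets_eq_imp_space_eq[OF sp] using vI A by measurable
  note [measurable] = measurable_likelihood
  let ?D = "\<integral>\<^sup>+ \<beta>. ennreal (likelihood n Y \<beta>) \<partial>?C"
  have "emeasure (posterior \<Gamma> n Y) {\<beta> \<in> space (posterior \<Gamma> n Y). \<beta> v \<in> A} =
    (\<integral>\<^sup>+ \<beta>. ennreal (likelihood n Y \<beta>) / ?D * indicator {\<beta> \<in> space (posterior \<Gamma> n Y). \<beta> v \<in> A} \<beta> \<partial>?C)"
    unfolding posterior_def using E[unfolded posterior_def] by (subst emeasure_density) auto
  also have "\<dots> = (\<integral>\<^sup>+ \<beta>. (ennreal (likelihood n Y \<beta>) * indicator A (\<beta> v)) / ?D \<partial>?C)"
    by (intro nn_integral_cong) (auto simp: posterior_def divide_ennreal_def indicator_def)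
  also have "\<dots> = (\<integral>\<^sup>+ \<beta>. ennreal (likelihood n Y \<beta>) * indicator A (\<beta> v) \<partial>?C) / ?D"
  proof (rule nn_integral_divide)
    show "(\<lambda>\<beta>. ennreal (likelihood n Y \<beta>) * indicator A (\<beta> v)) \<in> borel_measurable ?C"
      using vI A measurable_likelihood[of n Y \<Gamma>] unfolding measurable_cong_sets[OF sets_cart_prior refl]
      by measurable
  qed
  also have "\<dots> \<le> ennreal (c0 * (\<Sum>T\<in>?Tr. W T * k T)) / ennreal (c0 * (\<Sum>T\<in>?Tr. W T))"
    unfolding D using N by (rule divide_right_mono_ennreal)
  also have "\<dots> = ennreal ((\<Sum>T\<in>?Tr. W T * k T) / (\<Sum>T\<in>?Tr. W T))"
  proof -
    interpret P: prob_space "posterior \<Gamma> n Y" by (rule prob_posterior[OF n])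
    \<comment> \<open>Tree weights may vanish, so positivity of the normalizer is taken from the
      likelihood, which is strictly positive everywhere.\<close>
    have "?D \<noteq> 0"
    proof
      assume "?D = 0"
      then have "AE \<beta> in ?C. ennreal (likelihood n Y \<beta>) = 0" by (subst (asm) nn_integral_0_iff_AE) auto
      then have "AE \<beta> in ?C. False"
      proof eventually_elim
        case (elim \<beta>)
        have "likelihood n Y \<beta> > 0"
          unfolding likelihood_def using n by (auto intro!: prod_pos normal_density_pos)
        then show ?case using elim by (simp add: ennreal_eq_0_iff)
      qed
      then show False using prob_space.AE_False[OF prob_cart_prior] by simp
    qed
    then have "0 < c0 * (\<Sum>T\<in>?Tr. W T)" unfolding D by (simp add: ennreal_eq_0_iff not_le)
    then show ?thesis using c0 W0 k0
      by (subst divide_ennreal) (auto intro!: mult_nonneg_nonneg sum_nonneg)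
  qed
  finally show ?thesis unfolding k_def .
qed

section \<open>Haar coefficients of locally Hoelder functions\<close>

definition dyadic :: "nat \<Rightarrow> nat \<Rightarrow> real set" where
  "dyadic l k = {k / 2 ^ l <.. (k + 1) / 2 ^ l}"

text \<open>The truncation at \<open>0\<close> puts the point \<open>0\<close> into the leftmost interval.\<close>

definition dyadic_pos :: "nat \<Rightarrow> real \<Rightarrow> nat" where
  "dyadic_pos l x = nat (\<lceil>2 ^ l * x\<rceil> - 1)"

lemma dyadic_pos_0 [simp]: "dyadic_pos l 0 = 0"
  by (simp add: dyadic_pos_def)

lemma dyadic_pos_eq_iff:
  assumes "x > 0"
  shows "dyadic_pos l x = k \<longleftrightarrow> real k < 2 ^ l * x \<and> 2 ^ l * x \<le> real k + 1"
proof -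
  have "\<lceil>2 ^ l * x\<rceil> \<ge> 1" using assms by simp
  then have "dyadic_pos l x = k \<longleftrightarrow> \<lceil>2 ^ l * x\<rceil> = int k + 1" unfolding dyadic_pos_def by linarith
  then show ?thesis by (simp add: ceiling_eq_iff)
qed

lemma dyadic_pos_eq_iff_mem:
  assumes "x > 0"
  shows "dyadic_pos l x = k \<longleftrightarrow> x \<in> dyadic l k"
  unfolding dyadic_pos_eq_iff[OF assms] dyadic_def by (auto simp: field_simps)

lemma dyadic_pos_less:
  assumes "0 \<le> x" "x \<le> 1"
  shows "dyadic_pos l x < 2 ^ l"
proof -
  have "\<lceil>2 ^ l * x\<rceil> \<le> 2 ^ l" using assms by (simp add: ceiling_le_iff)
  then have "nat (\<lceil>2 ^ l * x\<rceil> - 1) \<le> nat (2 ^ l - 1)" by (intro nat_mono) simp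
  also have "\<dots> < 2 ^ l" by (simp add: nat_diff_distrib nat_power_eq)
  finally show ?thesis by (simp add: dyadic_pos_def)
qed

lemma dyadic_pos_Suc_div:
  assumes "0 \<le> x"
  shows "dyadic_pos (Suc l) x div 2 = dyadic_pos l x"
proof (cases "x = 0")
  case False
  then have x: "x > 0" using assms by simp
  define k where "k = dyadic_pos (Suc l) x"
  have "real k < 2 ^ Suc l * x" "2 ^ Suc l * x \<le> real k + 1"
    using dyadic_pos_eq_iff[OF x, of "Suc l" k] k_def by auto
  moreover have "real k = 2 * real (k div 2) + real (k mod 2)"
    by (metis div_mult_mod_eq mult.commute of_nat_add of_nat_mult of_nat_numeral)
  moreover have "real (k mod 2) \<le> 1" "real (k mod 2) \<ge> 0" by auto
  ultimately have "real (k div 2) < 2 ^ l * x" "2 ^ l * x \<le> real (k div 2) + 1"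
    by auto
  then have "dyadic_pos l x = k div 2" by (subst dyadic_pos_eq_iff[OF x]) simp
  then show ?thesis by (simp add: k_def)
qed simp

lemma dyadic_pos_bounds:
  assumes "0 \<le> x"
  shows "dyadic_pos l x / 2 ^ l \<le> x" "x \<le> (dyadic_pos l x + 1) / 2 ^ l"
proof -
  show "dyadic_pos l x / 2 ^ l \<le> x"
    using dyadic_pos_eq_iff[of x l "dyadic_pos l x"] assms by (cases "x = 0") (auto simp: field_simps)
  show "x \<le> (dyadic_pos l x + 1) / 2 ^ l"
    using dyadic_pos_eq_iff[of x l "dyadic_pos l x"] assms by (cases "x = 0") (auto simp: field_simps)
qed

lemma dyadic_subset:
  assumes "l \<le> m"
  shows "dyadic m k \<subseteq> dyadic l (k div 2 ^ (m - l))"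
proof
  fix y assume y: "y \<in> dyadic m k"
  define d where "d = m - l"
  have m: "m = l + d" using assms by (simp add: d_def)
  have "real k / 2 ^ m \<ge> real (k div 2 ^ d) / 2 ^ l"
  proof -
    have "k div 2 ^ d * 2 ^ d \<le> k" by simp
    then have "real (k div 2 ^ d) * 2 ^ d \<le> real k"
      by (metis of_nat_le_iff of_nat_mult of_nat_numeral of_nat_power)
    then show ?thesis unfolding m power_add by (simp add: field_simps)
  qed
  moreover have "(real k + 1) / 2 ^ m \<le> (real (k div 2 ^ d) + 1) / 2 ^ l"
  proof -
    have "k + 1 \<le> (k div 2 ^ d + 1) * 2 ^ d"
      by (metis Suc_eq_plus1 Suc_leI add.commute dividend_less_div_times mult_Suc pos2 zero_less_power)
    then have "real (k + 1) \<le> real ((k div 2 ^ d + 1) * 2 ^ d)" by (rule of_nat_mono)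
    then have "real k + 1 \<le> (real (k div 2 ^ d) + 1) * 2 ^ d"
      by (simp only: of_nat_add of_nat_mult of_nat_power of_nat_numeral of_nat_1)
    then have "(real k + 1) / 2 ^ m \<le> (real (k div 2 ^ d) + 1) * 2 ^ d / 2 ^ m"
      by (rule divide_right_mono) simp
    then show ?thesis unfolding m power_add by simp
  qed
  ultimately show "y \<in> dyadic l (k div 2 ^ (m - l))"
    using y unfolding dyadic_def d_def[symmetric] by auto
qed

lemma dyadic_split: "dyadic l k = dyadic (Suc l) (2 * k) \<union> dyadic (Suc l) (2 * k + 1)"
  "dyadic (Suc l) (2 * k) \<inter> dyadic (Suc l) (2 * k + 1) = {}"
  unfolding dyadic_def by (auto simp: field_simps)

lemma dyadic_subset_unit:
  assumes "k < 2 ^ l"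
  shows "dyadic l k \<subseteq> {0..1}"
proof -
  have "real (k + 1) \<le> real (2 ^ l)" using assms by (subst of_nat_le_iff) simp
  then have "(real k + 1) / 2 ^ l \<le> 1" by (simp add: field_simps)
  then have "y \<le> 1" if "y \<in> dyadic l k" for y using that order_trans unfolding dyadic_def by fastforce
  moreover have "0 \<le> y" if "y \<in> dyadic l k" for y
  proof -
    have "0 \<le> real k / 2 ^ l" by simp
    also have "\<dots> < y" using that by (simp add: dyadic_def)
    finally show ?thesis by simp
  qed
  ultimately show ?thesis by (simp add: subset_iff)
qed

lemma haar_eq_dyadic:
  "x > 0 \<Longrightarrow> haar (int l, k) x = 2 powr (l / 2) * (indicator (dyadic (Suc l) (2 * k)) x - indicator (dyadic (Suc l) (2 * k + 1)) x)"
proof -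
  assume x: "x > 0"
  have "indicator {0<..1/2} (2 ^ l * x - real k) = (indicator (dyadic (Suc l) (2 * k)) x :: real)"
    "indicator {1/2<..1} (2 ^ l * x - real k) = (indicator (dyadic (Suc l) (2 * k + 1)) x :: real)"
    by (auto simp: indicator_def dyadic_def field_simps)
  moreover have "(2::real) powr int l = 2 ^ l" by (simp add: powr_realpow)
  ultimately show ?thesis using x by (simp add: haar_def haar_mother_def)
qed

text \<open>The sign is positive on the left half of the interval, the one of even position at the
  next level. At x = 0 this agrees with the convention in \<open>haar\<close>, because
  \<open>dyadic_pos\<close> is 0 there at every level.\<close>

lemma haar_eq_pos:
  assumes "0 \<le> x" "x \<le> 1"
  shows "haar (int l, k) x =
    (if k = dyadic_pos l x then 2 powr (l / 2) * (if even (dyadic_pos (Suc l) x) then 1 else -1) else 0)"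
proof (cases "x = 0")
  case True
  then show ?thesis by (auto simp: haar_def haar_mother_def indicator_def)
next
  case False
  then have x: "x > 0" using assms by simp
  define m where "m = dyadic_pos (Suc l) x"
  have p: "dyadic_pos l x = m div 2" using dyadic_pos_Suc_div[of x l] assms by (simp add: m_def)
  have i: "indicator (dyadic (Suc l) j) x = (if j = m then 1 else 0 :: real)" for j
    using dyadic_pos_eq_iff_mem[OF x, of "Suc l" j] by (auto simp: m_def indicator_def)
  consider "m = 2 * k" | "m = 2 * k + 1" | "m \<noteq> 2 * k" "m \<noteq> 2 * k + 1" "k \<noteq> m div 2" by fastforce
  then show ?thesis
    unfolding haar_eq_dyadic[OF x] m_def[symmetric] p i by cases simp_all
qed

text \<open>On each level a point meets the support of one Haar function only. Shifting the level by
  one lets the induction start from the constant function alone.\<close>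

lemma haar_sum_eq:
  assumes "0 \<le> x" "x \<le> 1"
  shows "haar_sum (int L - 1) \<beta> x = \<beta> (-1, 0) + (\<Sum>l<L. \<beta> (int l, dyadic_pos l x) * haar (int l, dyadic_pos l x) x)"
proof (induction L)
  case 0
  have "{v \<in> haar_index. fst v \<le> int 0 - 1} = {(-1, 0)}" by (auto simp: haar_index_def)
  then show ?case using assms by (simp add: haar_sum_def haar_def)
next
  case (Suc L)
  have e: "{v \<in> haar_index. fst v \<le> int (Suc L) - 1} =
      {v \<in> haar_index. fst v \<le> int L - 1} \<union> Pair (int L) ` {..<2 ^ L}"
    by (auto simp: haar_index_def image_iff)
  have "(\<Sum>v\<in>Pair (int L) ` {..<2 ^ L}. \<beta> v * haar v x) = (\<Sum>k<2 ^ L. \<beta> (int L, k) * haar (int L, k) x)"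
    by (subst sum.reindex) (auto intro: inj_onI)
  also have "\<dots> = (\<Sum>k<2 ^ L. if k = dyadic_pos L x then \<beta> (int L, k) * haar (int L, k) x else 0)"
    by (intro sum.cong) (auto simp: haar_eq_pos[OF assms])
  also have "\<dots> = \<beta> (int L, dyadic_pos L x) * haar (int L, dyadic_pos L x) x"
    using dyadic_pos_less[OF assms] by (simp add: sum.delta)
  finally have s: "(\<Sum>v\<in>Pair (int L) ` {..<2 ^ L}. \<beta> v * haar v x) = \<beta> (int L, dyadic_pos L x) * haar (int L, dyadic_pos L x) x" .
  have "haar_sum (int (Suc L) - 1) \<beta> x = haar_sum (int L - 1) \<beta> x + (\<Sum>v\<in>Pair (int L) ` {..<2 ^ L}. \<beta> v * haar v x)"
    unfolding haar_sum_def e by (subst sum.union_disjoint[OF finite_haar_index_le]) auto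
  then show ?case unfolding s Suc.IH by simp
qed

section \<open>Integrals over dyadic intervals\<close>

definition dyadic_int :: "(real \<Rightarrow> real) \<Rightarrow> nat \<Rightarrow> nat \<Rightarrow> real" where
  "dyadic_int f l k = (LINT x:dyadic l k|lborel. f x)"

lemma dyadic_sets [measurable]: "dyadic l k \<in> sets borel"
  by (simp add: dyadic_def)

lemma set_integrable_dyadic:
  fixes f :: "real \<Rightarrow> real"
  assumes "set_integrable lborel {0..1} f" "k < 2 ^ l"
  shows "set_integrable lborel (dyadic l k) f"
  by (rule set_integrable_subset[OF assms(1)]) (use dyadic_subset_unit[OF assms(2)] in \<open>auto simp: dyadic_def\<close>)

lemma measure_dyadic: "measure lborel (dyadic l k) = 1 / 2 ^ l" "emeasure lborel (dyadic l k) < \<infinity>"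
proof -
  have "real k / 2 ^ l \<le> (real k + 1) / 2 ^ l" by (intro divide_right_mono) auto
  then show "measure lborel (dyadic l k) = 1 / 2 ^ l" "emeasure lborel (dyadic l k) < \<infinity>"
    unfolding dyadic_def by (auto simp: diff_divide_distrib[symmetric])
qed

lemma dyadic_int_approx:
  assumes f: "set_integrable lborel {0..1} f" and k: "k < 2 ^ l"
    and \<delta>: "\<And>y. y \<in> dyadic l k \<Longrightarrow> \<bar>f y - c\<bar> \<le> \<delta>"
  shows "\<bar>dyadic_int f l k - c / 2 ^ l\<bar> \<le> \<delta> / 2 ^ l"
proof -
  note fi = set_integrable_dyadic[OF f k]
  have ci: "set_integrable lborel (dyadic l k) (\<lambda>_. a :: real)" for a
    unfolding set_integrable_def using measure_dyadic(2)[of l k] by simp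
  have c: "(LINT y:dyadic l k|lborel. (a :: real)) = a / 2 ^ l" for a
    unfolding set_lebesgue_integral_def using measure_dyadic[of l k] by simp
  have "dyadic_int f l k - c / 2 ^ l = (LINT y:dyadic l k|lborel. f y - c)"
    unfolding dyadic_int_def c[symmetric] using fi ci by (subst set_integral_diff) auto
  also have "\<bar>\<dots>\<bar> \<le> (LINT y:dyadic l k|lborel. \<bar>f y - c\<bar>)"
    using set_integral_norm_bound[of lborel "dyadic l k" "\<lambda>y. f y - c"] set_integral_diff(1)[OF fi ci] by simp
  also have "\<dots> \<le> (LINT y:dyadic l k|lborel. \<delta>)"
    using set_integral_diff(1)[OF fi ci] ci \<delta> by (intro set_integral_mono set_integrable_abs) auto
  finally show ?thesis by (simp add: c)
qed

lemma dyadic_int_split: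
  assumes f: "set_integrable lborel {0..1} f" and k: "k < 2 ^ l"
  shows "dyadic_int f l k = dyadic_int f (Suc l) (2 * k) + dyadic_int f (Suc l) (2 * k + 1)"
  unfolding dyadic_int_def
  by (subst dyadic_split(1), rule set_integral_Un)
    (use dyadic_split(2)[of l k] k set_integrable_dyadic[OF f] in auto)

lemma haar_coeff_eq:
  assumes f: "set_integrable lborel {0..1} f" and k: "k < 2 ^ l"
  shows "haar_coeff f (int l, k) = 2 powr (l / 2) * (dyadic_int f (Suc l) (2 * k) - dyadic_int f (Suc l) (2 * k + 1))"
proof -
  let ?A = "dyadic (Suc l) (2 * k)" and ?B = "dyadic (Suc l) (2 * k + 1)"
  have AB: "?A \<subseteq> {0..1}" "?B \<subseteq> {0..1}" using k by (intro dyadic_subset_unit; simp)+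
  have i: "set_integrable lborel ?A f" "set_integrable lborel ?B f"
    using k by (intro set_integrable_dyadic[OF f]; simp)+
  have "haar_coeff f (int l, k) = (LINT x|lborel. 2 powr (l / 2) * (indicator ?A x * f x - indicator ?B x * f x))"
    unfolding haar_coeff_def set_lebesgue_integral_def
  proof (rule integral_cong_AE)
    have m: "(\<lambda>x. indicator {0..1} x *\<^sub>R f x) \<in> borel_measurable lborel"
      using f by (simp add: set_integrable_def)
    have h: "haar (int l, k) \<in> borel_measurable lborel"
    proof -
      have "haar (int l, k) = (\<lambda>x. if k = 0 \<and> x = 0 then 2 powr (l / 2) else 2 powr (l / 2) *
          (indicator {0<..1/2} (2 powr l * x - k) - indicator {1/2<..1} (2 powr l * x - k)))"
        by (simp add: haar_def haar_mother_def fun_eq_iff)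
      also have "\<dots> \<in> borel_measurable lborel" by measurable
      finally show ?thesis .
    qed
    show "(\<lambda>x. indicator {0..1} x *\<^sub>R (f x * haar (int l, k) x)) \<in> borel_measurable lborel"
      using borel_measurable_times[OF m h] by (simp add: mult.assoc)
    show "(\<lambda>x. 2 powr (l / 2) * (indicator ?A x * f x - indicator ?B x * f x)) \<in> borel_measurable lborel"
      using i unfolding set_integrable_def by (auto intro!: borel_measurable_times borel_measurable_diff)
    \<comment> \<open>The dyadic form of \<open>haar\<close> is available for positive x; the point
      0 is a null set.\<close>
    have "AE x in lborel. x \<noteq> (0::real)" by (rule AE_lborel_singleton)
    then show "AE x in lborel. indicator {0..1} x *\<^sub>R (f x * haar (int l, k) x) =
        2 powr (l / 2) * (indicator ?A x * f x - indicator ?B x * f x)"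
    proof eventually_elim
      case (elim x)
      show ?case
      proof (cases "x \<in> {0..1}")
        case True
        then show ?thesis using elim by (simp add: haar_eq_dyadic algebra_simps)
      next
        case False
        then have "x \<notin> ?A" "x \<notin> ?B" using AB by auto
        then show ?thesis using False by simp
      qed
    qed
  qed
  also have "\<dots> = 2 powr (l / 2) * (dyadic_int f (Suc l) (2 * k) - dyadic_int f (Suc l) (2 * k + 1))"
    using i unfolding set_integrable_def dyadic_int_def set_lebesgue_integral_def by simp
  finally show ?thesis .
qed

text \<open>The two halves have equal length, so the constant c cancels and only the oscillation
  \<delta> remains, weighted by the L1 norm 2^(-l/2) of the Haar function. The free choice of c
  allows a comparison with the value of f at a point outside the interval.\<close>

lemma haar_coeff_le:
  assumes f: "set_integrable lborel {0..1} f" and k: "k < 2 ^ l"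
    and \<delta>: "\<And>y. y \<in> dyadic l k \<Longrightarrow> \<bar>f y - c\<bar> \<le> \<delta>"
  shows "\<bar>haar_coeff f (int l, k)\<bar> \<le> \<delta> * 2 powr (- real l / 2)"
proof -
  have a: "\<bar>dyadic_int f (Suc l) (2 * k) - c / 2 ^ Suc l\<bar> \<le> \<delta> / 2 ^ Suc l"
    using k dyadic_split(1)[of l k] by (intro dyadic_int_approx[OF f] \<delta>) auto
  have b: "\<bar>dyadic_int f (Suc l) (2 * k + 1) - c / 2 ^ Suc l\<bar> \<le> \<delta> / 2 ^ Suc l"
    using k dyadic_split(1)[of l k] by (intro dyadic_int_approx[OF f] \<delta>) auto
  have "\<bar>dyadic_int f (Suc l) (2 * k) - dyadic_int f (Suc l) (2 * k + 1)\<bar> \<le> \<delta> / 2 ^ Suc l + \<delta> / 2 ^ Suc l"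
    using a b by linarith
  also have "\<dots> = \<delta> / 2 ^ l" by simp
  finally have "\<bar>haar_coeff f (int l, k)\<bar> \<le> 2 powr (l / 2) * (\<delta> / 2 ^ l)"
    unfolding haar_coeff_eq[OF f k] abs_mult by (simp add: mult_left_mono del: times_divide_eq_right)
  also have "\<dots> = \<delta> * (2 powr (l / 2) / 2 powr l)" by (simp add: powr_realpow)
  also have "2 powr (l / 2) / 2 powr l = 2 powr (- real l / 2)"
    by (simp add: powr_diff[symmetric])
  finally show ?thesis .
qed

text \<open>The partial Haar sum is the mean of f over the dyadic interval of x: the term of level L
  replaces the mean over an interval by the mean over its half belonging to x. Truncation bias thus
  becomes local oscillation.\<close>

lemma haar_sum_coeff:
  assumes f: "set_integrable lborel {0..1} f" and x: "0 \<le> x" "x \<le> 1"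
  shows "haar_sum (int L - 1) (haar_coeff f) x = 2 ^ L * dyadic_int f L (dyadic_pos L x)"
  unfolding haar_sum_eq[OF x]
proof (induction L)
  case 0
  have "haar_coeff f (-1, 0) = (LINT x:{0..1}|lborel. f x)"
    unfolding haar_coeff_def set_lebesgue_integral_def haar_def
    by (intro Bochner_Integration.integral_cong) (auto simp: indicator_def)
  also have "\<dots> = dyadic_int f 0 0"
    unfolding dyadic_int_def set_lebesgue_integral_def
  proof (rule integral_cong_AE)
    show "(\<lambda>x. indicator {0..1} x *\<^sub>R f x) \<in> borel_measurable lborel"
      using f by (simp add: set_integrable_def)
    show "(\<lambda>x. indicator (dyadic 0 0) x *\<^sub>R f x) \<in> borel_measurable lborel"
      using set_integrable_dyadic[OF f, of 0 0] by (simp add: set_integrable_def)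
    have "AE x in lborel. x \<noteq> (0::real)" by (rule AE_lborel_singleton)
    then show "AE x in lborel. indicator {0..1} x *\<^sub>R f x = indicator (dyadic 0 0) x *\<^sub>R f x"
      by eventually_elim (auto simp: indicator_def dyadic_def)
  qed
  finally show ?case using dyadic_pos_less[OF x, of 0] by simp
next
  case (Suc L)
  define k where "k = dyadic_pos L x"
  define m where "m = dyadic_pos (Suc L) x"
  have k: "k < 2 ^ L" unfolding k_def by (rule dyadic_pos_less[OF x])
  have m: "m div 2 = k" unfolding k_def m_def by (rule dyadic_pos_Suc_div[OF x(1)])
  have p: "2 powr (L / 2) * (2 powr (L / 2)) = (2 ^ L :: real)"
    by (simp add: powr_add[symmetric] powr_realpow)
  have "haar_coeff f (int L, k) * haar (int L, k) x =
      (2 powr (L / 2) * 2 powr (L / 2)) * (dyadic_int f (Suc L) (2 * k) - dyadic_int f (Suc L) (2 * k + 1)) * (if even m then 1 else -1)"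
    unfolding haar_coeff_eq[OF f k] haar_eq_pos[OF x] m_def[symmetric] k_def[symmetric] by simp
  moreover have "m = 2 * k \<or> m = 2 * k + 1" using m by presburger
  ultimately have "2 ^ L * dyadic_int f L k + haar_coeff f (int L, k) * haar (int L, k) x = 2 ^ Suc L * dyadic_int f (Suc L) m"
    unfolding p dyadic_int_split[OF f k] by (auto simp: algebra_simps)
  then show ?case using Suc.IH unfolding k_def m_def by simp
qed

section \<open>Consequences of the local Hoelder condition\<close>

lemma local_HoelderD:
  assumes "f \<in> local_Hoelder t M \<eta>" "x \<in> {0..1}"
  shows "\<And>y. y \<in> {0..1} \<Longrightarrow> \<bar>f y\<bar> \<le> M x"
    and "\<And>y. y \<in> {0..1} \<Longrightarrow> \<bar>y - x\<bar> \<le> \<eta> x \<Longrightarrow> \<bar>f y - f x\<bar> \<le> M x * \<bar>y - x\<bar> powr t x"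
proof -
  have le: "(SUP y\<in>{0..1}. ereal \<bar>f y\<bar>) \<le> ereal (M x)"
    "(SUP m\<in>{m. 0 < \<bar>m\<bar> \<and> \<bar>m\<bar> \<le> \<eta> x \<and> x + m \<in> {0..1}}. ereal (\<bar>f (x + m) - f x\<bar> / \<bar>m\<bar> powr t x)) \<le> ereal (M x)"
    using assms by (auto simp: local_Hoelder_def)
  show b: "\<bar>f y\<bar> \<le> M x" if "y \<in> {0..1}" for y
    using le(1) that unfolding SUP_le_iff by fastforce
  show "\<bar>f y - f x\<bar> \<le> M x * \<bar>y - x\<bar> powr t x" if y: "y \<in> {0..1}" "\<bar>y - x\<bar> \<le> \<eta> x" for y
  proof (cases "y = x")
    case True
    then show ?thesis using b[OF y(1)] by simp
  next
    case False
    then have "y - x \<in> {m. 0 < \<bar>m\<bar> \<and> \<bar>m\<bar> \<le> \<eta> x \<and> x + m \<in> {0..1}}" using y by simp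
    with le(2) have "ereal (\<bar>f (x + (y - x)) - f x\<bar> / \<bar>y - x\<bar> powr t x) \<le> ereal (M x)"
      unfolding SUP_le_iff by blast
    then show ?thesis using False by (simp add: field_simps)
  qed
qed

text \<open>Measurability is not part of the class; it follows from continuity, which the Hoelder
  condition gives at each point because t x and \<eta> x are positive.\<close>

lemma local_Hoelder_set_integrable:
  assumes f: "f \<in> local_Hoelder t M \<eta>" and pos: "\<And>x. x \<in> {0..1} \<Longrightarrow> 0 < t x \<and> 0 < \<eta> x"
  shows "set_integrable lborel {0..1} f"
proof -
  have "continuous_on {0..1} f"
    unfolding continuous_on
  proof
    fix x :: real assume x: "x \<in> {0..1}"
    have "((\<lambda>y. M x * \<bar>y - x\<bar> powr t x) \<longlongrightarrow> M x * 0 powr t x) (at x within {0..1})"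
    proof (intro tendsto_mult tendsto_const tendsto_powr')
      show "((\<lambda>y. \<bar>y - x\<bar>) \<longlongrightarrow> 0) (at x within {0..1})"
        by (auto intro!: tendsto_eq_intros)
      show "(0::real) \<noteq> 0 \<or> 0 < t x \<and> (\<forall>\<^sub>F y in at x within {0..1}. 0 \<le> \<bar>y - x\<bar>)"
        using pos[OF x] by simp
    qed
    then have "((\<lambda>y. M x * \<bar>y - x\<bar> powr t x) \<longlongrightarrow> 0) (at x within {0..1})" by simp
    moreover have "\<forall>\<^sub>F y in at x within {0..1}. norm (f y - f x) \<le> M x * \<bar>y - x\<bar> powr t x"
      unfolding eventually_at
      using local_HoelderD(2)[OF f x] pos[OF x] by (intro exI[of _ "\<eta> x"]) (auto simp: dist_real_def)
    ultimately have "((\<lambda>y. f y - f x) \<longlongrightarrow> 0) (at x within {0..1})"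
      by (rule Lim_null_comparison[rotated])
    then show "(f \<longlongrightarrow> f x) (at x within {0..1})" by (simp add: LIM_zero_iff)
  qed
  then show ?thesis by (rule borel_integrable_atLeastAtMost'[unfolded box_real])
qed

section \<open>The deterministic error bound\<close>

lemma sum_powr_half: "1 + (\<Sum>l<m. 2 powr (real l / 2)) \<le> 4 * 2 powr (real m / 2)"
proof (induction m)
  case (Suc m)
  \<comment> \<open>The induction step amounts to 5 \<le> 4 sqrt 2, which is where the constant 4
    comes from.\<close>
  have "5 / 4 \<le> sqrt (2::real)" by (rule real_le_rsqrt) (simp add: power2_eq_square)
  then have "5 / 4 * 2 powr (real m / 2) \<le> sqrt 2 * 2 powr (real m / 2)" by (intro mult_right_mono) auto
  also have "\<dots> = 2 powr (real (Suc m) / 2)"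
    by (simp add: powr_half_sqrt[symmetric] powr_add[symmetric] add_divide_distrib)
  finally show ?case using Suc by simp
qed simp

lemma sum_power_tail_le:
  fixes z :: real
  assumes "0 \<le> z" "z < 1"
  shows "(\<Sum>l=m..<k. z ^ l) \<le> z ^ m / (1 - z)"
proof (cases "m \<le> k")
  case True
  then have "(1 - z) * (\<Sum>l=m..<k. z ^ l) = z ^ m - z ^ k"
  proof (induction k rule: dec_induct)
    case (step k)
    have "(1 - z) * (\<Sum>l=m..<Suc k. z ^ l) = (1 - z) * (\<Sum>l=m..<k. z ^ l) + (1 - z) * z ^ k"
      using step.hyps by (simp add: distrib_left)
    then show ?case unfolding step.IH by (simp add: algebra_simps)
  qed simp
  then have "(\<Sum>l=m..<k. z ^ l) = (z ^ m - z ^ k) / (1 - z)"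
    using assms by (simp add: eq_divide_eq mult.commute)
  also have "\<dots> \<le> z ^ m / (1 - z)" using assms by (intro divide_right_mono) auto
  finally show ?thesis .
qed (use assms in auto)

lemma two_power_L_max:
  assumes "n > 0"
  shows "2 ^ max_depth n \<le> real n" "real n < 2 * 2 ^ max_depth n"
proof -
  have "real_of_int (L_max n) \<le> log 2 n" "log 2 n < real_of_int (L_max n) + 1"
    unfolding L_max_def by auto
  moreover have "real (max_depth n) = real_of_int (L_max n)" using L_max_nonneg[OF assms] by simp
  ultimately have "real (max_depth n) \<le> log 2 n" "log 2 n < real (max_depth n) + 1" by auto
  then have "2 powr real (max_depth n) \<le> n" "n < 2 powr (real (max_depth n) + 1)"
    using assms by (simp_all add: le_log_iff log_less_iff)
  then show "2 ^ max_depth n \<le> real n" "real n < 2 * 2 ^ max_depth n"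
    by (simp_all add: powr_realpow powr_add)
qed

text \<open>The nodes to be shown not internal. Asking for weak signals at all descendants closes
  the set under children, as the argument with the deepest internal node requires, and avoids any
  reference to \<open>t\<close>. The lower bound on 2^l makes the split probability a high power of
  1 / n.\<close>

definition small_nodes :: "(real \<Rightarrow> real) \<Rightarrow> nat \<Rightarrow> node set" where
  "small_nodes f n = {(l, k). 0 \<le> l \<and> l < L_max n \<and> k < 2 ^ nat l \<and> n powr (1/4) \<le> 2 ^ nat l \<and>
     (\<forall>l' k'. nat l \<le> l' \<and> int l' < L_max n \<and> k' < 2 ^ l' \<and> k' div 2 ^ (l' - nat l) = k \<longrightarrow>
        \<bar>haar_coeff f (int l', k')\<bar> \<le> sqrt (ln n / n))}"

lemma local_Hoelder_dyadic:
  assumes f: "f \<in> local_Hoelder t M \<eta>" and x: "x \<in> {0..1}" and K: "M x \<le> K" "0 \<le> K" and t: "0 < t x"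
    and \<eta>: "1 / 2 ^ l \<le> \<eta> x" and y: "y \<in> dyadic l (dyadic_pos l x)"
  shows "\<bar>f y - f x\<bar> \<le> K * (2 powr (- t x)) ^ l"
proof -
  have pos: "dyadic_pos l x < 2 ^ l" using dyadic_pos_less x by auto
  have y01: "y \<in> {0..1}" using y dyadic_subset_unit[OF pos] by auto
  \<comment> \<open>The left bound is not strict, because x = 0 lies outside the half-open interval
    assigned to it.\<close>
  have "dyadic_pos l x / 2 ^ l \<le> x" "x \<le> (dyadic_pos l x + 1) / 2 ^ l"
    using x by (intro dyadic_pos_bounds; simp)+
  moreover have "dyadic_pos l x / 2 ^ l < y" "y \<le> (dyadic_pos l x + 1) / 2 ^ l"
    using y by (simp_all add: dyadic_def add.commute)
  ultimately have "\<bar>y - x\<bar> \<le> (dyadic_pos l x + 1) / 2 ^ l - dyadic_pos l x / 2 ^ l"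
    by linarith
  also have "\<dots> = 1 / 2 ^ l" by (simp add: diff_divide_distrib[symmetric])
  finally have yx: "\<bar>y - x\<bar> \<le> 1 / 2 ^ l" .
  have "\<bar>f y - f x\<bar> \<le> M x * \<bar>y - x\<bar> powr t x"
    using local_HoelderD(2)[OF f x y01] yx \<eta> by linarith
  also have "\<dots> \<le> K * (1 / 2 ^ l) powr t x"
    using K yx t by (intro mult_mono powr_mono2) auto
  also have "(1 / 2 ^ l :: real) powr t x = (2 powr (- t x)) ^ l"
    by (simp add: powr_divide powr_minus power_one_over inverse_eq_divide powr_realpow[symmetric] powr_powr powr_power mult.commute)
  finally show ?thesis .
qed

text \<open>Purely deterministic. The path of x is cut at a level m with 2^m of the order of the
  critical resolution \<open>a\<close>. Below m the errors B ln n / sqrt n add up to that error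
  times 2^(m/2); from m on all estimated coefficients on the path vanish, and the bias is a
  geometric series whose ratio is bounded through t_1.\<close>

lemma error_bound:
  fixes n :: nat and K B c t\<^sub>1 x :: real
  assumes f: "f \<in> local_Hoelder t M \<eta>" and pos: "\<And>x. x \<in> {0..1} \<Longrightarrow> 0 < t x \<and> 0 < \<eta> x"
    and x: "x \<in> {0..1}" and K: "M x \<le> K" "1 \<le> K" and c: "0 < c" "c \<le> \<eta> x"
    and t: "0 < t\<^sub>1" "t\<^sub>1 \<le> t x" "t x \<le> 1" and B: "0 \<le> B"
    and n: "n \<ge> 3" "n powr (1/4) \<le> (n / ln n) powr (1/3)" "1 / c \<le> n powr (1/4)"
      "2 * K\<^sup>2 * (n / ln n) powr (1 / (2 * t\<^sub>1 + 1)) \<le> n / 2"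
    and small: "\<And>v. v \<in> small_nodes f n \<Longrightarrow> \<beta> v = 0"
    and top: "\<And>v. v \<in> level_nodes n \<Longrightarrow> fst v = L_max n \<Longrightarrow> \<beta> v = 0"
    and low: "\<And>v. v \<in> level_nodes n \<Longrightarrow> fst v < L_max n \<Longrightarrow> \<bar>\<beta> v - haar_coeff f v\<bar> \<le> B * ln n / sqrt n"
  shows "local_rate t n x * \<bar>haar_sum (L_max n) \<beta> x - f x\<bar> \<le>
    8 * K * B * sqrt (ln n) + K / (1 - 2 powr (- t\<^sub>1))"
proof -
  define L where "L = max_depth n"
  define N where "N = n / ln n"
  \<comment> \<open>\<open>a\<close> equates the size a^(-(t x + 1/2)) of a Haar coefficient at
    resolution a with the noise level sqrt (ln n / n); its power t x is the local rate.\<close>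
  define a where "a = N powr (1 / (2 * t x + 1))"
  define \<Delta> where "\<Delta> = (\<lambda>v. \<beta> v - haar_coeff f v)"
  define z where "z = 2 powr (- t x)"
  have Lm: "L_max n = int L" using L_max_nonneg[of n] n by (simp add: L_def)
  have ln1: "1 \<le> ln n"
  proof -
    have "exp 1 \<le> (3::real)" by (rule exp_le)
    then have "exp 1 \<le> real n" using n by linarith
    then show ?thesis using n by (subst ln_ge_iff) auto
  qed
  have n0: "real n > 0" using n by simp
  have lnn: "ln n \<le> n" using ln_bound[OF n0] .
  have N1: "1 \<le> N" using ln1 lnn n by (simp add: N_def le_divide_eq)
  have a1: "1 \<le> a" unfolding a_def using N1 t by (intro ge_one_powr_ge_zero) auto
  have aN: "a powr (2 * t x + 1) = N" unfolding a_def using N1 t by (simp add: powr_powr)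
  have an: "n powr (1/4) \<le> a"
  proof -
    have "n powr (1/4) \<le> N powr (1/3)" using n(2) by (simp add: N_def)
    also have "\<dots> \<le> a" unfolding a_def using N1 t by (intro powr_mono divide_left_mono) auto
    finally show ?thesis .
  qed
  have x01: "0 \<le> x" "x \<le> 1" using x by auto
  have fi: "set_integrable lborel {0..1} f" by (rule local_Hoelder_set_integrable[OF f pos])
  have K2: "1 \<le> K\<^sup>2" using K by simp
  \<comment> \<open>The factor K^2 pushes the coefficients below the noise level: K (K^2 a)^(-(t x +
    1/2)) = K^(-2 t x) a^(-(t x + 1/2)), and K \<ge> 1.\<close>
  define m where "m = nat \<lceil>log 2 (K\<^sup>2 * a)\<rceil>"
  have Ka1: "1 \<le> K\<^sup>2 * a" using mult_mono[OF K2 a1] by simp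
  have m: "K\<^sup>2 * a \<le> 2 ^ m" "2 ^ m \<le> 2 * (K\<^sup>2 * a)"
  proof -
    have l0: "0 \<le> log 2 (K\<^sup>2 * a)" using Ka1 by simp
    then have "real m = of_int \<lceil>log 2 (K\<^sup>2 * a)\<rceil>" by (simp add: m_def)
    then have "log 2 (K\<^sup>2 * a) \<le> real m" "real m \<le> log 2 (K\<^sup>2 * a) + 1"
      using ceiling_correct[of "log 2 (K\<^sup>2 * a)"] by linarith+
    moreover have "log 2 (K\<^sup>2 * a) + 1 = log 2 (2 * (K\<^sup>2 * a))" using Ka1 K a1 by (simp add: log_mult)
    ultimately have "K\<^sup>2 * a \<le> 2 powr real m" "2 powr real m \<le> 2 * (K\<^sup>2 * a)"
      using Ka1 by (simp_all add: log_le_iff le_log_iff)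
    then show "K\<^sup>2 * a \<le> 2 ^ m" "2 ^ m \<le> 2 * (K\<^sup>2 * a)" by (simp_all add: powr_realpow)
  qed
  have am: "a \<le> 2 ^ m"
  proof -
    have "1 * a \<le> K\<^sup>2 * a" using K2 a1 by (intro mult_right_mono) auto
    then show ?thesis using m(1) by simp
  qed
  \<comment> \<open>In the last condition on n, the factor 2 on the left pays for rounding m up and
    the 1/2 on the right for rounding \<open>L_max n\<close> down.\<close>
  have mL: "m < L"
  proof -
    have "a \<le> N powr (1 / (2 * t\<^sub>1 + 1))"
      unfolding a_def using N1 t by (intro powr_mono divide_left_mono) auto
    then have "2 * (K\<^sup>2 * a) \<le> 2 * K\<^sup>2 * N powr (1 / (2 * t\<^sub>1 + 1))" by (simp add: mult_left_mono)
    also have "\<dots> \<le> n / 2" using n(4) by (simp add: N_def)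
    also have "\<dots> < 2 ^ L" using two_power_L_max(2)[of n] n by (simp add: L_def)
    finally have "(2::real) ^ m < 2 ^ L" using m(2) by linarith
    then show ?thesis by simp
  qed
  have \<eta>l: "1 / 2 ^ l \<le> \<eta> x" if "m \<le> l" for l
  proof -
    have "1 / c \<le> 2 ^ m" using n(3) an am by linarith
    also have "(2::real) ^ m \<le> 2 ^ l" using that by simp
    finally have "1 / 2 ^ l \<le> c" using c(1) by (simp add: field_simps)
    then show ?thesis using c(2) by linarith
  qed
  have z: "0 < z" "z \<le> 2 powr (- t\<^sub>1)" "2 powr (- t\<^sub>1) < 1" unfolding z_def using t by (auto simp: powr_less_one)
  have zpow: "z ^ l = (2 ^ l) powr (- t x)" for l
    unfolding z_def by (simp add: powr_realpow[symmetric] powr_powr powr_power mult.commute)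
  have half: "2 powr (- real l / 2) = (2 ^ l) powr (- (1/2))" for l :: nat
    by (simp add: powr_realpow[symmetric] powr_powr)
  \<comment> \<open>The interval of k' need not contain x. It lies inside the interval of level l
    belonging to x, where the Hoelder condition at x bounds the oscillation.\<close>
  have desc: "\<bar>haar_coeff f (int l', k')\<bar> \<le> K * z ^ l * 2 powr (- real l' / 2)"
    if "m \<le> l" "l \<le> l'" "k' < 2 ^ l'" "k' div 2 ^ (l' - l) = dyadic_pos l x" for l l' k'
  proof (rule haar_coeff_le[OF fi that(3)])
    fix y assume "y \<in> dyadic l' k'"
    then have "y \<in> dyadic l (dyadic_pos l x)" using dyadic_subset[OF that(2), of k'] that(4) by auto
    then show "\<bar>f y - f x\<bar> \<le> K * z ^ l"
      unfolding z_def using K pos[OF x] \<eta>l[OF that(1)] by (intro local_Hoelder_dyadic[OF f x]) auto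
  qed
  have smalls: "(int l, dyadic_pos l x) \<in> small_nodes f n" if l: "m \<le> l" "l < L" for l
  proof -
    have "\<bar>haar_coeff f (int l', k')\<bar> \<le> sqrt (ln n / n)"
      if d: "l \<le> l'" "k' < 2 ^ l'" "k' div 2 ^ (l' - l) = dyadic_pos l x" for l' k'
    proof -
      \<comment> \<open>The bound decreases in both levels, so l = l' = m is the worst case.\<close>
      have "K * z ^ l * 2 powr (- real l' / 2) \<le> K * z ^ m * 2 powr (- real m / 2)"
        using K z l d by (intro mult_mono power_decreasing powr_mono mult_nonneg_nonneg) auto
      also have "\<dots> = K * (2 ^ m) powr (- (t x + 1/2))"
        unfolding zpow half by (simp add: powr_add[symmetric])
      also have "\<dots> \<le> K * (K\<^sup>2 * a) powr (- (t x + 1/2))"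
        using m(1) Ka1 K t by (intro mult_left_mono powr_mono2') auto
      also have "\<dots> = K * (K powr (- (2 * t x + 1)) * a powr (- (t x + 1/2)))"
      proof -
        have "(K\<^sup>2) powr (- (t x + 1/2)) = K powr (- (2 * t x + 1))"
        proof -
          have "K\<^sup>2 = K powr 2" using K by simp
          moreover have "2 * - (t x + 1/2) = - (2 * t x + 1)" by simp
          ultimately show ?thesis by (simp only: powr_powr)
        qed
        then show ?thesis using K a1 by (simp add: powr_mult)
      qed
      also have "\<dots> = K powr (- (2 * t x)) * a powr (- (t x + 1/2))"
      proof -
        have "K * K powr (- (2 * t x + 1)) = K powr 1 * K powr (- (2 * t x + 1))" using K by simp
        also have "\<dots> = K powr (- (2 * t x))" by (simp only: powr_add[symmetric]) simp
        finally show ?thesis by (simp add: mult.assoc[symmetric])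
      qed
      also have "\<dots> \<le> 1 * a powr (- (t x + 1/2))"
      proof (intro mult_right_mono)
        have "1 \<le> K powr (2 * t x)" using K t by (intro ge_one_powr_ge_zero) auto
        then show "K powr (- (2 * t x)) \<le> 1" unfolding powr_minus by (rule inverse_le_1_iff[THEN iffD2, OF disjI2])
      qed simp
      also have "a powr (- (t x + 1/2)) = N powr (- (1/2))"
        unfolding aN[symmetric] powr_powr by (simp add: field_simps)
      also have "\<dots> = sqrt (ln n / n)"
        using N1 n0 ln1 by (simp add: powr_minus_divide powr_half_sqrt N_def real_sqrt_divide)
      finally show ?thesis using desc[OF l(1) d] by simp
    qed
    moreover have "n powr (1/4) \<le> 2 ^ l"
    proof -
      have "(2::real) ^ m \<le> 2 ^ l" using l by simp
      then show ?thesis using an am by linarith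
    qed
    ultimately show ?thesis
      unfolding small_nodes_def using l dyadic_pos_less[OF x01, of l] by (auto simp: Lm)
  qed
  have lev: "(int l, dyadic_pos l x) \<in> level_nodes n" if "l \<le> L" for l
    using that dyadic_pos_less[OF x01, of l] by (simp add: haar_index_def Lm)
  have \<Delta>hi: "\<bar>\<Delta> (int l, dyadic_pos l x)\<bar> \<le> K * z ^ l * 2 powr (- real l / 2)" if l: "m \<le> l" "l \<le> L" for l
  proof -
    have "\<beta> (int l, dyadic_pos l x) = 0"
      using small[OF smalls[OF l(1)]] top[OF lev[OF l(2)]] l by (cases "l = L") (auto simp: Lm)
    then show ?thesis unfolding \<Delta>_def using desc[OF l(1) order_refl dyadic_pos_less[OF x01, of l]] by simp
  qed
  define D where "D = B * ln n / sqrt n"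
  have D0: "0 \<le> D" unfolding D_def using B ln1 by simp
  have \<Delta>lo: "\<bar>\<Delta> (int l, dyadic_pos l x)\<bar> \<le> D" if "l < m" for l
    unfolding \<Delta>_def D_def using that mL by (intro low lev) (auto simp: Lm)
  have \<Delta>0: "\<bar>\<Delta> (-1, 0)\<bar> \<le> D"
    unfolding \<Delta>_def D_def by (intro low) (auto simp: haar_index_def Lm)
  have habs: "\<bar>haar (int l, dyadic_pos l x) x\<bar> = 2 powr (real l / 2)" for l
    by (simp add: haar_eq_pos[OF x01] abs_mult)
  have "\<bar>haar_sum (int (Suc L) - 1) \<Delta> x\<bar> \<le> 4 * D * 2 powr (real m / 2) + (\<Sum>l=m..<Suc L. K * z ^ l)"
  proof -
    let ?g = "\<lambda>l. \<bar>\<Delta> (int l, dyadic_pos l x)\<bar> * 2 powr (real l / 2)"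
    have "\<bar>haar_sum (int (Suc L) - 1) \<Delta> x\<bar> \<le> \<bar>\<Delta> (-1, 0)\<bar> + \<bar>\<Sum>l<Suc L. \<Delta> (int l, dyadic_pos l x) * haar (int l, dyadic_pos l x) x\<bar>"
      unfolding haar_sum_eq[OF x01] by (rule abs_triangle_ineq)
    also have "\<dots> \<le> \<bar>\<Delta> (-1, 0)\<bar> + (\<Sum>l<Suc L. ?g l)"
      using sum_abs[of "\<lambda>l. \<Delta> (int l, dyadic_pos l x) * haar (int l, dyadic_pos l x) x" "{..<Suc L}"]
      by (simp only: abs_mult habs)
    also have "(\<Sum>l<Suc L. ?g l) = (\<Sum>l<m. ?g l) + (\<Sum>l=m..<Suc L. ?g l)"
      using sum.atLeastLessThan_concat[of 0 m "Suc L" ?g] mL by (simp add: lessThan_atLeast0)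
    also have "(\<Sum>l<m. ?g l) \<le> (\<Sum>l<m. D * 2 powr (real l / 2))"
      using \<Delta>lo by (intro sum_mono mult_right_mono) auto
    also have "(\<Sum>l=m..<Suc L. ?g l) \<le> (\<Sum>l=m..<Suc L. K * z ^ l)"
    proof (intro sum_mono)
      fix l assume "l \<in> {m..<Suc L}"
      then have "?g l \<le> K * z ^ l * 2 powr (- real l / 2) * 2 powr (real l / 2)"
        using \<Delta>hi[of l] by (intro mult_right_mono) auto
      also have "\<dots> = K * z ^ l" by (simp add: mult.assoc powr_add[symmetric])
      finally show "?g l \<le> K * z ^ l" .
    qed
    also have "\<bar>\<Delta> (-1, 0)\<bar> + ((\<Sum>l<m. D * 2 powr (real l / 2)) + (\<Sum>l=m..<Suc L. K * z ^ l)) \<le>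
        D * (1 + (\<Sum>l<m. 2 powr (real l / 2))) + (\<Sum>l=m..<Suc L. K * z ^ l)"
      using \<Delta>0 by (simp add: sum_distrib_left distrib_left)
    also have "D * (1 + (\<Sum>l<m. 2 powr (real l / 2))) \<le> D * (4 * 2 powr (real m / 2))"
      using D0 by (intro mult_left_mono sum_powr_half)
    finally show ?thesis by simp
  qed
  \<comment> \<open>The truncation bias has the form of one further term, l = Suc L, of the
    geometric series; the sum is extended accordingly afterwards.\<close>
  moreover have "\<bar>haar_sum (int (Suc L) - 1) (haar_coeff f) x - f x\<bar> \<le> K * z ^ Suc L"
  proof -
    have "\<bar>dyadic_int f (Suc L) (dyadic_pos (Suc L) x) - f x / 2 ^ Suc L\<bar> \<le> K * z ^ Suc L / 2 ^ Suc L"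
      using K pos[OF x] \<eta>l[of "Suc L"] mL unfolding z_def
      by (intro dyadic_int_approx[OF fi dyadic_pos_less[OF x01]] local_Hoelder_dyadic[OF f x]) auto
    then have "2 ^ Suc L * \<bar>dyadic_int f (Suc L) (dyadic_pos (Suc L) x) - f x / 2 ^ Suc L\<bar> \<le> K * z ^ Suc L"
      by (simp add: pos_le_divide_eq mult.commute)
    also have "2 ^ Suc L * \<bar>dyadic_int f (Suc L) (dyadic_pos (Suc L) x) - f x / 2 ^ Suc L\<bar> =
        \<bar>2 ^ Suc L * (dyadic_int f (Suc L) (dyadic_pos (Suc L) x) - f x / 2 ^ Suc L)\<bar>"
      by (simp add: abs_mult)
    also have "2 ^ Suc L * (dyadic_int f (Suc L) (dyadic_pos (Suc L) x) - f x / 2 ^ Suc L) =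
        2 ^ Suc L * dyadic_int f (Suc L) (dyadic_pos (Suc L) x) - f x"
      by (simp add: right_diff_distrib)
    finally show ?thesis unfolding haar_sum_coeff[OF fi x01] .
  qed
  moreover have "haar_sum (int (Suc L) - 1) \<beta> x - f x =
      haar_sum (int (Suc L) - 1) \<Delta> x + (haar_sum (int (Suc L) - 1) (haar_coeff f) x - f x)"
    unfolding haar_sum_def \<Delta>_def by (simp add: left_diff_distrib sum_subtractf)
  ultimately have "\<bar>haar_sum (L_max n) \<beta> x - f x\<bar> \<le> 4 * D * 2 powr (real m / 2) + (\<Sum>l=m..<Suc (Suc L). K * z ^ l)"
    using mL by (simp add: Lm)
  also have "(\<Sum>l=m..<Suc (Suc L). K * z ^ l) \<le> K * (z ^ m / (1 - 2 powr (- t\<^sub>1)))"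
  proof -
    have "(\<Sum>l=m..<Suc (Suc L). z ^ l) \<le> z ^ m / (1 - z)" using z by (intro sum_power_tail_le) auto
    also have "\<dots> \<le> z ^ m / (1 - 2 powr (- t\<^sub>1))" using z by (intro divide_left_mono mult_pos_pos) auto
    finally show ?thesis unfolding sum_distrib_left[symmetric] using K by (intro mult_left_mono) simp_all
  qed
  finally have main: "\<bar>haar_sum (L_max n) \<beta> x - f x\<bar> \<le> 4 * D * 2 powr (real m / 2) + K * (z ^ m / (1 - 2 powr (- t\<^sub>1)))"
    by simp
  have rate: "local_rate t n x = a powr t x"
    unfolding local_rate_def a_def N_def[symmetric] by (simp add: powr_powr)
  \<comment> \<open>By the choice of \<open>a\<close>, its power t x times sqrt a equals sqrt N;
    together with D sqrt N = B sqrt (ln n) this is the source of the logarithmic loss.\<close>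
  have p1: "a powr t x * 2 powr (real m / 2) \<le> 2 * K * sqrt N"
  proof -
    have "2 powr (real m / 2) = (2 ^ m) powr (1/2)" by (simp add: powr_realpow[symmetric] powr_powr)
    also have "\<dots> \<le> (2 * (K\<^sup>2 * a)) powr (1/2)" using m(2) by (intro powr_mono2) auto
    also have "\<dots> = sqrt 2 * (K * a powr (1/2))"
      using K a1 by (simp add: powr_half_sqrt real_sqrt_mult)
    also have "\<dots> \<le> 2 * (K * a powr (1/2))"
      using K by (intro mult_right_mono) (auto intro: real_le_lsqrt)
    finally have "a powr t x * 2 powr (real m / 2) \<le> a powr t x * (2 * (K * a powr (1/2)))"
      by (intro mult_left_mono) auto
    also have "\<dots> = 2 * K * a powr (t x + 1/2)" by (simp add: powr_add)
    also have "a powr (t x + 1/2) = N powr (1/2)"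
      unfolding aN[symmetric] powr_powr by (simp add: field_simps)
    also have "\<dots> = sqrt N" using N1 by (simp add: powr_half_sqrt)
    finally show ?thesis .
  qed
  have p2: "a powr t x * z ^ m \<le> 1"
  proof -
    have "z ^ m \<le> a powr (- t x)" unfolding zpow using am a1 t by (intro powr_mono2') auto
    then have "a powr t x * z ^ m \<le> a powr t x * a powr (- t x)" by (intro mult_left_mono) auto
    also have "\<dots> = 1" using a1 by (simp add: powr_add[symmetric])
    finally show ?thesis .
  qed
  have DN: "D * sqrt N = B * sqrt (ln n)"
  proof -
    have "D * sqrt N = B * (ln n / sqrt (ln n))" unfolding D_def N_def real_sqrt_divide using n0 by simp
    then show ?thesis using ln1 by (simp only: real_div_sqrt)
  qed
  have "local_rate t n x * \<bar>haar_sum (L_max n) \<beta> x - f x\<bar> \<le>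
      a powr t x * (4 * D * 2 powr (real m / 2) + K * (z ^ m / (1 - 2 powr (- t\<^sub>1))))"
    unfolding rate using main by (intro mult_left_mono) auto
  also have "\<dots> = 4 * D * (a powr t x * 2 powr (real m / 2)) + K / (1 - 2 powr (- t\<^sub>1)) * (a powr t x * z ^ m)"
    by (simp add: algebra_simps)
  also have "\<dots> \<le> 4 * D * (2 * K * sqrt N) + K / (1 - 2 powr (- t\<^sub>1)) * 1"
    using p1 p2 D0 K z(3) by (intro add_mono mult_left_mono) auto
  also have "\<dots> = 8 * K * (D * sqrt N) + K / (1 - 2 powr (- t\<^sub>1))" by simp
  finally show ?thesis unfolding DN by simp
qed

section \<open>Nodes without signal\<close>

text \<open>A crude count suffices, since every node will contribute O(n^(-4)) only.\<close>

lemma card_level_nodes: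
  assumes "n \<ge> 2"
  shows "real (card (level_nodes n)) \<le> 2 * n\<^sup>2"
proof -
  let ?L = "max_depth n"
  have L0: "0 \<le> L_max n" using L_max_nonneg[of n] assms by simp
  have "level_nodes n \<subseteq> insert (-1, 0) ({0..int ?L} \<times> {..<2 ^ ?L})"
  proof
    fix v assume v: "v \<in> level_nodes n"
    obtain l k where lk: "v = (l, k)" by (cases v)
    show "v \<in> insert (-1, 0) ({0..int ?L} \<times> {..<2 ^ ?L})"
    proof (cases "v = (-1, 0)")
      case False
      then have l: "0 \<le> l" "k < 2 ^ nat l" "l \<le> L_max n" using v lk by (auto simp: haar_index_def)
      then have "(2::nat) ^ nat l \<le> 2 ^ ?L" by (intro power_increasing nat_mono) auto
      with l(2) have "k < 2 ^ ?L" by (rule less_le_trans)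
      then show ?thesis using l lk by auto
    qed simp
  qed
  then have "card (level_nodes n) \<le> card (insert (-1, 0) ({0..int ?L} \<times> {..<(2::nat) ^ ?L}))"
    by (intro card_mono) auto
  also have "\<dots> \<le> Suc (card ({0..int ?L} \<times> {..<(2::nat) ^ ?L}))" by (simp add: card_insert_if)
  also have "\<dots> = Suc (Suc ?L * 2 ^ ?L)" by (simp add: card_cartesian_product nat_add_distrib)
  finally have c: "card (level_nodes n) \<le> Suc (Suc ?L * 2 ^ ?L)" .
  have "real (2 ^ ?L) \<le> real n" using two_power_L_max(1)[of n] assms by simp
  then have p: "2 ^ ?L \<le> n" unfolding of_nat_le_iff .
  have "?L < 2 ^ ?L" by (rule less_exp)
  then have "Suc ?L \<le> n" using p by linarith
  then have "Suc ?L * 2 ^ ?L \<le> n * n" using p by (intro mult_le_mono) auto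
  then have "card (level_nodes n) \<le> Suc (n * n)" using c by linarith
  also have "\<dots> \<le> 2 * (n * n)" using assms by (cases n) auto
  finally have "real (card (level_nodes n)) \<le> real (2 * (n * n))" by (rule of_nat_mono)
  then show ?thesis by (simp add: power2_eq_square)
qed

lemma power_divide_cancel: "x \<noteq> 0 \<Longrightarrow> x ^ a / x ^ (a + b) = 1 / x ^ b" for x :: real
  by (simp add: power_add)

text \<open>The 4 is 3 for the noise plus 1 for a weak signal. The exponent is below n y^2 / 2,
  hence at most 8 ln n, and the factor 1 / sqrt (n + 1) is simply dropped.\<close>

lemma marginal_ratio_le:
  assumes n: "n > 0" and ln: "0 \<le> ln n" and y: "\<bar>y\<bar> \<le> 4 * sqrt (ln n / n)"
  shows "marginal_ratio n y \<le> real n ^ 8"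
proof -
  have "y\<^sup>2 \<le> (4 * sqrt (ln n / n))\<^sup>2" using y by (metis abs_ge_zero power2_abs power_mono)
  also have "\<dots> = 16 * (ln n / n)" using n ln by (simp add: power_mult_distrib)
  finally have "(real n)\<^sup>2 * y\<^sup>2 / (2 * (real n + 1)) \<le> (real n)\<^sup>2 * (16 * (ln n / n)) / (2 * (real n + 1))"
    by (intro divide_right_mono mult_left_mono) auto
  also have "\<dots> = 8 * ln n * (n / (real n + 1))" using n by (simp add: field_simps power2_eq_square)
  also have "\<dots> \<le> 8 * ln n * 1" using ln by (intro mult_left_mono) auto
  finally have "exp ((real n)\<^sup>2 * y\<^sup>2 / (2 * (real n + 1))) \<le> exp (8 * ln n)" by simp
  also have "\<dots> = real n ^ 8" using n exp_of_nat_mult[of 8 "ln n"] by simp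
  finally have e: "exp ((real n)\<^sup>2 * y\<^sup>2 / (2 * (real n + 1))) \<le> real n ^ 8" .
  have "marginal_ratio n y \<le> exp ((real n)\<^sup>2 * y\<^sup>2 / (2 * (real n + 1))) / 1"
    unfolding marginal_ratio_def by (rule divide_left_mono) simp_all
  then show ?thesis using e by simp
qed

section \<open>From tree weights to posterior probabilities\<close>

lemma sum_weight_ratio:
  assumes "\<And>T. T \<in> Tr \<Longrightarrow> 0 \<le> W T" "finite Tr" "(\<Sum>T\<in>{T \<in> Tr. P T}. W T) \<le> \<delta> * (\<Sum>T\<in>Tr. W T)" "0 \<le> (\<delta>::real)"
  shows "(\<Sum>T\<in>Tr. W T * (if P T then 1 else 0)) / (\<Sum>T\<in>Tr. W T) \<le> \<delta>"
proof (cases "(\<Sum>T\<in>Tr. W T) = 0")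
  case False
  then have "(\<Sum>T\<in>Tr. W T) > 0" using assms(1) sum_nonneg[of Tr W] by force
  moreover have "(\<Sum>T\<in>Tr. W T * (if P T then 1 else 0)) = (\<Sum>T\<in>{T \<in> Tr. P T}. W T)"
    using assms(2) by (simp add: sum.inter_filter if_distrib cong: if_cong)
  ultimately show ?thesis using assms(3) by (simp add: divide_le_eq)
qed (use assms in simp)

text \<open>A coefficient can be nonzero only at an internal node, so the trivial bound \<kappa> = 1
  for the normal mass is enough.\<close>

lemma posterior_nonzero_le:
  fixes Y :: "node \<Rightarrow> real" and \<Gamma> \<delta> :: real
  assumes n: "n > 0" and v: "v \<in> level_nodes n" and \<delta>: "0 \<le> \<delta>"
    and W: "(\<Sum>T\<in>{T \<in> full_trees (max_depth n). v \<in> internal_nodes T}. tree_weight \<Gamma> (max_depth n) (\<lambda>u. marginal_ratio n (Y u)) T)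
      \<le> \<delta> * (\<Sum>T\<in>full_trees (max_depth n). tree_weight \<Gamma> (max_depth n) (\<lambda>u. marginal_ratio n (Y u)) T)"
  shows "emeasure (posterior \<Gamma> n Y) {\<beta> \<in> space (posterior \<Gamma> n Y). \<beta> v \<in> - {0}} \<le> ennreal \<delta>"
proof -
  let ?N = "normal_density (real n * Y v / (real n + 1)) (1 / sqrt (real n + 1))"
  have "(\<integral>\<^sup>+ b. ennreal (?N b) * indicator (- {0}) b \<partial>lborel) \<le> (\<integral>\<^sup>+ b. ennreal (?N b) \<partial>lborel)"
    by (intro nn_integral_mono) (auto simp: indicator_def)
  also have "\<dots> = 1"
    by (subst nn_integral_eq_integral) (auto simp: integrable_normal_density integral_normal_density)
  finally have s: "(\<integral>\<^sup>+ b. ennreal (?N b) * indicator (- {0}) b \<partial>lborel) \<le> ennreal 1" by simp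
  have e: "(if v \<in> internal_nodes T then 1 else indicator (- {0}) (0::real)) = (if v \<in> internal_nodes T then 1 else 0 :: real)" for T
    by simp
  have A: "- {0} \<in> sets (borel :: real measure)" by simp
  show ?thesis
    by (rule order_trans[OF posterior_coord_le[where Y = Y and \<Gamma> = \<Gamma>, OF n v A zero_le_one s, unfolded e]
          ennreal_leI[OF sum_weight_ratio[OF _ finite_full_trees W \<delta>]]])
      (rule tree_weight_nonneg[OF marginal_ratio_pos])
qed

text \<open>The normal law of an internal coefficient has no atom, so \<kappa> = 0 and only trees in
  which v is not internal count.\<close>

lemma posterior_zero_le:
  fixes Y :: "node \<Rightarrow> real" and \<Gamma> \<delta> :: real
  assumes n: "n > 0" and v: "v \<in> level_nodes n" and \<delta>: "0 \<le> \<delta>"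
    and W: "(\<Sum>T\<in>{T \<in> full_trees (max_depth n). v \<notin> internal_nodes T}. tree_weight \<Gamma> (max_depth n) (\<lambda>u. marginal_ratio n (Y u)) T)
      \<le> \<delta> * (\<Sum>T\<in>full_trees (max_depth n). tree_weight \<Gamma> (max_depth n) (\<lambda>u. marginal_ratio n (Y u)) T)"
  shows "emeasure (posterior \<Gamma> n Y) {\<beta> \<in> space (posterior \<Gamma> n Y). \<beta> v \<in> {0}} \<le> ennreal \<delta>"
proof -
  let ?N = "normal_density (real n * Y v / (real n + 1)) (1 / sqrt (real n + 1))"
  have "AE b in lborel. b \<noteq> (0::real)" by (rule AE_lborel_singleton)
  then have "(\<integral>\<^sup>+ b. ennreal (?N b) * indicator {0} b \<partial>lborel) = (\<integral>\<^sup>+ b. 0 \<partial>(lborel :: real measure))"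
    by (intro nn_integral_cong_AE) (auto elim!: eventually_mono simp: indicator_def)
  then have s: "(\<integral>\<^sup>+ b. ennreal (?N b) * indicator {0} b \<partial>lborel) \<le> ennreal 0" by simp
  have e: "(if v \<in> internal_nodes T then 0 else indicator {0} (0::real)) = (if v \<notin> internal_nodes T then 1 else 0 :: real)" for T
    by simp
  have A: "{0} \<in> sets (borel :: real measure)" by simp
  show ?thesis
    by (rule order_trans[OF posterior_coord_le[where Y = Y and \<Gamma> = \<Gamma>, OF n v A order_refl s, unfolded e]
          ennreal_leI[OF sum_weight_ratio[OF _ finite_full_trees W \<delta>]]])
      (rule tree_weight_nonneg[OF marginal_ratio_pos])
qed

section \<open>Spurious splits and nodes of full depth\<close>

lemma small_nodes_subset: "small_nodes f n \<subseteq> level_nodes n"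
  by (auto simp: small_nodes_def haar_index_def)

text \<open>Origin of 2^64: with 2^l \<ge> n^(1/4) the split probability is at most (2^l)^(-64)
  \<le> n^(-16), and half of this exponent is spent on the likelihood ratio n^8. The factor 2 comes
  from 1 / (1 - p).\<close>

lemma split_odds_small_le:
  fixes \<Gamma> :: real
  assumes \<Gamma>: "\<Gamma> \<ge> 2 ^ 64" and n: "n \<ge> 2" and l: "1 \<le> l" "n powr (1/4) \<le> 2 ^ l"
    and r: "0 < r (int l, k)" "r (int l, k) \<le> real n ^ 8"
  shows "split_odds \<Gamma> L r (int l, k) \<le> 2 / real n ^ 8"
proof -
  have G1: "\<Gamma> > 1" using \<Gamma> by simp
  define p where "p = \<Gamma> powi (- int l)"
  define q where "q = \<Gamma> powi (- (int l + 1))"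
  have p0: "0 < p" "p \<le> 1 / \<Gamma>" using split_prob[OF G1, of "int l"] l by (simp_all add: p_def)
  have q0: "0 < q" "q < 1" using split_prob[OF G1, of "int l + 1"] by (simp_all add: q_def)
  have "1 / \<Gamma> \<le> 1 / 2" using \<Gamma> by (intro divide_left_mono) auto
  then have p2: "p \<le> 1 / 2" using p0 by linarith
  have pn: "p \<le> 1 / real n ^ 16"
  proof -
    have "real n ^ 16 = (n powr (1/4)) ^ 64" using n by (simp add: powr_power)
    also have "\<dots> \<le> (2 ^ l) ^ 64" using l by (intro power_mono) auto
    also have "\<dots> = (2 ^ 64) ^ l" by (simp only: power_mult[symmetric] mult.commute)
    also have "\<dots> \<le> \<Gamma> ^ l" using \<Gamma> by (intro power_mono) auto
    finally have "real n ^ 16 \<le> \<Gamma> ^ l" .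
    moreover have "p = 1 / \<Gamma> ^ l" by (simp add: p_def power_int_minus inverse_eq_divide)
    ultimately show ?thesis using n by (simp add: frac_le)
  qed
  have "split_odds \<Gamma> L r (int l, k) = p / (1 - p) * (if int l + 1 < int L then (1 - q)\<^sup>2 else 1) * r (int l, k)"
    by (simp add: split_odds_def p_def q_def)
  also have "\<dots> \<le> p / (1 - p) * 1 * r (int l, k)"
    using p0 p2 q0 r(1) by (intro mult_right_mono mult_left_mono) (auto intro!: power_le_one)
  also have "\<dots> \<le> (2 * p) * 1 * r (int l, k)"
    using p0 p2 r(1) by (intro mult_right_mono) (auto simp: divide_le_eq)
  also have "\<dots> \<le> 2 * (1 / real n ^ 16) * 1 * real n ^ 8"
    using p0 pn r by (intro mult_mono) auto
  also have "\<dots> = 2 * (real n ^ 8 / real n ^ (8 + 8))" by simp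
  also have "\<dots> = 2 / real n ^ 8" using n by (subst power_divide_cancel) auto
  finally show ?thesis .
qed

lemma posterior_small_le:
  fixes Y :: "node \<Rightarrow> real" and \<Gamma> :: real
  assumes \<Gamma>: "\<Gamma> \<ge> 2 ^ 64" and n: "n \<ge> 2" and v: "v \<in> small_nodes f n"
    and Y: "\<And>u. u \<in> level_nodes n \<Longrightarrow> \<bar>Y u - haar_coeff f u\<bar> \<le> 3 * sqrt (ln n / n)"
  shows "emeasure (posterior \<Gamma> n Y) {\<beta> \<in> space (posterior \<Gamma> n Y). \<beta> v \<in> - {0}} \<le> ennreal (4 / real n ^ 4)"
proof -
  let ?L = "max_depth n" and ?r = "\<lambda>u. marginal_ratio n (Y u)" and ?S = "small_nodes f n"
  let ?W = "tree_weight \<Gamma> ?L ?r"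
  have G1: "\<Gamma> > 1" using \<Gamma> by simp
  have n0: "n > 0" using n by simp
  have L: "int ?L = L_max n" using L_max_nonneg[OF n0] by simp
  have ln0: "0 \<le> ln n" using n by simp
  have fS: "finite ?S" by (rule finite_subset[OF small_nodes_subset finite_haar_index_le])
  have S1: "1 \<le> fst u \<and> fst u < int ?L" if "u \<in> ?S" for u
  proof -
    obtain l k where u: "u = (l, k)" by (cases u)
    \<comment> \<open>The lower bound n^(1/4) on 2^l excludes the root, whose split is
      certain.\<close>
    have "1 < n powr (1/4)" using n by simp
    then have "(1::real) < 2 ^ nat l" using that u by (auto simp: small_nodes_def)
    then have "nat l \<noteq> 0" by (intro notI) simp
    then show ?thesis using that u L by (auto simp: small_nodes_def)
  qed
  have closed: "w \<in> ?S" if u: "u \<in> ?S" and w: "w \<in> children u" "fst w < int ?L" for u w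
  proof -
    obtain l k where lk: "u = (l, k)" by (cases u)
    obtain m where wm: "w = (l + 1, m)" "m div 2 = k" using w(1) lk by (cases w) (auto simp: mem_children)
    have l0: "0 \<le> l" "k < 2 ^ nat l" "n powr (1/4) \<le> 2 ^ nat l"
      and d: "\<And>l' k'. nat l \<le> l' \<Longrightarrow> int l' < L_max n \<Longrightarrow> k' < 2 ^ l' \<Longrightarrow> k' div 2 ^ (l' - nat l) = k \<Longrightarrow>
        \<bar>haar_coeff f (int l', k')\<bar> \<le> sqrt (ln n / n)"
      using u lk by (auto simp: small_nodes_def)
    have s: "nat (l + 1) = Suc (nat l)" using l0 by simp
    have "\<bar>haar_coeff f (int l', k')\<bar> \<le> sqrt (ln n / n)"
      if a: "Suc (nat l) \<le> l'" "int l' < L_max n" "k' < 2 ^ l'" "k' div 2 ^ (l' - Suc (nat l)) = m" for l' k'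
    proof (rule d)
      have "l' - nat l = Suc (l' - Suc (nat l))" using a(1) by simp
      then have "k' div 2 ^ (l' - nat l) = k' div 2 ^ (l' - Suc (nat l)) div 2"
        by (simp add: div_mult2_eq mult.commute[of 2])
      then show "k' div 2 ^ (l' - nat l) = k" using a(4) wm by simp
    qed (use a in auto)
    moreover have "m < 2 ^ Suc (nat l)" using wm l0 by auto
    moreover have "n powr (1/4) \<le> 2 ^ Suc (nat l)" by (rule order_trans[OF l0(3)]) simp
    ultimately show ?thesis unfolding small_nodes_def using wm w(2) L l0 s by auto
  qed
  have odds: "split_odds \<Gamma> ?L ?r u \<le> 2 / real n ^ 8" if u: "u \<in> ?S" for u
  proof -
    obtain l k where lk: "u = (l, k)" by (cases u)
    have l: "0 \<le> l" "1 \<le> nat l" "n powr (1/4) \<le> 2 ^ nat l" "k < 2 ^ nat l" "l < L_max n"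
      using S1[OF u] u lk by (auto simp: small_nodes_def)
    have d: "\<And>l' k'. nat l \<le> l' \<Longrightarrow> int l' < L_max n \<Longrightarrow> k' < 2 ^ l' \<Longrightarrow> k' div 2 ^ (l' - nat l) = k \<Longrightarrow>
        \<bar>haar_coeff f (int l', k')\<bar> \<le> sqrt (ln n / n)"
      using u lk by (auto simp: small_nodes_def)
    have "\<bar>haar_coeff f (int (nat l), k)\<bar> \<le> sqrt (ln n / n)"
      using l by (intro d) auto
    then have "\<bar>haar_coeff f u\<bar> \<le> sqrt (ln n / n)" using lk l by simp
    then have "\<bar>Y u\<bar> \<le> 4 * sqrt (ln n / n)"
      using Y[of u] u small_nodes_subset[of f n] by fastforce
    then have "?r u \<le> real n ^ 8" by (rule marginal_ratio_le[OF n0 ln0])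
    then have "split_odds \<Gamma> ?L ?r (int (nat l), k) \<le> 2 / real n ^ 8"
      using lk l marginal_ratio_pos by (intro split_odds_small_le[OF \<Gamma> n]) auto
    then show ?thesis using lk l by simp
  qed
  have W0: "0 \<le> ?W T" for T by (intro tree_weight_nonneg marginal_ratio_pos)
  show ?thesis
  proof (rule posterior_nonzero_le[OF n0])
    show "v \<in> level_nodes n" using v small_nodes_subset by blast
    have "(\<Sum>T\<in>{T \<in> full_trees ?L. v \<in> internal_nodes T}. ?W T) \<le> (\<Sum>T\<in>{T \<in> full_trees ?L. ?S \<inter> internal_nodes T \<noteq> {}}. ?W T)"
      using v W0 finite_full_trees by (intro sum_mono2) auto
    also have "\<dots> \<le> (\<Sum>u\<in>?S. split_odds \<Gamma> ?L ?r u) * (\<Sum>T\<in>full_trees ?L. ?W T)"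
      using marginal_ratio_pos S1 closed by (intro weight_internal_le[OF G1 _ fS])
    also have "\<dots> \<le> (4 / real n ^ 4) * (\<Sum>T\<in>full_trees ?L. ?W T)"
    proof (intro mult_right_mono)
      \<comment> \<open>The bound obtained is of order n^(-6); it is weakened to the common form 4 /
        n^4 shared by all kinds of bad coordinates.\<close>
      have "(\<Sum>u\<in>?S. split_odds \<Gamma> ?L ?r u) \<le> real (card ?S) * (2 / real n ^ 8)"
        using odds by (rule sum_bounded_above)
      also have "\<dots> \<le> 2 * n\<^sup>2 * (2 / real n ^ 8)"
      proof (intro mult_right_mono)
        have "card ?S \<le> card (level_nodes n)" by (rule card_mono[OF finite_haar_index_le small_nodes_subset])
        then show "real (card ?S) \<le> real (2 * n\<^sup>2)" using card_level_nodes[OF n] by linarith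
      qed simp
      also have "\<dots> = 4 * (real n ^ 2 / real n ^ (2 + 6))" by simp
      also have "\<dots> = 4 / real n ^ 6" using n by (subst power_divide_cancel) auto
      also have "\<dots> \<le> 4 / real n ^ 4" using n by (intro divide_left_mono power_increasing) auto
      finally show "(\<Sum>u\<in>?S. split_odds \<Gamma> ?L ?r u) \<le> 4 / real n ^ 4" .
    qed (use W0 in \<open>auto intro: sum_nonneg\<close>)
    finally show "(\<Sum>T\<in>{T \<in> full_trees ?L. v \<in> internal_nodes T}. ?W T) \<le> 4 / real n ^ 4 * (\<Sum>T\<in>full_trees ?L. ?W T)" .
  qed simp
qed

text \<open>Children of such a node would exceed the depth bound, so it is internal in no tree and
  the weight in question is in fact zero.\<close>

lemma posterior_top_le:
  fixes Y :: "node \<Rightarrow> real" and \<Gamma> :: real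
  assumes n: "n > 0" and v: "v \<in> level_nodes n" "fst v = L_max n"
  shows "emeasure (posterior \<Gamma> n Y) {\<beta> \<in> space (posterior \<Gamma> n Y). \<beta> v \<in> - {0}} \<le> ennreal (4 / real n ^ 4)"
proof -
  have "v \<notin> internal_nodes T" if T: "T \<in> full_trees (max_depth n)" for T
  proof
    assume a: "v \<in> internal_nodes T"
    have "v \<noteq> (-1, 0)" using v(2) L_max_nonneg[OF n] by auto
    then have "children v \<subseteq> T" using a by (simp add: internal_nodes_def)
    moreover obtain w where w: "w \<in> children v" using children_ne by blast
    ultimately have "(fst w, snd w) \<in> T" by auto
    then show False using full_treesD(3)[OF T] fst_children[OF w] v L_max_nonneg[OF n] by fastforce
  qed
  then have e: "{T \<in> full_trees (max_depth n). v \<in> internal_nodes T} = {}" by auto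
  show ?thesis
  proof (rule posterior_nonzero_le[OF n v(1)])
    show "(\<Sum>T\<in>{T \<in> full_trees (max_depth n). v \<in> internal_nodes T}. tree_weight \<Gamma> (max_depth n) (\<lambda>u. marginal_ratio n (Y u)) T)
      \<le> 4 / real n ^ 4 * (\<Sum>T\<in>full_trees (max_depth n). tree_weight \<Gamma> (max_depth n) (\<lambda>u. marginal_ratio n (Y u)) T)"
      unfolding e sum.empty by (intro mult_nonneg_nonneg sum_nonneg tree_weight_nonneg marginal_ratio_pos) simp
  qed simp
qed

section \<open>Detection, deviations and noise\<close>

lemma inverse_split_odds_le:
  fixes \<Gamma> :: real
  assumes \<Gamma>: "\<Gamma> \<ge> 2" and u: "1 \<le> fst u" "fst u < int L" and r: "0 < r u"
  shows "1 / split_odds \<Gamma> L r u \<le> 4 * \<Gamma> ^ L / r u"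
proof -
  have G1: "\<Gamma> > 1" using \<Gamma> by simp
  define p where "p = \<Gamma> powi (- fst u)"
  define q where "q = \<Gamma> powi (- (fst u + 1))"
  have p: "0 < p" "p < 1" using split_prob[OF G1 u(1)] by (simp_all add: p_def)
  have "1 / \<Gamma> \<le> 1 / 2" using \<Gamma> by (intro divide_left_mono) auto
  then have q: "q \<le> 1 / 2" using split_prob(2)[OF G1, of "fst u + 1"] u by (simp add: q_def)
  have "\<Gamma> ^ nat (fst u) \<le> \<Gamma> ^ L" using G1 u by (intro power_increasing) auto
  moreover have "p = 1 / \<Gamma> ^ nat (fst u)"
    using u by (simp add: p_def power_int_def inverse_eq_divide power_one_over)
  ultimately have pL: "1 / \<Gamma> ^ L \<le> p" using G1 by (simp add: frac_le)
  \<comment> \<open>The two new leaves cost at worst a factor 1/4, the source of the 4 in the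
    bound.\<close>
  have "(1 / 2)\<^sup>2 \<le> (1 - q)\<^sup>2" using q by (intro power_mono) auto
  then have c: "1 / 4 \<le> (if fst u + 1 < int L then (1 - q)\<^sup>2 else 1)" by (simp add: power_divide)
  have "p * 1 \<le> p * (1 / (1 - p))" using p by (intro mult_left_mono) auto
  then have "1 / \<Gamma> ^ L \<le> p / (1 - p)" using pL by simp
  then have "1 / \<Gamma> ^ L * (1 / 4) \<le> p / (1 - p) * (if fst u + 1 < int L then (1 - q)\<^sup>2 else 1)"
    using c p G1 by (intro mult_mono) auto
  then have "1 / \<Gamma> ^ L * (1 / 4) * r u \<le> split_odds \<Gamma> L r u"
    unfolding split_odds_def p_def q_def using r by (intro mult_right_mono) auto
  then have "1 / split_odds \<Gamma> L r u \<le> 1 / (1 / \<Gamma> ^ L * (1 / 4) * r u)"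
    using r G1 by (intro divide_left_mono mult_pos_pos) (auto intro: less_le_trans[rotated])
  then show ?thesis by (simp add: mult.commute)
qed

text \<open>With h = ln n, each level of a path costs at most exp (\<kappa> h), where \<kappa> = 3 +
  2 ln \<Gamma>, and there are at most 2 h levels, in total exp (2 \<kappa> h^2). The further 8
  leaves a surplus of at most n^(-8). The outer 2 compensates the quotient n / (2 (n + 1)) in the
  likelihood exponent, and the leading 3 is room for the noise.\<close>

definition detection_const :: "real \<Rightarrow> real" where
  "detection_const \<Gamma> = 3 + 2 * (2 * (3 + 2 * ln \<Gamma>) + 8)"

lemma ln_ge_1_nat: "n \<ge> 3 \<Longrightarrow> 1 \<le> ln (real n)"
proof -
  assume n: "n \<ge> 3"
  have "exp 1 \<le> (3::real)" by (rule exp_le)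
  then have "exp 1 \<le> real n" using n by linarith
  then show ?thesis using n by (subst ln_ge_iff) auto
qed

lemma detection_bound:
  fixes \<Gamma> y R :: real
  assumes \<Gamma>: "\<Gamma> \<ge> 2" and n: "n \<ge> 3" and y: "(detection_const \<Gamma> - 3) * ln n / sqrt n \<le> \<bar>y\<bar>"
  defines "R \<equiv> 4 * \<Gamma> ^ max_depth n * sqrt (real n + 1)"
  shows "1 \<le> R" "max_depth n * R ^ max_depth n * exp (- ((real n)\<^sup>2 * y\<^sup>2 / (2 * (real n + 1)))) \<le> 4 / real n ^ 4"
proof -
  define h where "h = ln (real n)"
  define L where "L = max_depth n"
  define \<kappa> where "\<kappa> = 3 + 2 * ln \<Gamma>"
  have n0: "real n > 0" using n by simp
  have h1: "1 \<le> h" unfolding h_def by (rule ln_ge_1_nat[OF n])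
  have G0: "0 \<le> ln \<Gamma>" using \<Gamma> by simp
  have L2: "(2::real) ^ L \<le> n" unfolding L_def using two_power_L_max(1)[of n] n by simp
  have Lh: "real L \<le> 2 * h"
  proof -
    have "real L * ln 2 = ln (2 ^ L)" by (simp add: ln_realpow)
    also have "\<dots> \<le> h" unfolding h_def using L2 n0 by (subst ln_le_cancel_iff) auto
    finally have "real L * ln 2 \<le> h" .
    moreover have "(1/2 :: real) \<le> ln 2" using ln2_ge_two_thirds by simp
    then have "real L * (1/2) \<le> real L * ln 2" by (intro mult_left_mono) auto
    ultimately show ?thesis by linarith
  qed
  have Ln: "real L \<le> n"
  proof -
    have "real L \<le> 2 ^ L" using of_nat_mono[OF less_imp_le[OF less_exp[of L]], where ?'a = real] by simp
    then show ?thesis using L2 by linarith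
  qed
  have eh: "exp h = n" using n0 by (simp add: h_def)
  have R1: "1 \<le> R"
  proof -
    have "1 * 1 \<le> \<Gamma> ^ L * sqrt (real n + 1)" using \<Gamma> by (intro mult_mono one_le_power) auto
    then show ?thesis unfolding R_def L_def by simp
  qed
  show "1 \<le> R" by (rule R1)
  \<comment> \<open>Each factor of R is at most a power of n: 4 \<le> n^2, \<Gamma>^L \<le> n^(2 ln
    \<Gamma>) and sqrt (n + 1) \<le> n. The exponents add up to \<kappa>.\<close>
  have Rle: "R \<le> exp (\<kappa> * h)"
  proof -
    have "2 * 2 \<le> exp 1 * exp (1::real)" using exp_ge_add_one_self[of 1] by (intro mult_mono) auto
    also have "\<dots> = exp 2" by (simp add: exp_add[symmetric])
    also have "\<dots> \<le> exp (2 * h)" using h1 by simp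
    finally have a: "4 \<le> exp (2 * h)" by simp
    have "\<Gamma> ^ L = exp (L * ln \<Gamma>)" using \<Gamma> by (simp add: exp_of_nat_mult)
    also have "\<dots> \<le> exp (2 * h * ln \<Gamma>)" using Lh G0 by (simp add: mult_right_mono)
    finally have b: "\<Gamma> ^ L \<le> exp (2 * h * ln \<Gamma>)" .
    have "real n + 1 \<le> (real n)\<^sup>2"
    proof -
      have "3 * real n \<le> real n * real n" using n by (intro mult_right_mono) auto
      then show ?thesis unfolding power2_eq_square using n by linarith
    qed
    then have c: "sqrt (real n + 1) \<le> exp h" unfolding eh by (intro real_le_lsqrt) auto
    have "R \<le> exp (2 * h) * exp (2 * h * ln \<Gamma>) * exp h"
      unfolding R_def L_def[symmetric] using a b c \<Gamma> by (intro mult_mono) auto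
    also have "\<dots> = exp (\<kappa> * h)" unfolding \<kappa>_def exp_add[symmetric] by (simp add: algebra_simps)
    finally show ?thesis .
  qed
  have \<kappa>0: "0 \<le> \<kappa>" unfolding \<kappa>_def using G0 by simp
  have RL: "R ^ L \<le> exp (2 * \<kappa> * h\<^sup>2)"
  proof -
    have "R ^ L \<le> exp (\<kappa> * h) ^ L" using Rle R1 by (intro power_mono) auto
    also have "\<dots> = exp (L * (\<kappa> * h))" by (simp add: exp_of_nat_mult)
    also have "\<dots> \<le> exp (2 * h * (\<kappa> * h))" using Lh \<kappa>0 h1 by (intro exp_le_cancel_iff[THEN iffD2] mult_right_mono) auto
    also have "2 * h * (\<kappa> * h) = 2 * \<kappa> * h\<^sup>2" by (simp add: power2_eq_square)
    finally show ?thesis .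
  qed
  have E: "(2 * \<kappa> + 8) * h\<^sup>2 \<le> (real n)\<^sup>2 * y\<^sup>2 / (2 * (real n + 1))"
  proof -
    define c where "c = 2 * \<kappa> + 8"
    have c0: "1 \<le> c" using \<kappa>0 by (simp add: c_def)
    have b: "detection_const \<Gamma> - 3 = 2 * c" by (simp add: detection_const_def \<kappa>_def c_def)
    have "0 \<le> 2 * c * h / sqrt n" using c0 h1 by simp
    then have "(2 * c * h / sqrt n)\<^sup>2 \<le> \<bar>y\<bar>\<^sup>2" using y unfolding b h_def[symmetric] by (intro power_mono)
    then have y2: "4 * c\<^sup>2 * h\<^sup>2 / n \<le> y\<^sup>2" using n0 by (simp add: power_divide power_mult_distrib)
    \<comment> \<open>As c \<ge> 1, one factor c of c^2 can be given away, which leaves an exponent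
      linear in the path cost.\<close>
    have "c * 1 \<le> c * c" using c0 by (intro mult_left_mono) auto
    then have "c * h\<^sup>2 \<le> c\<^sup>2 * h\<^sup>2" unfolding power2_eq_square[of c] by (intro mult_right_mono) auto
    also have "\<dots> \<le> c\<^sup>2 * h\<^sup>2 * (2 * n / (real n + 1))"
    proof -
      have "1 \<le> 2 * n / (real n + 1)" using n by simp
      then show ?thesis using mult_left_mono[of 1 "2 * n / (real n + 1)" "c\<^sup>2 * h\<^sup>2"] by simp
    qed
    also have "\<dots> = (real n)\<^sup>2 * (4 * c\<^sup>2 * h\<^sup>2 / n) / (2 * (real n + 1))"
      using n0 by (simp add: divide_simps power2_eq_square)
    also have "\<dots> \<le> (real n)\<^sup>2 * y\<^sup>2 / (2 * (real n + 1))"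
      using y2 by (intro divide_right_mono mult_left_mono) auto
    finally show ?thesis unfolding c_def .
  qed
  have "L * R ^ L * exp (- ((real n)\<^sup>2 * y\<^sup>2 / (2 * (real n + 1)))) \<le> n * exp (2 * \<kappa> * h\<^sup>2) * exp (- ((2 * \<kappa> + 8) * h\<^sup>2))"
    using Ln RL E R1 by (intro mult_mono) auto
  also have "\<dots> = n * exp (- 8 * h\<^sup>2)" by (simp add: mult.assoc exp_add[symmetric] algebra_simps)
  also have "\<dots> \<le> n * exp (- 8 * h)"
    using h1 mult_left_mono[of 1 h h] by (intro mult_left_mono) (auto simp: power2_eq_square)
  also have "exp (- 8 * h) = 1 / real n ^ 8"
    using exp_of_nat_mult[of 8 h] eh by (simp add: exp_minus inverse_eq_divide)
  also have "n * (1 / real n ^ 8) = real n ^ 1 / real n ^ (1 + 7)" by simp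
  also have "\<dots> = 1 / real n ^ 7" using n0 by (subst power_divide_cancel) auto
  also have "\<dots> \<le> 4 / real n ^ 4" using n by (intro frac_le power_increasing) auto
  finally show "max_depth n * R ^ max_depth n * exp (- ((real n)\<^sup>2 * y\<^sup>2 / (2 * (real n + 1)))) \<le> 4 / real n ^ 4"
    by (simp add: L_def)
qed

text \<open>The ancestors of v may carry no signal, and each may cost the full factor R; the
  likelihood ratio at v alone repays the whole path. Its exponent must therefore be of order ln^2 n,
  which explains a threshold of order ln n / sqrt n.\<close>

lemma posterior_gap_le:
  fixes Y :: "node \<Rightarrow> real" and \<Gamma> :: real
  assumes \<Gamma>: "\<Gamma> \<ge> 2" and n: "n \<ge> 3" and v: "v \<in> level_nodes n" "fst v < L_max n"
    and Y: "\<bar>Y v - b\<bar> \<le> 3 * sqrt (ln n / n)" and b: "detection_const \<Gamma> * ln n / sqrt n < \<bar>b\<bar>"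
  shows "emeasure (posterior \<Gamma> n Y) {\<beta> \<in> space (posterior \<Gamma> n Y). \<beta> v \<in> {0}} \<le> ennreal (4 / real n ^ 4)"
proof -
  let ?L = "max_depth n" and ?r = "\<lambda>u. marginal_ratio n (Y u)"
  let ?W = "tree_weight \<Gamma> ?L ?r"
  define R where "R = 4 * \<Gamma> ^ ?L * sqrt (real n + 1)"
  define E where "E = (real n)\<^sup>2 * (Y v)\<^sup>2 / (2 * (real n + 1))"
  have n0: "n > 0" and G1: "\<Gamma> > 1" using n \<Gamma> by auto
  have W0: "0 \<le> ?W T" for T by (intro tree_weight_nonneg marginal_ratio_pos)
  have ln1: "1 \<le> ln n" by (rule ln_ge_1_nat[OF n])
  \<comment> \<open>The noise bound is enlarged to the scale of the threshold so that it can be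
    subtracted from it.\<close>
  have "sqrt (ln n / n) \<le> ln n / sqrt n"
    using ln1 by (auto simp: real_sqrt_divide intro!: divide_right_mono real_le_lsqrt self_le_power)
  then have "(detection_const \<Gamma> - 3) * ln n / sqrt n \<le> \<bar>Y v\<bar>"
    using Y b by (simp add: left_diff_distrib diff_divide_distrib)
  note db = detection_bound[OF \<Gamma> n this, folded R_def E_def]
  have odds: "1 / split_odds \<Gamma> ?L ?r u \<le> R" if u: "1 \<le> fst u" "fst u < int ?L" for u
  proof -
    \<comment> \<open>Whatever is observed at u, splitting is penalized by the data by no more than
      the Occam factor 1 / sqrt (n + 1).\<close>
    have "1 / sqrt (real n + 1) \<le> ?r u"
      unfolding marginal_ratio_def using n0 by (intro divide_right_mono) auto
    then have "4 * \<Gamma> ^ ?L / ?r u \<le> 4 * \<Gamma> ^ ?L / (1 / sqrt (real n + 1))"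
      using \<Gamma> n0 marginal_ratio_pos[of n "Y u"] by (intro divide_left_mono mult_pos_pos) auto
    then show ?thesis using inverse_split_odds_le[of \<Gamma> u ?L ?r, OF \<Gamma> u marginal_ratio_pos] by (simp add: R_def)
  qed
  show ?thesis
  proof (rule posterior_zero_le[OF n0 v(1)])
    show "(\<Sum>T\<in>{T \<in> full_trees ?L. v \<notin> internal_nodes T}. ?W T) \<le> 4 / real n ^ 4 * (\<Sum>T\<in>full_trees ?L. ?W T)"
    proof (cases "v = (-1, 0)")
      case True
      then have e: "{T \<in> full_trees ?L. v \<notin> internal_nodes T} = {}" by (simp add: internal_nodes_def)
      show ?thesis unfolding e sum.empty using W0 by (intro mult_nonneg_nonneg sum_nonneg) auto
    next
      case False
      then obtain l k where lk: "v = (int l, k)" "k < 2 ^ l" using v(1)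
        by (cases v) (auto simp: haar_index_def intro: that[of "nat (fst v)" "snd v"])
      have l: "l < ?L" using lk v(2) L_max_nonneg[OF n0] by simp
      have "(\<Sum>T\<in>{T \<in> full_trees ?L. v \<notin> internal_nodes T}. ?W T) \<le> l * R ^ l / split_odds \<Gamma> ?L ?r v * (\<Sum>T\<in>full_trees ?L. ?W T)"
        unfolding lk(1) using db(1) odds by (intro weight_not_internal_le[OF G1 marginal_ratio_pos _ _ l lk(2)])
      also have "\<dots> \<le> 4 / real n ^ 4 * (\<Sum>T\<in>full_trees ?L. ?W T)"
      proof (intro mult_right_mono sum_nonneg W0)
        show "l * R ^ l / split_odds \<Gamma> ?L ?r v \<le> 4 / real n ^ 4"
        proof (cases "l = 0")
          case False
          have rv: "?r v = exp E / sqrt (real n + 1)" by (simp add: marginal_ratio_def E_def add.commute)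
          have "1 / split_odds \<Gamma> ?L ?r v \<le> 4 * \<Gamma> ^ ?L / ?r v"
            using False l lk marginal_ratio_pos by (intro inverse_split_odds_le[OF \<Gamma>]) auto
          also have "\<dots> = R * exp (- E)" unfolding rv R_def by (simp add: exp_minus field_simps)
          finally have "l * R ^ l * (1 / split_odds \<Gamma> ?L ?r v) \<le> l * R ^ l * (R * exp (- E))"
            using db(1) by (intro mult_left_mono) auto
          also have "\<dots> = l * R ^ Suc l * exp (- E)" by simp
          also have "\<dots> \<le> ?L * R ^ ?L * exp (- E)"
            using db(1) l by (intro mult_right_mono mult_mono power_increasing) auto
          also have "\<dots> \<le> 4 / real n ^ 4" by (rule db(2))
          finally show ?thesis by simp
        qed simp
      qed
      finally show ?thesis .
    qed
  qed simp
qed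

text \<open>The 7 is 3 + 1 + 3: noise in the observation, shrinkage of the posterior mean towards 0,
  posterior spread. The shrinkage is at most |b| / (n + 1), which K \<le> sqrt n makes negligible.
  Excluding z = 0 removes the atom coming from trees in which v is not internal; that case belongs
  to detection.\<close>

lemma posterior_dev_le:
  fixes Y :: "node \<Rightarrow> real" and \<Gamma> b K :: real
  assumes n: "n \<ge> 3" and v: "v \<in> level_nodes n"
    and Y: "\<bar>Y v - b\<bar> \<le> 3 * sqrt (ln n / n)" and b: "\<bar>b\<bar> \<le> K" and K: "K \<le> sqrt n"
  shows "emeasure (posterior \<Gamma> n Y) {\<beta> \<in> space (posterior \<Gamma> n Y). \<beta> v \<in> {z. z \<noteq> 0 \<and> 7 * sqrt (ln n / n) < \<bar>z - b\<bar>}}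
    \<le> ennreal (4 / real n ^ 4)"
proof -
  define s where "s = sqrt (ln n / n)"
  define \<mu> where "\<mu> = real n * Y v / (real n + 1)"
  define \<sigma> where "\<sigma> = 1 / sqrt (real n + 1)"
  define \<kappa> where "\<kappa> = 2 * exp (- (3 * s)\<^sup>2 / (2 * \<sigma>\<^sup>2))"
  let ?A = "{z. z \<noteq> 0 \<and> 7 * s < \<bar>z - b\<bar>}"
  let ?W = "tree_weight \<Gamma> (max_depth n) (\<lambda>u. marginal_ratio n (Y u))"
  have n0: "n > 0" using n by simp
  have ln1: "1 \<le> ln n" by (rule ln_ge_1_nat[OF n])
  have \<sigma>: "\<sigma> > 0" by (simp add: \<sigma>_def)
  have s0: "0 \<le> s" using ln1 by (simp add: s_def)
  have \<mu>b: "\<bar>\<mu> - b\<bar> \<le> 4 * s"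
  proof -
    have "\<mu> - b = (real n * (Y v - b) - b) / (real n + 1)" unfolding \<mu>_def by (simp add: field_simps)
    then have "\<bar>\<mu> - b\<bar> = \<bar>real n * (Y v - b) - b\<bar> / (real n + 1)" by simp
    also have "\<dots> \<le> (real n * (3 * s) + sqrt n) / (real n + 1)"
    proof (intro divide_right_mono)
      have "\<bar>real n * (Y v - b) - b\<bar> \<le> \<bar>real n * (Y v - b)\<bar> + \<bar>b\<bar>" by (rule abs_triangle_ineq4)
      also have "\<dots> = real n * \<bar>Y v - b\<bar> + \<bar>b\<bar>" by (simp add: abs_mult)
      also have "\<dots> \<le> real n * (3 * s) + sqrt n"
        using Y b K unfolding s_def[symmetric] by (intro add_mono mult_left_mono) auto
      finally show "\<bar>real n * (Y v - b) - b\<bar> \<le> real n * (3 * s) + sqrt n" .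
    qed simp
    also have "\<dots> \<le> (real n * (3 * s) + real n * s) / (real n + 1)"
    proof (intro divide_right_mono add_left_mono)
      have "sqrt n = real n * (1 / sqrt n)" using n0 by (simp add: real_div_sqrt)
      also have "\<dots> \<le> real n * s"
        unfolding s_def real_sqrt_divide using ln1 by (intro mult_left_mono divide_right_mono) auto
      finally show "sqrt n \<le> real n * s" .
    qed simp
    also have "\<dots> = 4 * s * (real n / (real n + 1))" by (simp add: field_simps)
    also have "\<dots> \<le> 4 * s * 1" using s0 by (intro mult_left_mono) auto
    finally show ?thesis by simp
  qed
  have "(\<integral>\<^sup>+ z. ennreal (normal_density \<mu> \<sigma> z) * indicator ?A z \<partial>lborel) \<le>
      (\<integral>\<^sup>+ z. ennreal (normal_density \<mu> \<sigma> z) * indicator {z. 3 * s < \<bar>z - \<mu>\<bar>} z \<partial>lborel)"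
    using \<mu>b by (intro nn_integral_mono mult_left_mono) (auto simp: indicator_def)
  also have "\<dots> \<le> ennreal \<kappa>" unfolding \<kappa>_def using \<sigma> s0 by (intro normal_density_tail) auto
  finally have slab: "(\<integral>\<^sup>+ z. ennreal (normal_density (real n * Y v / (real n + 1)) (1 / sqrt (real n + 1)) z) * indicator ?A z \<partial>lborel) \<le> ennreal \<kappa>"
    unfolding \<mu>_def \<sigma>_def .
  have A: "?A \<in> sets borel" by measurable
  have \<kappa>0: "0 \<le> \<kappa>" by (simp add: \<kappa>_def)
  have W0: "0 \<le> ?W T" for T by (intro tree_weight_nonneg marginal_ratio_pos)
  have "emeasure (posterior \<Gamma> n Y) {\<beta> \<in> space (posterior \<Gamma> n Y). \<beta> v \<in> ?A} \<le>
    ennreal ((\<Sum>T\<in>full_trees (max_depth n). ?W T * (if v \<in> internal_nodes T then \<kappa> else indicator ?A 0)) / (\<Sum>T\<in>full_trees (max_depth n). ?W T))"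
    by (rule posterior_coord_le[where Y = Y and \<Gamma> = \<Gamma>, OF n0 v A \<kappa>0 slab])
  also have "\<dots> \<le> ennreal \<kappa>"
  proof (rule ennreal_leI)
    have "(\<Sum>T\<in>full_trees (max_depth n). ?W T * (if v \<in> internal_nodes T then \<kappa> else indicator ?A 0)) \<le> (\<Sum>T\<in>full_trees (max_depth n). ?W T * \<kappa>)"
      using W0 \<kappa>0 by (intro sum_mono mult_left_mono) auto
    also have "\<dots> = \<kappa> * (\<Sum>T\<in>full_trees (max_depth n). ?W T)" by (simp add: sum_distrib_left mult.commute)
    finally show "(\<Sum>T\<in>full_trees (max_depth n). ?W T * (if v \<in> internal_nodes T then \<kappa> else indicator ?A 0)) / (\<Sum>T\<in>full_trees (max_depth n). ?W T) \<le> \<kappa>"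
      using sum_nonneg[of "full_trees (max_depth n)" ?W] W0 \<kappa>0 by (cases "(\<Sum>T\<in>full_trees (max_depth n). ?W T) = 0") (auto simp: divide_le_eq)
  qed
  also have "\<dots> \<le> ennreal (4 / real n ^ 4)"
  proof (rule ennreal_leI)
    have "(3 * s)\<^sup>2 / (2 * \<sigma>\<^sup>2) = 9 / 2 * ln n * ((real n + 1) / n)"
      using ln1 n0 by (simp add: s_def \<sigma>_def power_mult_distrib power_divide)
    moreover have "9 / 2 * ln n * 1 \<le> 9 / 2 * ln n * ((real n + 1) / n)"
      using ln1 n0 by (intro mult_left_mono) auto
    \<comment> \<open>A deviation of 3 s yields the exponent 9/2 in ln n; 4 is enough for the sum
      over 2 n^2 nodes.\<close>
    ultimately have "4 * ln n \<le> (3 * s)\<^sup>2 / (2 * \<sigma>\<^sup>2)" using ln1 by linarith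
    then have "\<kappa> \<le> 2 * exp (- (4 * ln n))" unfolding \<kappa>_def by simp
    also have "exp (- (4 * ln n)) = 1 / real n ^ 4"
      using exp_of_nat_mult[of 4 "ln n"] n0 by (simp add: exp_minus inverse_eq_divide)
    finally show "\<kappa> \<le> 4 / real n ^ 4" by (rule order_trans) (simp add: divide_right_mono)
  qed
  finally show ?thesis unfolding s_def .
qed

text \<open>The factor 3 makes each Gaussian tail at most 2 n^(-9/2), weakened to 2 n^(-4), which
  survives a union bound over 2 n^2 nodes.\<close>

lemma noise_bound:
  assumes n: "n \<ge> 3"
  shows "emeasure (sequence_model n b) {Y \<in> space (sequence_model n b). \<exists>v\<in>level_nodes n. 3 * sqrt (ln n / n) < \<bar>Y v - b v\<bar>}
     \<le> ennreal (4 / real n ^ 2)"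
    and "{Y \<in> space (sequence_model n b). \<exists>v\<in>level_nodes n. 3 * sqrt (ln n / n) < \<bar>Y v - b v\<bar>} \<in> sets (sequence_model n b)"
proof -
  define s where "s = sqrt (ln n / n)"
  have n0: "n > 0" using n by simp
  have ln1: "1 \<le> ln n" by (rule ln_ge_1_nat[OF n])
  let ?P = "PiM haar_index (\<lambda>_. std_normal)" and ?Q = "PiM haar_index (\<lambda>_. borel :: real measure)"
  let ?T = "\<lambda>\<epsilon>. \<lambda>v\<in>haar_index. b v + \<epsilon> v / sqrt n"
  let ?J = "level_nodes n"
  have sets: "sets (sequence_model n b) = sets ?Q" by (simp add: sequence_model_def)
  have sp: "space (sequence_model n b) = space ?Q" by (rule sets_eq_imp_space_eq[OF sets])
  have T: "?T \<in> ?P \<rightarrow>\<^sub>M ?Q" by measurable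
  define F where "F = (\<lambda>v. {Y \<in> space (sequence_model n b). 3 * s < \<bar>Y v - b v\<bar>})"
  have F: "F v \<in> sets (sequence_model n b)" if v: "v \<in> haar_index" for v
    unfolding F_def sets sp using v by measurable
  have e: "{Y \<in> space (sequence_model n b). \<exists>v\<in>?J. 3 * s < \<bar>Y v - b v\<bar>} = (\<Union>v\<in>?J. F v)"
    unfolding F_def by blast
  have fJ: "finite ?J" by (rule finite_haar_index_le)
  show "{Y \<in> space (sequence_model n b). \<exists>v\<in>?J. 3 * sqrt (ln n / n) < \<bar>Y v - b v\<bar>} \<in> sets (sequence_model n b)"
    unfolding s_def[symmetric] e using fJ F by auto
  have Fv: "emeasure (sequence_model n b) (F v) \<le> ennreal (2 / real n ^ 4)" if v: "v \<in> haar_index" for v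
  proof -
    let ?A = "{x::real. 3 * sqrt (ln n) < \<bar>x - 0\<bar>}"
    have A: "?A \<in> sets borel" by measurable
    have "emeasure (sequence_model n b) (F v) = emeasure ?P (?T -` F v \<inter> space ?P)"
      unfolding sequence_model_def using T F[OF v] sets by (intro emeasure_distr) (auto simp: sequence_model_def)
    also have "?T -` F v \<inter> space ?P \<subseteq> {\<epsilon> \<in> space ?P. \<epsilon> v \<in> ?A}"
    proof
      fix \<epsilon> assume a: "\<epsilon> \<in> ?T -` F v \<inter> space ?P"
      then have "3 * s < \<bar>\<epsilon> v / sqrt n\<bar>" using v by (simp add: F_def)
      then have "3 * (sqrt (ln n) / sqrt n) < \<bar>\<epsilon> v\<bar> / sqrt n" by (simp add: s_def real_sqrt_divide)
      then show "\<epsilon> \<in> {\<epsilon> \<in> space ?P. \<epsilon> v \<in> ?A}" using a n0 by (simp add: divide_less_cancel)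
    qed
    then have "emeasure ?P (?T -` F v \<inter> space ?P) \<le> emeasure ?P {\<epsilon> \<in> space ?P. \<epsilon> v \<in> ?A}"
      using v A by (intro emeasure_mono) auto
    \<comment> \<open>The event is written as a product over a single coordinate to fit
      \<open>nn_integral_PiM_prod\<close>.\<close>
    also have "\<dots> = (\<integral>\<^sup>+ \<epsilon>. (\<Prod>u\<in>{v}. indicator ?A (\<epsilon> u)) \<partial>?P)"
    proof -
      have "{\<epsilon> \<in> space ?P. \<epsilon> v \<in> ?A} \<in> sets ?P" using v A by measurable
      then have "emeasure ?P {\<epsilon> \<in> space ?P. \<epsilon> v \<in> ?A} = (\<integral>\<^sup>+ \<epsilon>. indicator {\<epsilon> \<in> space ?P. \<epsilon> v \<in> ?A} \<epsilon> \<partial>?P)"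
        by (rule nn_integral_indicator[symmetric])
      also have "\<dots> = (\<integral>\<^sup>+ \<epsilon>. (\<Prod>u\<in>{v}. indicator ?A (\<epsilon> u)) \<partial>?P)"
        by (intro nn_integral_cong) (simp add: indicator_def)
      finally show ?thesis .
    qed
    also have "\<dots> = (\<Prod>u\<in>{v}. \<integral>\<^sup>+ x. indicator ?A x \<partial>std_normal)"
      using v A by (intro nn_integral_PiM_prod) (auto intro: prob_std_normal)
    also have "\<dots> = (\<integral>\<^sup>+ x. ennreal (std_normal_density x) * indicator ?A x \<partial>lborel)"
      using A by (simp only: prod.insert_remove prod.empty finite.emptyI Diff_empty empty_Diff mult_1_right) (intro nn_integral_density; simp)
    also have "\<dots> \<le> ennreal (2 * exp (- (3 * sqrt (ln n))\<^sup>2 / (2 * 1\<^sup>2)))"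
      using ln1 by (intro normal_density_tail) auto
    also have "\<dots> \<le> ennreal (2 / real n ^ 4)"
    proof (rule ennreal_leI)
      have "exp (- (3 * sqrt (ln n))\<^sup>2 / (2 * 1\<^sup>2)) \<le> exp (- (4 * ln n))"
        using ln1 by (simp add: power_mult_distrib)
      also have "\<dots> = 1 / real n ^ 4"
        using exp_of_nat_mult[of 4 "ln n"] n0 by (simp add: exp_minus inverse_eq_divide)
      finally show "2 * exp (- (3 * sqrt (ln n))\<^sup>2 / (2 * 1\<^sup>2)) \<le> 2 / real n ^ 4" by simp
    qed
    finally show ?thesis .
  qed
  have "emeasure (sequence_model n b) (\<Union>v\<in>?J. F v) \<le> (\<Sum>v\<in>?J. emeasure (sequence_model n b) (F v))"
    using fJ F by (intro emeasure_subadditive_finite) auto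
  also have "\<dots> \<le> (\<Sum>v\<in>?J. ennreal (2 / real n ^ 4))" using Fv by (intro sum_mono) auto
  also have "\<dots> = ennreal (card ?J * (2 / real n ^ 4))" by (simp add: ennreal_of_nat_eq_real_of_nat ennreal_mult[symmetric])
  also have "\<dots> \<le> ennreal (4 / real n ^ 2)"
  proof (rule ennreal_leI)
    have "card ?J * (2 / real n ^ 4) \<le> (2 * n\<^sup>2) * (2 / real n ^ 4)"
      using card_level_nodes[of n] n by (intro mult_right_mono) auto
    also have "\<dots> = 4 * (real n ^ 2 / real n ^ (2 + 2))" by simp
    also have "\<dots> = 4 / real n ^ 2" using n by (subst power_divide_cancel) auto
    finally show "card ?J * (2 / real n ^ 4) \<le> 4 / real n ^ 2" .
  qed
  finally show "emeasure (sequence_model n b) {Y \<in> space (sequence_model n b). \<exists>v\<in>?J. 3 * sqrt (ln n / n) < \<bar>Y v - b v\<bar>}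
     \<le> ennreal (4 / real n ^ 2)" unfolding s_def[symmetric] e .
qed

section \<open>Posterior contraction\<close>

text \<open>Serves to control the shrinkage of the posterior means.\<close>

lemma haar_coeff_bounded:
  assumes f: "set_integrable lborel {0..1} f" and K: "\<And>y. y \<in> {0..1} \<Longrightarrow> \<bar>f y\<bar> \<le> K" and v: "v \<in> haar_index"
  shows "\<bar>haar_coeff f v\<bar> \<le> K"
proof -
  have K0: "0 \<le> K" using K[of 0] by simp
  show ?thesis
  proof (cases "v = (-1, 0)")
    case True
    have "haar_coeff f v = dyadic_int f 0 0"
      using haar_sum_coeff[OF f, of 0 0] haar_sum_eq[of 0 0 "haar_coeff f"] True by simp
    also have "\<bar>\<dots>\<bar> \<le> K"
    proof -
      have "\<bar>f y - 0\<bar> \<le> K" if "y \<in> dyadic 0 0" for y using K[of y] that dyadic_subset_unit[of 0 0] by auto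
      then show ?thesis using dyadic_int_approx[OF f, of 0 0 0 K] by simp
    qed
    finally show ?thesis .
  next
    case False
    then obtain l k where lk: "v = (int l, k)" "k < 2 ^ l" using v
      by (cases v) (auto simp: haar_index_def intro: that[of "nat (fst v)" "snd v"])
    have "\<bar>haar_coeff f v\<bar> \<le> K * 2 powr (- real l / 2)"
      unfolding lk(1) using dyadic_subset_unit[OF lk(2)] K by (intro haar_coeff_le[OF f lk(2), where c = 0]) auto
    also have "\<dots> \<le> K * 2 powr 0" using K0 by (intro mult_left_mono powr_mono) auto
    finally show ?thesis by simp
  qed
qed

lemma sets_posterior_coord:
  assumes "Z \<in> sets borel" "v \<in> haar_index"
  shows "{\<beta> \<in> space (posterior \<Gamma> n Y). \<beta> v \<in> Z} \<in> sets (posterior \<Gamma> n Y)"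
proof -
  have sp: "sets (posterior \<Gamma> n Y) = sets (PiM haar_index (\<lambda>_. borel))"
    by (simp add: posterior_def sets_cart_prior)
  show ?thesis unfolding sp sets_eq_imp_space_eq[OF sp] using assms by measurable
qed

text \<open>The bound and the conditions on n involve the class only through K, c and t_1, hence
  uniformity in f. The 28 is 24 + 4: 2 n^2 nodes, three kinds of bad coordinate and 4 / n^4 for each
  make 24, the noise event adds 4.\<close>

lemma posterior_expectation_le:
  fixes n :: nat and \<Gamma> K c t\<^sub>1 m :: real
  assumes \<Gamma>: "\<Gamma> \<ge> 2 ^ 64" and f: "f \<in> local_Hoelder t M \<eta>"
    and pos: "\<And>x. x \<in> {0..1} \<Longrightarrow> 0 < t x \<and> 0 < \<eta> x" and MK: "\<And>x. x \<in> {0..1} \<Longrightarrow> M x \<le> K" and K: "1 \<le> K"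
    and c: "0 < c" "\<And>x. x \<in> {0..1} \<Longrightarrow> c \<le> \<eta> x"
    and t: "0 < t\<^sub>1" "\<And>x. x \<in> {0..1} \<Longrightarrow> t\<^sub>1 \<le> t x \<and> t x \<le> 1"
    and n: "n \<ge> 3" "n powr (1/4) \<le> (n / ln n) powr (1/3)" "1 / c \<le> n powr (1/4)"
      "2 * K\<^sup>2 * (n / ln n) powr (1 / (2 * t\<^sub>1 + 1)) \<le> n / 2" "K \<le> sqrt n"
    and m: "8 * K * (detection_const \<Gamma> + 7) * sqrt (ln n) + K / (1 - 2 powr (- t\<^sub>1)) \<le> m"
  shows "(\<integral>\<^sup>+ Y. emeasure (posterior \<Gamma> n Y)
      {\<beta> \<in> space (posterior \<Gamma> n Y). (SUP x\<in>{0..1}. ereal (local_rate t n x * \<bar>haar_sum (L_max n) \<beta> x - f x\<bar>)) > ereal m}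
    \<partial>sequence_model n (haar_coeff f)) \<le> ennreal (28 / real n ^ 2)"
proof -
  define s where "s = sqrt (ln n / n)"
  define E where "E = (\<lambda>Y. {\<beta> \<in> space (posterior \<Gamma> n Y).
      (SUP x\<in>{0..1}. ereal (local_rate t n x * \<bar>haar_sum (L_max n) \<beta> x - f x\<bar>)) > ereal m})"
  let ?J = "level_nodes n" and ?\<beta>0 = "haar_coeff f" and ?B = "detection_const \<Gamma>"
  let ?S = "sequence_model n (haar_coeff f)"
  have n0: "n > 0" and n2: "n \<ge> 2" and G2: "\<Gamma> \<ge> 2" using n(1) \<Gamma> by auto
  have ln1: "1 \<le> ln n" by (rule ln_ge_1_nat[OF n(1)])
  have fJ: "finite ?J" by (rule finite_haar_index_le)
  have fi: "set_integrable lborel {0..1} f" by (rule local_Hoelder_set_integrable[OF f pos])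
  have fK: "\<bar>f y\<bar> \<le> K" if "y \<in> {0..1}" for y
    using local_HoelderD(1)[OF f that that] MK[OF that] by linarith
  have \<beta>0: "\<bar>?\<beta>0 v\<bar> \<le> K" if "v \<in> ?J" for v using haar_coeff_bounded[OF fi fK, of v] that by auto
  have B0: "0 \<le> ?B" using G2 by (simp add: detection_const_def)
  have sln: "s \<le> ln n / sqrt n"
    unfolding s_def using ln1 by (auto simp: real_sqrt_divide intro!: divide_right_mono real_le_lsqrt self_le_power)
  \<comment> \<open>Forbidden values of a coordinate: nonzero at a node without signal or of full
    depth (\<open>Z1\<close>), zero at a strong signal (\<open>Z2\<close>), nonzero but far from the
    truth (\<open>Z3\<close>). A \<beta> avoiding all of them meets the hypotheses of
    \<open>error_bound\<close>.\<close>
  define Z1 where "Z1 = (\<lambda>v. if v \<in> small_nodes f n \<or> fst v = L_max n then - {0} else {} :: real set)"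
  define Z2 where "Z2 = (\<lambda>v. if fst v < L_max n \<and> ?B * ln n / sqrt n < \<bar>?\<beta>0 v\<bar> then {0} else {} :: real set)"
  define Z3 where "Z3 = (\<lambda>v. {z::real. z \<noteq> 0 \<and> 7 * s < \<bar>z - ?\<beta>0 v\<bar>})"
  have Zm: "Z1 v \<in> sets borel" "Z2 v \<in> sets borel" "Z3 v \<in> sets borel" for v
    unfolding Z1_def Z2_def Z3_def by auto measurable
  have EA: "E Y \<subseteq> (\<Union>v\<in>?J. {\<beta> \<in> space (posterior \<Gamma> n Y). \<beta> v \<in> Z1 v} \<union> {\<beta> \<in> space (posterior \<Gamma> n Y). \<beta> v \<in> Z2 v}
      \<union> {\<beta> \<in> space (posterior \<Gamma> n Y). \<beta> v \<in> Z3 v})" for Y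
  proof (rule ccontr)
    assume "\<not> ?thesis"
    then obtain \<beta> where \<beta>: "\<beta> \<in> E Y" and no: "\<And>v. v \<in> ?J \<Longrightarrow> \<beta> v \<notin> Z1 v \<and> \<beta> v \<notin> Z2 v \<and> \<beta> v \<notin> Z3 v"
      unfolding E_def by blast
    have "local_rate t n x * \<bar>haar_sum (L_max n) \<beta> x - f x\<bar> \<le> m" if x: "x \<in> {0..1}" for x
    proof -
      have "local_rate t n x * \<bar>haar_sum (L_max n) \<beta> x - f x\<bar> \<le>
          8 * K * (?B + 7) * sqrt (ln n) + K / (1 - 2 powr (- t\<^sub>1))"
      proof (rule error_bound[OF f pos x MK[OF x] K c(1) c(2)[OF x] t(1) _ _ _ n(1-4)])
        show "t\<^sub>1 \<le> t x" "t x \<le> 1" using t(2)[OF x] by auto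
        show "0 \<le> ?B + 7" using B0 by simp
        show "\<beta> v = 0" if "v \<in> small_nodes f n" for v
          using no[of v] that small_nodes_subset[of f n] by (auto simp: Z1_def)
        show "\<beta> v = 0" if "v \<in> ?J" "fst v = L_max n" for v
          using no[of v] that by (auto simp: Z1_def)
        show "\<bar>\<beta> v - ?\<beta>0 v\<bar> \<le> (?B + 7) * ln n / sqrt n" if v: "v \<in> ?J" "fst v < L_max n" for v
        proof -
          have p: "0 \<le> ?B * ln n / sqrt n" "0 \<le> ln n / sqrt n" using B0 ln1 by auto
          have "\<bar>\<beta> v - ?\<beta>0 v\<bar> \<le> ?B * ln n / sqrt n + 7 * (ln n / sqrt n)"
          \<comment> \<open>A zero coefficient errs by the signal itself, which is then below the
            detection threshold; a nonzero one is close to the truth. The sum of the two bounds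
            covers both cases.\<close>
          proof (cases "\<beta> v = 0")
            case True
            then have "\<bar>?\<beta>0 v\<bar> \<le> ?B * ln n / sqrt n" using no[OF v(1)] v(2) by (auto simp: Z2_def split: if_splits)
            then show ?thesis using True p by simp
          next
            case False
            then have "\<bar>\<beta> v - ?\<beta>0 v\<bar> \<le> 7 * s" using no[OF v(1)] by (auto simp: Z3_def)
            then show ?thesis using sln p by linarith
          qed
          then show ?thesis by (simp add: distrib_right add_divide_distrib)
        qed
      qed auto
      then show ?thesis using m by linarith
    qed
    then have "(SUP x\<in>{0..1}. ereal (local_rate t n x * \<bar>haar_sum (L_max n) \<beta> x - f x\<bar>)) \<le> ereal m"
      by (intro SUP_least) simp
    then show False using \<beta> by (auto simp: E_def)
  qed
  define N where "N = {Y \<in> space ?S. \<exists>v\<in>?J. 3 * s < \<bar>Y v - ?\<beta>0 v\<bar>}"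
  have good: "emeasure (posterior \<Gamma> n Y) (E Y) \<le> ennreal (24 / real n ^ 2)"
    if Y: "\<And>v. v \<in> ?J \<Longrightarrow> \<bar>Y v - ?\<beta>0 v\<bar> \<le> 3 * s" for Y
  proof -
    let ?P = "posterior \<Gamma> n Y" and ?d = "4 / real n ^ 4"
    define A where "A = (\<lambda>Z v. {\<beta> \<in> space ?P. \<beta> v \<in> (Z :: node \<Rightarrow> real set) v})"
    have A: "A Z1 v \<in> sets ?P" "A Z2 v \<in> sets ?P" "A Z3 v \<in> sets ?P" if "v \<in> ?J" for v
      unfolding A_def using that by (intro sets_posterior_coord Zm; simp)+
    have e1: "emeasure ?P (A Z1 v) \<le> ennreal ?d" if v: "v \<in> ?J" for v
      using posterior_small_le[where v = v and f = f, OF \<Gamma> n2 _ Y[unfolded s_def]] posterior_top_le[where \<Gamma> = \<Gamma> and Y = Y, OF n0 v]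
      unfolding A_def Z1_def by (cases "v \<in> small_nodes f n"; cases "fst v = L_max n") simp_all
    have e2: "emeasure ?P (A Z2 v) \<le> ennreal ?d" if v: "v \<in> ?J" for v
    proof (cases "fst v < L_max n \<and> ?B * ln n / sqrt n < \<bar>?\<beta>0 v\<bar>")
      case True
      then show ?thesis
        using posterior_gap_le[where Y = Y and b = "?\<beta>0 v", OF G2 n(1) v _ Y[OF v, unfolded s_def]]
        by (simp add: A_def Z2_def)
    next
      case False
      then have "Z2 v = {}" unfolding Z2_def by (rule if_not_P)
      then show ?thesis by (simp add: A_def)
    qed
    have e3: "emeasure ?P (A Z3 v) \<le> ennreal ?d" if v: "v \<in> ?J" for v
      using posterior_dev_le[where Y = Y and \<Gamma> = \<Gamma>, OF n(1) v Y[OF v, unfolded s_def] \<beta>0[OF v] n(5)]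
      unfolding A_def Z3_def s_def by simp
    have e: "emeasure ?P (A Z1 v \<union> A Z2 v \<union> A Z3 v) \<le> ennreal (3 * ?d)" if v: "v \<in> ?J" for v
    proof -
      have "emeasure ?P (A Z1 v \<union> A Z2 v \<union> A Z3 v) \<le> emeasure ?P (A Z1 v) + emeasure ?P (A Z2 v) + emeasure ?P (A Z3 v)"
        using A[OF v] by (intro order_trans[OF emeasure_subadditive] add_right_mono emeasure_subadditive) auto
      also have "\<dots> \<le> ennreal ?d + ennreal ?d + ennreal ?d" using e1 e2 e3 v by (intro add_mono)
      also have "\<dots> = ennreal (3 * ?d)" by (simp add: ennreal_plus[symmetric] del: ennreal_plus)
      finally show ?thesis .
    qed
    have "emeasure ?P (E Y) \<le> emeasure ?P (\<Union>v\<in>?J. A Z1 v \<union> A Z2 v \<union> A Z3 v)"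
      using EA[of Y] A fJ unfolding A_def by (intro emeasure_mono sets.finite_UN sets.Un) auto
    also have "\<dots> \<le> (\<Sum>v\<in>?J. emeasure ?P (A Z1 v \<union> A Z2 v \<union> A Z3 v))"
      using A fJ by (intro emeasure_subadditive_finite) (auto intro!: sets.Un)
    also have "\<dots> \<le> (\<Sum>v\<in>?J. ennreal (3 * ?d))" using e by (intro sum_mono)
    also have "\<dots> = ennreal (card ?J * (3 * ?d))"
      by (simp add: ennreal_of_nat_eq_real_of_nat ennreal_mult[symmetric])
    also have "\<dots> \<le> ennreal (24 / real n ^ 2)"
    proof (rule ennreal_leI)
      have "card ?J * (3 * ?d) \<le> (2 * n\<^sup>2) * (3 * ?d)"
        using card_level_nodes[OF n2] by (intro mult_right_mono) auto
      also have "\<dots> = 24 * (real n ^ 2 / real n ^ (2 + 2))" by simp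
      also have "\<dots> = 24 / real n ^ 2" using n0 by (subst power_divide_cancel) auto
      finally show "card ?J * (3 * ?d) \<le> 24 / real n ^ 2" .
    qed
    finally show ?thesis .
  qed
  \<comment> \<open>On the noise event the posterior probability is bounded by 1, so integration
    adds the probability of \<open>N\<close>.\<close>
  have le: "emeasure (posterior \<Gamma> n Y) (E Y) \<le> indicator N Y + ennreal (24 / real n ^ 2)" if "Y \<in> space ?S" for Y
  proof (cases "Y \<in> N")
    case True
    then show ?thesis using prob_space.emeasure_le_1[OF prob_posterior[OF n0], of \<Gamma> Y "E Y"]
      by (simp add: add_increasing2)
  next
    case False
    have "\<bar>Y v - ?\<beta>0 v\<bar> \<le> 3 * s" if "v \<in> ?J" for v
    proof (rule ccontr)
      assume "\<not> \<bar>Y v - ?\<beta>0 v\<bar> \<le> 3 * s"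
      then have "3 * s < \<bar>Y v - ?\<beta>0 v\<bar>" by simp
      then show False using that \<open>Y \<in> space ?S\<close> False unfolding N_def by blast
    qed
    from good[OF this] show ?thesis using False by simp
  qed
  have Ns: "N \<in> sets ?S" unfolding N_def s_def by (rule noise_bound(2)[OF n(1)])
  have "(\<integral>\<^sup>+ Y. emeasure (posterior \<Gamma> n Y) (E Y) \<partial>?S) \<le> (\<integral>\<^sup>+ Y. indicator N Y + ennreal (24 / real n ^ 2) \<partial>?S)"
    using le by (rule nn_integral_mono)
  also have "\<dots> = emeasure ?S N + ennreal (24 / real n ^ 2)"
    using Ns prob_space.emeasure_space_1[OF prob_sequence_model] by (subst nn_integral_add) auto
  also have "\<dots> \<le> ennreal (4 / real n ^ 2) + ennreal (24 / real n ^ 2)"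
    unfolding N_def s_def by (intro add_right_mono noise_bound(1)[OF n(1)])
  also have "\<dots> = ennreal (28 / real n ^ 2)" by (simp add: ennreal_plus[symmetric] add_divide_distrib[symmetric] del: ennreal_plus)
  finally show ?thesis unfolding E_def .
qed

lemma eventually_le_powr:
  assumes "e > 0"
  shows "\<forall>\<^sub>F n in sequentially. C \<le> real n powr e"
proof -
  have "filterlim (\<lambda>n. real n powr e) at_top sequentially"
    by (rule filterlim_compose[OF real_powr_at_top[OF assms] filterlim_real_sequentially])
  then show ?thesis by (simp add: filterlim_at_top)
qed

theorem theorem1:
  shows "\<exists>\<Gamma>\<^sub>0::real. \<Gamma>\<^sub>0 > 0 \<and> (\<forall>\<Gamma>\<ge>\<Gamma>\<^sub>0.
    \<forall>(t :: real \<Rightarrow> real) (M :: real \<Rightarrow> real) (\<eta> :: real \<Rightarrow> real) (t\<^sub>1 :: real) (M\<^sub>n :: nat \<Rightarrow> real).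
      (\<forall>x\<in>{0..1}. 0 < t x \<and> 0 < M x \<and> 0 < \<eta> x) \<longrightarrow>
      bdd_above (M ` {0..1}) \<longrightarrow> (\<exists>c>0. \<forall>x\<in>{0..1}. c \<le> M x) \<longrightarrow>
      bdd_above (\<eta> ` {0..1}) \<longrightarrow> (\<exists>c>0. \<forall>x\<in>{0..1}. c \<le> \<eta> x) \<longrightarrow>
      0 < t\<^sub>1 \<longrightarrow> t\<^sub>1 \<le> (INF x\<in>{0..1}. t x) \<longrightarrow> (\<forall>x\<in>{0..1}. t x \<le> 1) \<longrightarrow>
      filterlim M\<^sub>n at_top sequentially \<longrightarrow>
      filterlim (\<lambda>n. M\<^sub>n n / sqrt (ln n)) at_top sequentially \<longrightarrow>
      (\<lambda>n. SUP f\<^sub>0\<in>local_Hoelder t M \<eta>.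
         \<integral>\<^sup>+ Y. emeasure (posterior \<Gamma> n Y)
                {\<beta> \<in> space (posterior \<Gamma> n Y).
                   (SUP x\<in>{0..1}. ereal (local_rate t n x * \<bar>haar_sum (L_max n) \<beta> x - f\<^sub>0 x\<bar>)) > ereal (M\<^sub>n n)}
           \<partial>sequence_model n (haar_coeff f\<^sub>0))
      \<longlonglongrightarrow> 0)"
proof (intro exI[of _ "2 ^ 64"] conjI allI impI)
  fix \<Gamma> t\<^sub>1 :: real and t M \<eta> :: "real \<Rightarrow> real" and M\<^sub>n :: "nat \<Rightarrow> real"
  assume \<Gamma>: "2 ^ 64 \<le> \<Gamma>" and pos: "\<forall>x\<in>{0..1}. 0 < t x \<and> 0 < M x \<and> 0 < \<eta> x"
    and bM: "bdd_above (M ` {0..1})" and "\<exists>c>0. \<forall>x\<in>{0..1}. c \<le> \<eta> x"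
    and t\<^sub>1: "0 < t\<^sub>1" "t\<^sub>1 \<le> (INF x\<in>{0..1}. t x)" and tle: "\<forall>x\<in>{0..1}. t x \<le> 1"
    and Mn: "filterlim (\<lambda>n. M\<^sub>n n / sqrt (ln n)) at_top sequentially"
  then obtain c where c: "c > 0" "\<And>x. x \<in> {0..1} \<Longrightarrow> c \<le> \<eta> x" by blast
  obtain K0 where K0: "\<And>x. x \<in> {0..1} \<Longrightarrow> M x \<le> K0"
    using bM unfolding bdd_above_def by blast
  \<comment> \<open>The lower bound 1 keeps negative powers of K below 1 in the deterministic
    bound.\<close>
  define K where "K = max 1 K0"
  have K: "1 \<le> K" "\<And>x. x \<in> {0..1} \<Longrightarrow> M x \<le> K" using K0 by (auto simp: K_def le_max_iff_disj)
  \<comment> \<open>A real infimum gives pointwise bounds only for a set bounded from below.\<close>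
  have "bdd_below (t ` {0..1})" using pos by (auto intro!: bdd_belowI2[of _ 0] less_imp_le)
  then have t: "t\<^sub>1 \<le> t x \<and> t x \<le> 1" if "x \<in> {0..1}" for x
    using t\<^sub>1(2) cINF_lower[of t "{0..1}" x] that tle by fastforce
  have pos': "0 < t x \<and> 0 < \<eta> x" if "x \<in> {0..1}" for x using pos that by blast
  define \<alpha> where "\<alpha> = 1 / (2 * t\<^sub>1 + 1)"
  \<comment> \<open>The bias constant can be merged with the coefficient of sqrt (ln n), because ln
    n \<ge> 1; eventually M_n / sqrt (ln n) exceeds D.\<close>
  define D where "D = 8 * K * (detection_const \<Gamma> + 7) + K / (1 - 2 powr (- t\<^sub>1))"
  have \<alpha>: "0 < \<alpha>" "\<alpha> < 1" using t\<^sub>1(1) by (simp_all add: \<alpha>_def)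
  have G: "(\<lambda>n. ennreal (28 / real n)) \<longlonglongrightarrow> ennreal 0"
    by (intro tendsto_ennrealI lim_const_over_n)
  let ?F = "\<lambda>n. SUP f\<^sub>0\<in>local_Hoelder t M \<eta>.
         \<integral>\<^sup>+ Y. emeasure (posterior \<Gamma> n Y)
                {\<beta> \<in> space (posterior \<Gamma> n Y).
                   (SUP x\<in>{0..1}. ereal (local_rate t n x * \<bar>haar_sum (L_max n) \<beta> x - f\<^sub>0 x\<bar>)) > ereal (M\<^sub>n n)}
           \<partial>sequence_model n (haar_coeff f\<^sub>0)"
  have "\<forall>\<^sub>F n in sequentially. D \<le> M\<^sub>n n / sqrt (ln n)" using Mn by (simp add: filterlim_at_top)
  \<comment> \<open>With exponent 1/8, ln n \<le> 8 n^(1/8) \<le> n^(1/4), hence n / ln n \<ge>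
    n^(3/4), whose cube root is n^(1/4).\<close>
  moreover have "\<forall>\<^sub>F n in sequentially. 8 \<le> real n powr (1/8)" "\<forall>\<^sub>F n in sequentially. 1 / c \<le> real n powr (1/4)"
    "\<forall>\<^sub>F n in sequentially. 4 * K\<^sup>2 \<le> real n powr (1 - \<alpha>)" "\<forall>\<^sub>F n in sequentially. K \<le> real n powr (1/2)"
    using \<alpha> by (intro eventually_le_powr; simp)+
  ultimately have "\<forall>\<^sub>F n in sequentially. ?F n \<le> ennreal (28 / real n)"
    using eventually_ge_at_top[of 3]
  proof eventually_elim
    case (elim n)
    have n0: "real n > 0" using elim by simp
    have ln1: "1 \<le> ln n" using elim by (intro ln_ge_1_nat)
    have c1: "n powr (1/4) \<le> (n / ln n) powr (1/3)"
    proof -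
      have "ln n \<le> n powr (1/8) / (1/8)" using elim by (intro ln_powr_bound) auto
      also have "\<dots> \<le> n powr (1/8) * n powr (1/8)"
        using mult_left_mono[OF elim(2), of "n powr (1/8)"] by simp
      also have "\<dots> = n powr (1/4)" by (simp add: powr_add[symmetric])
      finally have "n / n powr (1/4) \<le> n / ln n" using ln1 n0 elim by (intro divide_left_mono mult_pos_pos) auto
      also have "n / n powr (1/4) = n powr (1 - 1/4)" using n0 by (simp only: powr_diff) simp
      finally have "(n powr (3/4)) powr (1/3) \<le> (n / ln n) powr (1/3)" by (intro powr_mono2) auto
      then show ?thesis by (simp add: powr_powr)
    qed
    have c2: "2 * K\<^sup>2 * (n / ln n) powr (1 / (2 * t\<^sub>1 + 1)) \<le> n / 2"
    proof -
      have "n / ln n \<le> n / 1" using ln1 n0 elim by (intro divide_left_mono) auto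
      then have "(n / ln n) powr \<alpha> \<le> n powr \<alpha>" using ln1 \<alpha> by (intro powr_mono2) auto
      then have "4 * K\<^sup>2 * (n / ln n) powr \<alpha> \<le> n powr (1 - \<alpha>) * n powr \<alpha>" using elim by (intro mult_mono) auto
      also have "\<dots> = n" using n0 by (simp add: powr_add[symmetric])
      finally show ?thesis by (simp add: \<alpha>_def)
    qed
    have c3: "K \<le> sqrt n" using elim by (simp add: powr_half_sqrt)
    have c4: "8 * K * (detection_const \<Gamma> + 7) * sqrt (ln n) + K / (1 - 2 powr (- t\<^sub>1)) \<le> M\<^sub>n n"
    proof -
      have s1: "1 \<le> sqrt (ln n)" using ln1 by simp
      have "2 powr (- t\<^sub>1) < 1" using t\<^sub>1(1) by (simp add: powr_less_one)
      then have "0 \<le> K / (1 - 2 powr (- t\<^sub>1))" using K(1) by simp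
      then have "K / (1 - 2 powr (- t\<^sub>1)) * 1 \<le> K / (1 - 2 powr (- t\<^sub>1)) * sqrt (ln n)"
        using s1 by (intro mult_left_mono)
      then have "8 * K * (detection_const \<Gamma> + 7) * sqrt (ln n) + K / (1 - 2 powr (- t\<^sub>1)) \<le> D * sqrt (ln n)"
        unfolding D_def distrib_right by simp
      also have "\<dots> \<le> M\<^sub>n n" using elim(1) s1 by (simp add: le_divide_eq)
      finally show ?thesis .
    qed
    show ?case
    proof (rule SUP_least)
      fix f assume f: "f \<in> local_Hoelder t M \<eta>"
      have "ennreal (28 / real n ^ 2) \<le> ennreal (28 / real n)"
        using elim by (intro ennreal_leI divide_left_mono) (auto simp: power2_eq_square)
      with posterior_expectation_le[OF \<Gamma> f pos' K(2) K(1) c t\<^sub>1(1) t _ c1 elim(3) c2 c3 c4] elim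
      show "(\<integral>\<^sup>+ Y. emeasure (posterior \<Gamma> n Y)
                {\<beta> \<in> space (posterior \<Gamma> n Y).
                   (SUP x\<in>{0..1}. ereal (local_rate t n x * \<bar>haar_sum (L_max n) \<beta> x - f x\<bar>)) > ereal (M\<^sub>n n)}
           \<partial>sequence_model n (haar_coeff f)) \<le> ennreal (28 / real n)"
        using order_trans by blast
    qed
  qed
  then have le: "\<forall>\<^sub>F n in sequentially. ?F n \<le> ennreal (28 / real n)" .
  show "?F \<longlonglongrightarrow> 0"
  proof (rule tendsto_sandwich[OF _ le tendsto_const])
    show "(\<lambda>n. ennreal (28 / real n)) \<longlonglongrightarrow> 0" using G by simp
  qed simp
qed simp

end
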